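(* Let $(a,k,n)\in[0,\frac\pi{2N}]\times\mathbb Z_N\times\mathbb N$. (i) $G^a_{k,4n}$ is a periodic gap. (ii) $G^a_{k,2n-1}$ is a p-mix gap. If $s_k\ne0$, then $G^a_{k,2n-1}=\emptyset$ for all $n\ge n_0$, for some $n_0\ge1$. (iii) $G^a_{k,4n-2}$ is an antiperiodic, resonance, or r-mix gap. Moreover, for some $n_0\ge1$: - if $s_k=0$, then each $G^a_{k,4n-2}$ is either an antiperiodic gap or empty, and $G^a_{k,4n-2}=\emptyset$ for $n\ge n_0$; - if $c_k\ne0$ and $s_k\ne0$, then $G^a_{k,4n-2}$ is a resonance gap for $n\ge n_0$; - if $c_k=0$, then all $G^a_{k,4n-2}$ are antiperiodic gaps. If in addition $q(1-t)=q(t)$, then for all $n\ge1$: - if $s_k=0$, then $E^{k,-}_{1,2n-1}=E^{k,+}_{1,2n-1}=\eta_n$ and $G^a_{k,4n-2}=\emptyset$; - if $c_k\ne0$ and $s_k\ne0$, then $G^a_{k,4n-2}$ is a resonance gap.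
   Context: Fix an integer $N\ge1$ and a real potential $q\in L^2(0,1)$. Hill-equation data. For $\lambda\in\mathbb C$, let $\vartheta,\varphi$ solve $-y''+qy=\lambda y$ with $\vartheta(0)=\varphi'(0)=1$ and $\vartheta'(0)=\varphi(0)=0$. Put $F=(\varphi'(1,\cdot)+\vartheta(1,\cdot))/2$ and $F_-=(\varphi'(1,\cdot)-\vartheta(1,\cdot))/2$. The zeros of $F$ are $\eta_1<\eta_2<\cdots$. Operator $H_k^a$. Let $a_1',a_2'\in\mathbb R$ with $a=a_1'+a_2'$, let $s=e^{2\pi i/N}$ and $k\in\mathbb Z_N$. Set $c_k=\cos(\pi k/N+a)$ and $s_k=\sin(\pi k/N+a)$. $H_k^a$ acts in $L^2(\Gamma^1)$, where $\Gamma^1$ has edges $\Gamma_{n,j}$, $(n,j)\in\mathbb Z\times\{1,\dots,6\}$, each identified with $[0,1]$, by $-f''_{n,j}+qf_{n,j}$, with boundary conditions for all $n$: - $e^{ia_1'}f_{n,1}(1)=f_{n,2}(0)=f_{n,5}(0)$; - $e^{ia_2'}f_{n,2}(1)=f_{n,3}(0)=f_{n,6}(0)$; - $e^{ia_1'}f_{n,3}(1)=f_{n,4}(0)=e^{ia_1'}f_{n-1,6}(1)$; - $e^{ia_2'}s^kf_{n,4}(1)=f_{n,1}(0)=e^{-ia_1'}f_{n-1,5}(1)$; - $e^{ia_1'}f'_{n,1}(1)=f'_{n,2}(0)+f'_{n,5}(0)$; - $e^{ia_2'}f'_{n,2}(1)=f'_{n,3}(0)+f'_{n,6}(0)$; -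 $e^{ia_1'}f'_{n,3}(1)+e^{ia_1'}f'_{n-1,6}(1)=f'_{n,4}(0)$; - $e^{ia_2'}s^kf'_{n,4}(1)+e^{-ia_1'}f'_{n-1,5}(1)=f'_{n,1}(0)$. Lyapunov functions. $F_{k,\nu}=\xi_k-(-1)^\nu\sqrt{\rho_k}$, with $\xi_k=\frac{9F^2-F_-^2-1}2-s_k^2$ and $\rho_k=(9F^2-s_k^2)c_k^2+s_k^2F_-^2$, and $\sqrt{\rho_k}>0$ where $\rho_k>0$. Set $D_k^\pm=4(F_{k,1}\mp1)(F_{k,2}\mp1)$. Eigenvalue labeling. The zeros of $D_k^+$ are labeled $$\lambda^{k,+}_{2,0}\le\lambda^{k,+}_{1,0}\le\lambda^{k,-}_{1,2}\le\lambda^{k,-}_{2,2}\le\lambda^{k,+}_{2,2}\le\lambda^{k,+}_{1,2}\le\cdots.$$ The zeros of $D_k^-$ are labeled $$\lambda^{k,-}_{2,1}\le\lambda^{k,-}_{1,1}\le\lambda^{k,+}_{1,1}\le\lambda^{k,+}_{2,1}\le\cdots.$$ Both lists are real and counted with multiplicity. An unadorned $\lambda^{0,\pm}_{\nu,p}$ with $p$ odd means its value at $k=0$, $a=0$. Intervals, resonances and band edges. - $\varkappa_n=(\lambda^{0,-}_{1,2n-1},\lambda^{0,+}_{1,2n-1})$. - $r^\mp_{k,n}$ is the smallest/largest zero of $\rho_k$ in $\overline{\varkappa_n}$. - $v_k=|F_-|-c_k^2$. - With $p=2n-1$: - $E^{k,\pm}_{\nu,p-1}=\lambda^{k,\pm}_{\nu,p-1}$;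 - $E^{k,\pm}_{2,p}=\lambda^{0,\pm}_{2,p}$; - $E^{k,\pm}_{1,p}=\lambda^{0,\pm}_{1,p}$ if $v_k(\lambda^{0,\pm}_{1,p})\ge0$, and $E^{k,\pm}_{1,p}=r^\pm_{k,n}$ otherwise. Gaps. - $G^a_{k,4n}=(E^{k,-}_{2,2n},E^{k,+}_{2,2n})$; - $G^a_{k,4n-2}=(E^{k,-}_{1,2n-1},E^{k,+}_{1,2n-1})$; - $G^a_{k,4n-3}=(E^{k,-}_{2,2n-1},E^{k,+}_{1,2n-2})$; - $G^a_{k,4n-1}=(E^{k,-}_{1,2n},E^{k,+}_{2,2n-1})$. An interval $(x,y)$ with $x\ge y$ is empty. Gap types. A gap $(\lambda_1,\lambda_2)$ is: - periodic (resp. antiperiodic) if both endpoints are zeros of $D_k^+$ (resp. $D_k^-$); - a resonance gap if both endpoints are zeros of $\rho_k$; - p-mix (resp. r-mix) if one endpoint is a zero of $D_k^-$ and the other is a zero of $D_k^+$ (resp. of $\rho_k$). *)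

theory Defs
  imports "HOL-Analysis.Analysis"
begin

text \<open>y solves -y'' + q y = lam y on [0,1] with y(0)=y0, y'(0)=y1, in the
  Caratheodory sense, written as the equivalent Volterra integral equation.\<close>
definition is_sol :: "(real \<Rightarrow> real) \<Rightarrow> real \<Rightarrow> real \<Rightarrow> real \<Rightarrow> (real \<Rightarrow> real) \<Rightarrow> bool" where
  "is_sol q lam y0 y1 y \<longleftrightarrow>
     continuous_on {0..1} y \<and>
     set_integrable lborel {0..1} (\<lambda>s. (q s - lam) * y s) \<and>
     (\<forall>t\<in>{0..1}. y t = y0 + y1 * t + (LINT s:{0..t}|lborel. (t - s) * (q s - lam) * y s))"

definition sol_val1 :: "(real \<Rightarrow> real) \<Rightarrow> real \<Rightarrow> real \<Rightarrow> real \<Rightarrow> real" where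
  "sol_val1 q lam y0 y1 = (THE c. \<exists>y. is_sol q lam y0 y1 y \<and> y 1 = c)"

definition sol_der1 :: "(real \<Rightarrow> real) \<Rightarrow> real \<Rightarrow> real \<Rightarrow> real \<Rightarrow> real" where
  "sol_der1 q lam y0 y1 =
     (THE c. \<exists>y. is_sol q lam y0 y1 y \<and> c = y1 + (LINT s:{0..1}|lborel. (q s - lam) * y s))"

definition theta1 :: "(real \<Rightarrow> real) \<Rightarrow> real \<Rightarrow> real" where
  "theta1 q lam = sol_val1 q lam 1 0"

definition phid1 :: "(real \<Rightarrow> real) \<Rightarrow> real \<Rightarrow> real" where
  "phid1 q lam = sol_der1 q lam 0 1"

definition Fp :: "(real \<Rightarrow> real) \<Rightarrow> real \<Rightarrow> real" where
  "Fp q lam = (phid1 q lam + theta1 q lam) / 2"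

definition Fm :: "(real \<Rightarrow> real) \<Rightarrow> real \<Rightarrow> real" where
  "Fm q lam = (phid1 q lam - theta1 q lam) / 2"

definition eta :: "(real \<Rightarrow> real) \<Rightarrow> nat \<Rightarrow> real" where
  "eta q n = (THE x. Fp q x = 0 \<and> card {y. y < x \<and> Fp q y = 0} = n - 1)"

definition ck :: "nat \<Rightarrow> nat \<Rightarrow> real \<Rightarrow> real" where
  "ck N k a = cos (pi * real k / real N + a)"

definition sk :: "nat \<Rightarrow> nat \<Rightarrow> real \<Rightarrow> real" where
  "sk N k a = sin (pi * real k / real N + a)"

definition xik :: "(real \<Rightarrow> real) \<Rightarrow> nat \<Rightarrow> nat \<Rightarrow> real \<Rightarrow> real \<Rightarrow> real" where
  "xik q N k a lam = (9 * (Fp q lam)\<^sup>2 - (Fm q lam)\<^sup>2 - 1) / 2 - (sk N k a)\<^sup>2"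

definition rhok :: "(real \<Rightarrow> real) \<Rightarrow> nat \<Rightarrow> nat \<Rightarrow> real \<Rightarrow> real \<Rightarrow> real" where
  "rhok q N k a lam = (9 * (Fp q lam)\<^sup>2 - (sk N k a)\<^sup>2) * (ck N k a)\<^sup>2
                      + (sk N k a)\<^sup>2 * (Fm q lam)\<^sup>2"

text \<open>D_k^+ = 4 (F_{k,1} - 1)(F_{k,2} - 1) and D_k^- = 4 (F_{k,1} + 1)(F_{k,2} + 1),
  with F_{k,nu} = xi_k -(-1)^nu sqrt rho_k; the products multiply out to
  4((xi_k -+ 1)^2 - rho_k).\<close>
definition Dplus :: "(real \<Rightarrow> real) \<Rightarrow> nat \<Rightarrow> nat \<Rightarrow> real \<Rightarrow> real \<Rightarrow> real" where
  "Dplus q N k a lam = 4 * ((xik q N k a lam - 1)\<^sup>2 - rhok q N k a lam)"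

definition Dminus :: "(real \<Rightarrow> real) \<Rightarrow> nat \<Rightarrow> nat \<Rightarrow> real \<Rightarrow> real \<Rightarrow> real" where
  "Dminus q N k a lam = 4 * ((xik q N k a lam + 1)\<^sup>2 - rhok q N k a lam)"

definition vk :: "(real \<Rightarrow> real) \<Rightarrow> nat \<Rightarrow> nat \<Rightarrow> real \<Rightarrow> real \<Rightarrow> real" where
  "vk q N k a lam = \<bar>Fm q lam\<bar> - (ck N k a)\<^sup>2"

definition zmult :: "(real \<Rightarrow> real) \<Rightarrow> real \<Rightarrow> nat" where
  "zmult D x = (LEAST m. (deriv ^^ m) D x \<noteq> 0)"

definition zcount_below :: "(real \<Rightarrow> real) \<Rightarrow> real \<Rightarrow> nat" where
  "zcount_below D x = (\<Sum>y\<in>{y. y < x \<and> D y = 0}. zmult D y)"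

definition zseq :: "(real \<Rightarrow> real) \<Rightarrow> nat \<Rightarrow> real" where
  "zseq D j = (THE x. D x = 0 \<and> zcount_below D x \<le> j \<and> j < zcount_below D x + zmult D x)"

text \<open>Position of lambda^{k,sigma}_{nu,p} (sigma = True for +, False for -) in the
  list of zeros: D_k^+ for p even, D_k^- for p odd.\<close>
definition lab_idx :: "bool \<Rightarrow> nat \<Rightarrow> nat \<Rightarrow> nat" where
  "lab_idx sg nu p =
     (if even p then
        (if sg then 2 * p + (if nu = 2 then 0 else 1)
               else 2 * p - 2 + (if nu = 1 then 0 else 1))
      else
        (if sg then 2 * p + (if nu = 1 then 0 else 1)
               else 2 * p - 2 + (if nu = 2 then 0 else 1)))"

definition lam :: "(real \<Rightarrow> real) \<Rightarrow> nat \<Rightarrow> nat \<Rightarrow> real \<Rightarrow> bool \<Rightarrow> nat \<Rightarrow> nat \<Rightarrow> real" where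
  "lam q N k a sg nu p =
     zseq (if even p then Dplus q N k a else Dminus q N k a) (lab_idx sg nu p)"

text \<open>r^{-}_{k,n} (sg = False): smallest, r^{+}_{k,n} (sg = True): largest zero of rho_k
  in the closure of kappa_n.\<close>
definition rres :: "(real \<Rightarrow> real) \<Rightarrow> nat \<Rightarrow> nat \<Rightarrow> real \<Rightarrow> bool \<Rightarrow> nat \<Rightarrow> real" where
  "rres q N k a sg n =
     (let Z = {x. lam q N 0 0 False 1 (2 * n - 1) \<le> x \<and> x \<le> lam q N 0 0 True 1 (2 * n - 1)
                  \<and> rhok q N k a x = 0}
      in if sg then Max Z else Min Z)"

definition Eedge :: "(real \<Rightarrow> real) \<Rightarrow> nat \<Rightarrow> nat \<Rightarrow> real \<Rightarrow> bool \<Rightarrow> nat \<Rightarrow> nat \<Rightarrow> real" where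
  "Eedge q N k a sg nu p =
     (if even p then lam q N k a sg nu p
      else if nu = 2 then lam q N 0 0 sg 2 p
      else if vk q N k a (lam q N 0 0 sg 1 p) \<ge> 0 then lam q N 0 0 sg 1 p
      else rres q N k a sg ((p + 1) div 2))"

definition gap :: "(real \<Rightarrow> real) \<Rightarrow> nat \<Rightarrow> nat \<Rightarrow> real \<Rightarrow> nat \<Rightarrow> real \<times> real" where
  "gap q N k a m =
     (if m mod 4 = 0 then
        (let n = m div 4 in (Eedge q N k a False 2 (2 * n), Eedge q N k a True 2 (2 * n)))
      else if m mod 4 = 2 then
        (let n = (m + 2) div 4 in (Eedge q N k a False 1 (2 * n - 1), Eedge q N k a True 1 (2 * n - 1)))
      else if m mod 4 = 1 then
        (let n = (m + 3) div 4 in (Eedge q N k a False 2 (2 * n - 1), Eedge q N k a True 1 (2 * n - 2)))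
      else
        (let n = (m + 1) div 4 in (Eedge q N k a False 1 (2 * n), Eedge q N k a True 2 (2 * n - 1))))"

definition empty_gap :: "real \<times> real \<Rightarrow> bool" where
  "empty_gap g \<longleftrightarrow> fst g \<ge> snd g"

definition periodic_gap :: "(real \<Rightarrow> real) \<Rightarrow> nat \<Rightarrow> nat \<Rightarrow> real \<Rightarrow> real \<times> real \<Rightarrow> bool" where
  "periodic_gap q N k a g \<longleftrightarrow> Dplus q N k a (fst g) = 0 \<and> Dplus q N k a (snd g) = 0"

definition antiperiodic_gap :: "(real \<Rightarrow> real) \<Rightarrow> nat \<Rightarrow> nat \<Rightarrow> real \<Rightarrow> real \<times> real \<Rightarrow> bool" where
  "antiperiodic_gap q N k a g \<longleftrightarrow> Dminus q N k a (fst g) = 0 \<and> Dminus q N k a (snd g) = 0"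

definition resonance_gap :: "(real \<Rightarrow> real) \<Rightarrow> nat \<Rightarrow> nat \<Rightarrow> real \<Rightarrow> real \<times> real \<Rightarrow> bool" where
  "resonance_gap q N k a g \<longleftrightarrow> rhok q N k a (fst g) = 0 \<and> rhok q N k a (snd g) = 0"

definition pmix_gap :: "(real \<Rightarrow> real) \<Rightarrow> nat \<Rightarrow> nat \<Rightarrow> real \<Rightarrow> real \<times> real \<Rightarrow> bool" where
  "pmix_gap q N k a g \<longleftrightarrow>
     (Dminus q N k a (fst g) = 0 \<and> Dplus q N k a (snd g) = 0) \<or>
     (Dplus q N k a (fst g) = 0 \<and> Dminus q N k a (snd g) = 0)"

definition rmix_gap :: "(real \<Rightarrow> real) \<Rightarrow> nat \<Rightarrow> nat \<Rightarrow> real \<Rightarrow> real \<times> real \<Rightarrow> bool" where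
  "rmix_gap q N k a g \<longleftrightarrow>
     (Dminus q N k a (fst g) = 0 \<and> rhok q N k a (snd g) = 0) \<or>
     (rhok q N k a (fst g) = 0 \<and> Dminus q N k a (snd g) = 0)"

end

theory Submission
  imports Defs "HOL-Complex_Analysis.Complex_Analysis"
begin

text \<open>
  Write \<open>F = (\<phi>' + \<theta>)/2\<close> and \<open>G = (\<phi>' - \<theta>)/2\<close> at the point 1, so that \<open>F\<^sup>2 = 1 + G\<^sup>2 + \<theta>' \<phi>\<close>. Then
  \<open>D_k\<^sup>-\<close> is the product of the four factors \<open>3 F \<plusminus> 1 \<plusminus> G\<close>, independently of \<open>k\<close> and \<open>a\<close>, and
  \<open>D_k\<^sup>+\<close> is the product of the four factors \<open>3 F \<plusminus> sqrt (5 + G\<^sup>2 \<plusminus> 2 sqrt (G\<^sup>2 + 4 c_k\<^sup>2))\<close>.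
  As for Hill's discriminant, a combination \<open>b1 \<theta> + b2 \<phi>'\<close> with positive weights is strictly
  monotone in \<open>\<lambda>\<close> wherever its modulus is below \<open>2 sqrt (b1 b2)\<close>. Applied to the tangents of the
  level curves, this shows that every factor has exactly one zero, and a simple one, between
  consecutive Dirichlet eigenvalues, provided \<open>s_k \<noteq> 0\<close> in the case of \<open>D_k\<^sup>+\<close>. So both spectra come
  in groups of four, which fixes all labels.
  Since \<open>G\<close> tends to 0 at infinity, the \<open>D_k\<^sup>+\<close> zeros eventually lie outside the span of the
  \<open>D_k\<^sup>-\<close> zeros of the same group, which closes the p-mix gaps. The zero set of \<open>\<rho>_k\<close> is an ellipse
  inscribed in the diamond \<open>\<bar>3 F\<bar> + \<bar>G\<bar> \<le> 1\<close> whose boundary carries the antiperiodic eigenvalues;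
  the condition \<open>v_k < 0\<close> says that the spectral curve enters or leaves the diamond in a corner
  that is cut off by the ellipse, which forces a resonance.
\<close>

section \<open>Linear initial value problems\<close>

text \<open>Labels count zeros with multiplicity from the bottom of the spectrum, so locating a
  labelled zero requires the exact number of zeros below it. Dirichlet eigenvalues supply the frame:
  there F^2 = 1 + G^2, and F alternates in sign from one to the next, so 3 F dominates every level
  curve R with R(G)^2 < 9 + 9 G^2, and each factor must vanish in between. The exclusion of s_k = 0
  comes from this bound. For c_k^2 = 1 the outer level curve 9 F^2 = 5 + G^2 + 2 sqrt (G^2 + 4)
  touches the hyperbola 9 F^2 = 9 + 9 G^2 at G = 0: a zero of D_k^+ may then coincide with a
  Dirichlet eigenvalue, and the grouping breaks down. What is claimed about D_k^+ for every k is
  therefore reduced to the fact that labelled points are zeros, which follows from one zero per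
  interval, found on the inner curve. All spectral facts enter through the locale
  \<open>hill\<close>, whose assumptions speak only of functions of the spectral parameter; the
  differential equation is confined to its instantiation.\<close>

lemma lipschitz_ivp_exists:
  fixes f :: "real \<Rightarrow> 'a::banach \<Rightarrow> 'a"
  assumes cont: "\<And>x. continuous_on {0..1} x \<Longrightarrow> continuous_on {0..1} (\<lambda>t. f t (x t))"
    and lip: "\<And>t u v. t \<in> {0..1} \<Longrightarrow> norm (f t u - f t v) \<le> L * norm (u - v)"
  obtains x where "x 0 = x0"
    "\<And>t. t \<in> {0..1} \<Longrightarrow> (x has_vector_derivative f t (x t)) (at t within {0..1})"
proof -
  define K where "K = max L 1"
  have K: "K > 0" "\<And>t u v. t \<in> {0..1} \<Longrightarrow> norm (f t u - f t v) \<le> K * norm (u - v)"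
  proof -
    show "norm (f t u - f t v) \<le> K * norm (u - v)" if "t \<in> {0..1}" for t u v
      using lip[OF that, of u v] mult_right_mono[of L K "norm (u - v)"] by (simp add: K_def)
  qed (simp add: K_def)
  define X where "X = rec_nat (\<lambda>_. x0) (\<lambda>n x t. x0 + integral {0..t} (\<lambda>s. f s (x s)))"
  have X0: "X 0 = (\<lambda>_. x0)" and XS: "X (Suc n) = (\<lambda>t. x0 + integral {0..t} (\<lambda>s. f s (X n s)))" for n
    by (simp_all add: X_def)
  have Xc: "continuous_on {0..1} (X n)" for n
  proof (induction n)
    case (Suc n)
    show ?case unfolding XS
      by (intro continuous_intros indefinite_integral_continuous_1 integrable_continuous_real cont Suc)
  qed (simp add: X0)
  have fXc: "continuous_on {0..1} (\<lambda>s. f s (X n s))" for n by (rule cont[OF Xc])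
  have fXi: "(\<lambda>s. f s (X n s)) integrable_on {0..t}" if "t \<in> {0..1}" for n t
    using that by (intro integrable_continuous_real continuous_on_subset[OF fXc]) auto
  have "compact ((\<lambda>t. X 1 t - X 0 t) ` {0..1})"
    by (intro compact_continuous_image continuous_intros Xc compact_Icc)
  then obtain C where C: "\<And>t. t \<in> {0..1} \<Longrightarrow> norm (X 1 t - X 0 t) \<le> C"
    by (meson bounded_iff compact_imp_bounded imageI)
  have C0: "C \<ge> 0" using order_trans[OF norm_ge_zero C[of 0]] by simp
  \<comment> \<open>The weight \<open>exp (2*K*t)\<close> makes every Picard step a contraction by
    1/2 on all of \<open>{0..1}\<close>, so the interval is not subdivided.\<close>
  have step: "norm (X (Suc n) t - X n t) \<le> C * (1/2)^n * exp (2*K*t)" if "t \<in> {0..1}" for n t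
    using that
  proof (induction n arbitrary: t)
    case 0
    have "C * 1 \<le> C * exp (2*K*t)" using 0 C0 K by (intro mult_left_mono) auto
    then show ?case using C[OF 0] by simp
  next
    case (Suc n)
    let ?E = "\<lambda>s. C * (1/2)^n * exp (2*K * s)"
    have I: "((\<lambda>s. K * ?E s) has_integral (?E t / 2 - ?E 0 / 2)) {0..t}"
    proof (rule fundamental_theorem_of_calculus)
      show "0 \<le> t" using Suc.prems by simp
      show "((\<lambda>s. ?E s / 2) has_vector_derivative K * ?E s) (at s within {0..t})" for s
        unfolding has_real_derivative_iff_has_vector_derivative[symmetric]
        by (auto intro!: derivative_eq_intros)
    qed
    have "norm (X (Suc (Suc n)) t - X (Suc n) t)
        = norm (integral {0..t} (\<lambda>s. f s (X (Suc n) s) - f s (X n s)))"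
      using fXi[OF Suc.prems] fun_cong[OF XS[of "Suc n"], of t] fun_cong[OF XS[of n], of t]
      by (simp add: integral_diff)
    also have "\<dots> \<le> integral {0..t} (\<lambda>s. K * ?E s)"
    proof (rule integral_norm_bound_integral)
      show "(\<lambda>s. f s (X (Suc n) s) - f s (X n s)) integrable_on {0..t}"
        using fXi[OF Suc.prems] by (intro integrable_diff)
      show "(\<lambda>s. K * ?E s) integrable_on {0..t}" using I by blast
      fix s assume s: "s \<in> {0..t}"
      then have s1: "s \<in> {0..1}" using Suc.prems by auto
      show "norm (f s (X (Suc n) s) - f s (X n s)) \<le> K * ?E s"
        using K(2)[OF s1, of "X (Suc n) s" "X n s"] mult_left_mono[OF Suc.IH[OF s1], of K] K(1)
        by linarith
    qed
    also have "\<dots> = ?E t / 2 - ?E 0 / 2" using I by blast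
    also have "\<dots> \<le> ?E t / 2" using C0 by simp
    finally show ?case by simp
  qed
  have "uniform_limit {0..1} (\<lambda>n t. \<Sum>i<n. X (Suc i) t - X i t) (\<lambda>t. \<Sum>i. X (Suc i) t - X i t) sequentially"
  proof (rule Weierstrass_m_test)
    fix n t assume t: "t \<in> {0..1::real}"
    have "exp (2*K*t) \<le> exp (2*K)" using t K by (simp add: mult_le_cancel_left1)
    then have "C * (1/2)^n * exp (2*K*t) \<le> C * (1/2)^n * exp (2*K)"
      using C0 by (intro mult_left_mono) auto
    then show "norm (X (Suc n) t - X n t) \<le> C * (1/2)^n * exp (2*K)" using step[OF t, of n] by linarith
  next
    show "summable (\<lambda>n. C * (1/2)^n * exp (2*K))"
      by (intro summable_mult summable_mult2 summable_geometric) auto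
  qed
  moreover define x where "x = (\<lambda>t. x0 + (\<Sum>i. X (Suc i) t - X i t))"
  ultimately have "uniform_limit {0..1} (\<lambda>n t. x0 + (\<Sum>i<n. X (Suc i) t - X i t)) x sequentially"
    by (auto intro!: uniform_limit_intros)
  moreover have "x0 + (\<Sum>i<n. X (Suc i) t - X i t) = X n t" for n t
    by (induction n) (auto simp: X0 algebra_simps)
  ultimately have U: "uniform_limit {0..1} X x sequentially" by simp
  have xc: "continuous_on {0..1} x"
    by (rule uniform_limit_theorem[OF _ U]) (auto simp: Xc)
  have fxc: "continuous_on {0..1} (\<lambda>s. f s (x s))" by (rule cont[OF xc])
  have V: "uniform_limit {0..1} (\<lambda>n s. f s (X n s)) (\<lambda>s. f s (x s)) sequentially"
  proof (rule uniform_limitI)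
    fix e :: real assume e: "e > 0"
    have "\<forall>\<^sub>F n in sequentially. \<forall>t\<in>{0..1}. dist (X n t) (x t) < e / K"
      using uniform_limitD[OF U] e K by simp
    then show "\<forall>\<^sub>F n in sequentially. \<forall>t\<in>{0..1}. dist (f t (X n t)) (f t (x t)) < e"
    proof eventually_elim
      case (elim n)
      show ?case
      proof
        fix t :: real assume t: "t \<in> {0..1}"
        have "norm (X n t - x t) < e / K" using elim t by (simp add: dist_norm)
        then have "K * norm (X n t - x t) < e" using K(1) by (simp add: field_simps)
        then show "dist (f t (X n t)) (f t (x t)) < e"
          using K(2)[OF t, of "X n t" "x t"] by (simp add: dist_norm)
      qed
    qed
  qed
  have xeq: "x t = x0 + integral {0..t} (\<lambda>s. f s (x s))" if t: "t \<in> {0..1}" for t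
  proof -
    have sub: "{0..t} \<subseteq> {0..1}" using t by auto
    obtain I J where I: "\<And>n. ((\<lambda>s. f s (X n s)) has_integral I n) {0..t}"
      and J: "((\<lambda>s. f s (x s)) has_integral J) {0..t}" "I \<longlonglongrightarrow> J"
      by (rule uniform_limit_integral[OF uniform_limit_on_subset[OF V sub]
            continuous_on_subset[OF fXc sub]]) auto
    have "(\<lambda>n. X (Suc n) t) \<longlonglongrightarrow> x0 + J"
      unfolding XS using integral_unique[OF I] tendsto_add[OF tendsto_const J(2)] by simp
    moreover have "(\<lambda>n. X (Suc n) t) \<longlonglongrightarrow> x t"
      by (rule LIMSEQ_Suc[OF tendsto_uniform_limitI[OF U t]])
    ultimately have "x t = x0 + J" by (intro LIMSEQ_unique)
    then show ?thesis using integral_unique[OF J(1)] by simp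
  qed
  show ?thesis
  proof (rule that)
    show "x 0 = x0" using xeq[of 0] by simp
    fix t :: real assume t: "t \<in> {0..1}"
    have "((\<lambda>t. x0 + integral {0..t} (\<lambda>s. f s (x s))) has_vector_derivative f t (x t)) (at t within {0..1})"
      using integral_has_vector_derivative[OF fxc t] by (auto intro!: derivative_eq_intros)
    then show "(x has_vector_derivative f t (x t)) (at t within {0..1})"
      by (rule has_vector_derivative_transform[OF t, rotated]) (use xeq in auto)
  qed
qed

text \<open>Squaring keeps the norm differentiable at zeros of \<open>x\<close>; Young's inequality
  for the cross term with \<open>E\<close> costs the \<open>+1\<close> in the exponent.
  \<open>E = 0\<close> gives uniqueness and bounds, \<open>E\<close> proportional to
  \<open>norm (z - w)\<close> gives the dependence on the parameter.\<close>

lemma gronwall_sq: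
  fixes x x' :: "real \<Rightarrow> 'a::real_inner"
  assumes der: "\<And>t. t \<in> {0..1} \<Longrightarrow> (x has_vector_derivative x' t) (at t within {0..1})"
    and bd: "\<And>t. t \<in> {0..1} \<Longrightarrow> norm (x' t) \<le> B * norm (x t) + E"
    and B: "B \<ge> 0" and E: "E \<ge> 0" and t: "t \<in> {0..1}"
  shows "(norm (x t))\<^sup>2 \<le> exp (2*B+1) * ((norm (x 0))\<^sup>2 + E\<^sup>2)"
proof -
  define u where "u = (\<lambda>t. exp (-((2*B+1) * t)) * (x t \<bullet> x t) - E\<^sup>2 * t)"
  define u' where "u' = (\<lambda>t. exp (-((2*B+1) * t)) * (2 * (x t \<bullet> x' t) - (2*B+1) * (x t \<bullet> x t)) - E\<^sup>2)"
  have du: "(u has_vector_derivative u' s) (at s within {0..1})" if "s \<in> {0..1}" for s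
    unfolding u_def u'_def
    by (rule derivative_eq_intros der[OF that] has_vector_derivative_real_field refl
        bounded_bilinear.has_vector_derivative[OF bounded_bilinear_inner]
       | simp add: has_real_derivative_iff_has_vector_derivative[symmetric] inner_commute algebra_simps)+
  have neg: "u' s \<le> 0" if s: "s \<in> {0..1}" for s
  proof -
    have "x s \<bullet> x' s \<le> norm (x s) * norm (x' s)" by (rule norm_cauchy_schwarz)
    also have "\<dots> \<le> norm (x s) * (B * norm (x s) + E)" using bd[OF s] by (intro mult_left_mono) auto
    finally have "2 * (x s \<bullet> x' s) \<le> 2 * B * (norm (x s))\<^sup>2 + 2 * (norm (x s) * E)"
      by (simp add: algebra_simps power2_eq_square)
    moreover have "2 * (norm (x s) * E) \<le> (norm (x s))\<^sup>2 + E\<^sup>2"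
      using sum_squares_bound[of "norm (x s)" E] by simp
    ultimately have "2 * (x s \<bullet> x' s) - (2*B+1) * (x s \<bullet> x s) \<le> E\<^sup>2"
      by (simp add: dot_square_norm algebra_simps)
    then have "exp (-((2*B+1) * s)) * (2 * (x s \<bullet> x' s) - (2*B+1) * (x s \<bullet> x s)) \<le> exp (-((2*B+1) * s)) * E\<^sup>2"
      by (intro mult_left_mono) auto
    also have "\<dots> \<le> 1 * E\<^sup>2" using B s by (intro mult_right_mono) auto
    finally show ?thesis by (simp add: u'_def)
  qed
  have "u t \<le> u 0"
  proof (rule ccontr)
    assume "\<not> u t \<le> u 0"
    then have t0: "0 < t" using t by (cases "t = 0") auto
    have "\<exists>s\<in>{0<..<t}. u t - u 0 = (\<lambda>h. h *\<^sub>R u' s) (t - 0)"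
    proof (rule mvt_simple[OF t0])
      fix s :: real assume "0 \<le> s" "s \<le> t"
      then show "(u has_derivative (\<lambda>h. h *\<^sub>R u' s)) (at s within {0..t})"
        using has_vector_derivative_within_subset[OF du[of s], of "{0..t}"] t
        by (simp add: has_vector_derivative_def)
    qed
    then obtain s where "0 < s" "s < t" "u t - u 0 = t * u' s" by auto
    then show False using neg[of s] t \<open>\<not> u t \<le> u 0\<close> mult_nonneg_nonpos[of t "u' s"] by auto
  qed
  then have "exp (-((2*B+1) * t)) * (x t \<bullet> x t) \<le> (x 0 \<bullet> x 0) + E\<^sup>2 * t" by (simp add: u_def)
  also have "\<dots> \<le> (x 0 \<bullet> x 0) + E\<^sup>2" using t by (simp add: mult_left_le)
  finally have "exp ((2*B+1) * t) * (exp (-((2*B+1) * t)) * (x t \<bullet> x t)) \<le> exp ((2*B+1) * t) * ((x 0 \<bullet> x 0) + E\<^sup>2)"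
    by (intro mult_left_mono) auto
  also have "exp ((2*B+1) * t) * (exp (-((2*B+1) * t)) * (x t \<bullet> x t)) = x t \<bullet> x t"
    by (simp add: exp_minus)
  also have "exp ((2*B+1) * t) * ((x 0 \<bullet> x 0) + E\<^sup>2) \<le> exp (2*B+1) * ((x 0 \<bullet> x 0) + E\<^sup>2)"
    using t B by (intro mult_right_mono) (auto simp: mult_left_le)
  finally show ?thesis by (simp add: dot_square_norm)
qed

section \<open>The quasi-derivative system\<close>

text \<open>The system satisfied by \<open>(y, y' - Q y)\<close> when \<open>- y'' + Q' y = z y\<close>: the quasi-derivative
  \<open>y' - Q y\<close> makes the coefficients continuous although \<open>Q'\<close> is only integrable.\<close>
definition qsys :: "(real \<Rightarrow> real) \<Rightarrow> complex \<Rightarrow> real \<Rightarrow> complex \<times> complex \<Rightarrow> complex \<times> complex" where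
  "qsys Q z t u = (of_real (Q t) * fst u + snd u, -(z + of_real ((Q t)\<^sup>2)) * fst u - of_real (Q t) * snd u)"

definition is_qsol :: "(real \<Rightarrow> real) \<Rightarrow> complex \<Rightarrow> complex \<times> complex \<Rightarrow> (real \<Rightarrow> complex \<times> complex) \<Rightarrow> bool" where
  "is_qsol Q z x0 x \<longleftrightarrow>
     x 0 = x0 \<and> (\<forall>t\<in>{0..1}. (x has_vector_derivative qsys Q z t (x t)) (at t within {0..1}))"

text \<open>The equation constrains a solution on \<open>{0..1}\<close> only, hence a choice by
  \<open>SOME\<close>; on that interval the values do not depend on it
  (\<open>is_qsol_unique\<close>).\<close>

definition qsol :: "(real \<Rightarrow> real) \<Rightarrow> complex \<Rightarrow> complex \<times> complex \<Rightarrow> real \<Rightarrow> complex \<times> complex" where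
  "qsol Q z x0 = (SOME x. is_qsol Q z x0 x)"

lemma qsys_diff: "qsys Q z t u - qsys Q z t v = qsys Q z t (u - v)"
  by (simp add: qsys_def algebra_simps)

lemma norm_fst_le_norm: "norm (fst u) \<le> norm u" and norm_snd_le_norm: "norm (snd u) \<le> norm u"
  by (metis norm_fst_le surjective_pairing) (metis norm_snd_le surjective_pairing)

lemma norm_qsys_le:
  assumes "\<bar>Q t\<bar> \<le> K"
  shows "norm (qsys Q z t u) \<le> (2*K + 1 + K\<^sup>2 + norm z) * norm u"
proof -
  have f: "norm (fst u) \<le> norm u" and s: "norm (snd u) \<le> norm u"
    by (rule norm_fst_le_norm norm_snd_le_norm)+
  have K: "K \<ge> 0" using assms by linarith
  have Q2: "(Q t)\<^sup>2 \<le> K\<^sup>2" using assms by (simp add: abs_le_square_iff[symmetric])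
  have "norm (qsys Q z t u) \<le> norm (of_real (Q t) * fst u + snd u)
      + norm (-(z + of_real ((Q t)\<^sup>2)) * fst u - of_real (Q t) * snd u)"
    unfolding qsys_def by (rule norm_Pair_le)
  also have "norm (of_real (Q t) * fst u + snd u) \<le> \<bar>Q t\<bar> * norm (fst u) + norm (snd u)"
    by (rule order_trans[OF norm_triangle_ineq]) (simp add: norm_mult)
  also have "\<bar>Q t\<bar> * norm (fst u) + norm (snd u) \<le> K * norm u + norm u"
    using assms f s K by (intro add_mono mult_mono) auto
  also have "norm (-(z + of_real ((Q t)\<^sup>2)) * fst u - of_real (Q t) * snd u)
      \<le> (norm z + (Q t)\<^sup>2) * norm (fst u) + \<bar>Q t\<bar> * norm (snd u)"
  proof (rule order_trans[OF norm_triangle_ineq4])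
    have "norm (z + of_real ((Q t)\<^sup>2)) \<le> norm z + (Q t)\<^sup>2"
      by (rule order_trans[OF norm_triangle_ineq]) (simp add: norm_power)
    then show "norm (-(z + of_real ((Q t)\<^sup>2)) * fst u) + norm (of_real (Q t) * snd u)
      \<le> (norm z + (Q t)\<^sup>2) * norm (fst u) + \<bar>Q t\<bar> * norm (snd u)"
      unfolding norm_mult norm_minus_cancel by (intro add_mono mult_right_mono) auto
  qed
  also have "\<dots> \<le> (norm z + K\<^sup>2) * norm u + K * norm u"
    using assms f s K Q2 by (intro add_mono mult_mono) auto
  finally show ?thesis by (simp add: algebra_simps)
qed

lemma is_qsol_diff:
  assumes "is_qsol Q z x0 x" "is_qsol Q z y0 y"
  shows "is_qsol Q z (x0 - y0) (\<lambda>t. x t - y t)"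
  using assms unfolding is_qsol_def by (auto simp flip: qsys_diff intro!: has_vector_derivative_diff)

lemma is_qsol_fst_snd:
  assumes "is_qsol Q z x0 x" "t \<in> {0..1}"
  shows "((\<lambda>t. fst (x t)) has_vector_derivative of_real (Q t) * fst (x t) + snd (x t)) (at t within {0..1})"
    and "((\<lambda>t. snd (x t)) has_vector_derivative
           -(z + of_real ((Q t)\<^sup>2)) * fst (x t) - of_real (Q t) * snd (x t)) (at t within {0..1})"
proof -
  have d: "(x has_vector_derivative qsys Q z t (x t)) (at t within {0..1})"
    using assms by (auto simp: is_qsol_def)
  show "((\<lambda>t. fst (x t)) has_vector_derivative of_real (Q t) * fst (x t) + snd (x t)) (at t within {0..1})"
    using bounded_linear.has_vector_derivative[OF bounded_linear_fst d] by (simp add: qsys_def)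
  show "((\<lambda>t. snd (x t)) has_vector_derivative
           -(z + of_real ((Q t)\<^sup>2)) * fst (x t) - of_real (Q t) * snd (x t)) (at t within {0..1})"
    using bounded_linear.has_vector_derivative[OF bounded_linear_snd d] by (simp add: qsys_def)
qed

lemma is_qsolI:
  assumes "x 0 = x0"
    and "\<And>t. t \<in> {0..1} \<Longrightarrow> ((\<lambda>t. fst (x t)) has_vector_derivative
           of_real (Q t) * fst (x t) + snd (x t)) (at t within {0..1})"
    and "\<And>t. t \<in> {0..1} \<Longrightarrow> ((\<lambda>t. snd (x t)) has_vector_derivative
           -(z + of_real ((Q t)\<^sup>2)) * fst (x t) - of_real (Q t) * snd (x t)) (at t within {0..1})"
  shows "is_qsol Q z x0 x"
  unfolding is_qsol_def
proof (intro conjI ballI assms(1))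
  fix t :: real assume t: "t \<in> {0..1}"
  show "(x has_vector_derivative qsys Q z t (x t)) (at t within {0..1})"
    using has_vector_derivative_Pair[OF assms(2,3)[OF t]] by (simp add: qsys_def)
qed

lemma is_qsol_cont:
  assumes "is_qsol Q z x0 x"
  shows "continuous_on {0..1} x"
  unfolding continuous_on_eq_continuous_within
proof
  fix t :: real assume "t \<in> {0..1}"
  with assms have "(x has_vector_derivative qsys Q z t (x t)) (at t within {0..1})"
    by (simp add: is_qsol_def)
  then show "continuous (at t within {0..1}) x" by (rule has_vector_derivative_continuous)
qed

text \<open>Lagrange's identity for two spectral parameters: in the derivative of the Wronskian all
  terms with \<open>Q\<close> cancel. For \<open>z = w\<close> the Wronskian is constant; for
  \<open>w\<close> near \<open>z\<close> the identity yields derivatives in the parameter.\<close>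

lemma is_qsol_wronskian:
  assumes a: "is_qsol Q z a0 a" and b: "is_qsol Q w b0 b"
  shows "(fst (a 1) * snd (b 1) - snd (a 1) * fst (b 1)) - (fst a0 * snd b0 - snd a0 * fst b0)
     = (z - w) * integral {0..1} (\<lambda>t. fst (a t) * fst (b t))"
proof -
  define W where "W = (\<lambda>t. fst (a t) * snd (b t) - snd (a t) * fst (b t))"
  have "((\<lambda>t. (z - w) * (fst (a t) * fst (b t))) has_integral (W 1 - W 0)) {0..1}"
  proof (rule fundamental_theorem_of_calculus)
    fix t :: real assume t: "t \<in> {0..1}"
    show "(W has_vector_derivative (z - w) * (fst (a t) * fst (b t))) (at t within {0..1})"
      unfolding W_def
      by (rule derivative_eq_intros is_qsol_fst_snd[OF a t] is_qsol_fst_snd[OF b t] refl)+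
         (simp add: algebra_simps)
  qed simp
  then have "W 1 - W 0 = integral {0..1} (\<lambda>t. (z - w) * (fst (a t) * fst (b t)))"
    by (rule integral_unique[symmetric])
  then show ?thesis using a b by (simp add: W_def is_qsol_def)
qed

section \<open>The transfer matrix over the unit interval and its dependence on the spectral
  parameter\<close>

locale quasi_potential =
  fixes Q :: "real \<Rightarrow> real"
  assumes Q_cont: "continuous_on {0..1} Q"
begin

definition QK :: real where
  "QK = (SOME K. \<forall>t\<in>{0..1}. \<bar>Q t\<bar> \<le> K)"

lemma QK: "t \<in> {0..1} \<Longrightarrow> \<bar>Q t\<bar> \<le> QK"
proof -
  have "bounded (Q ` {0..1})"
    by (intro compact_imp_bounded compact_continuous_image Q_cont compact_Icc)
  then have "\<exists>K. \<forall>t\<in>{0..1}. \<bar>Q t\<bar> \<le> K" by (auto simp: bounded_iff)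
  then have "\<forall>t\<in>{0..1}. \<bar>Q t\<bar> \<le> QK" unfolding QK_def by (rule someI_ex)
  then show "t \<in> {0..1} \<Longrightarrow> \<bar>Q t\<bar> \<le> QK" by blast
qed

lemma QK_nonneg: "QK \<ge> 0"
  using QK[of 0] by simp

lemma is_qsol_unique:
  assumes "is_qsol Q z x0 x" "is_qsol Q z x0 y" "t \<in> {0..1}"
  shows "x t = y t"
proof -
  have d: "is_qsol Q z 0 (\<lambda>t. x t - y t)" using is_qsol_diff[OF assms(1,2)] by simp
  have "(norm (x t - y t))\<^sup>2 \<le> exp (2 * (2*QK + 1 + QK\<^sup>2 + norm z) + 1) * ((norm (x 0 - y 0))\<^sup>2 + 0\<^sup>2)"
  proof (rule gronwall_sq[OF _ _ _ _ assms(3)])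
    fix t :: real assume t: "t \<in> {0..1}"
    show "((\<lambda>t. x t - y t) has_vector_derivative qsys Q z t (x t - y t)) (at t within {0..1})"
      using d t by (simp add: is_qsol_def)
    show "norm (qsys Q z t (x t - y t)) \<le> (2*QK + 1 + QK\<^sup>2 + norm z) * norm (x t - y t) + 0"
      using norm_qsys_le[of Q t QK] QK[OF t] by simp
  qed (use QK_nonneg in auto)
  moreover have "x 0 - y 0 = 0" using d by (simp add: is_qsol_def)
  ultimately show ?thesis by simp
qed

lemma is_qsol_qsol: "is_qsol Q z x0 (qsol Q z x0)"
proof -
  have c: "continuous_on {0..1} (\<lambda>t. qsys Q z t (x t))" if "continuous_on {0..1} x" for x
    unfolding qsys_def by (intro continuous_intros Q_cont that)
  have l: "norm (qsys Q z t u - qsys Q z t v) \<le> (2*QK + 1 + QK\<^sup>2 + norm z) * norm (u - v)"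
    if "t \<in> {0..1}" for t u v
    unfolding qsys_diff by (intro norm_qsys_le QK that)
  have "\<exists>x. is_qsol Q z x0 x"
    by (rule lipschitz_ivp_exists[OF c l]) (auto simp: is_qsol_def)
  then show ?thesis unfolding qsol_def by (rule someI_ex)
qed

lemma qsol_bound:
  "\<exists>C\<ge>0. \<forall>z. norm z \<le> R \<longrightarrow> (\<forall>t\<in>{0..1}. norm (qsol Q z x0 t) \<le> C)"
proof (intro exI conjI allI ballI impI)
  let ?B = "2*QK + 1 + QK\<^sup>2 + R"
  let ?C = "sqrt (exp (2 * ?B + 1) * (norm x0)\<^sup>2)"
  fix z :: complex and t :: real assume z: "norm z \<le> R" and t: "t \<in> {0..1}"
  have "(norm (qsol Q z x0 t))\<^sup>2 \<le> exp (2 * ?B + 1) * ((norm (qsol Q z x0 0))\<^sup>2 + 0\<^sup>2)"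
  proof (rule gronwall_sq[OF _ _ _ _ t])
    fix t :: real assume t: "t \<in> {0..1}"
    show "(qsol Q z x0 has_vector_derivative qsys Q z t (qsol Q z x0 t)) (at t within {0..1})"
      using is_qsol_qsol[of z x0] t by (simp add: is_qsol_def)
    have "norm (qsys Q z t (qsol Q z x0 t)) \<le> (2*QK + 1 + QK\<^sup>2 + norm z) * norm (qsol Q z x0 t)"
      by (intro norm_qsys_le QK t)
    also have "\<dots> \<le> ?B * norm (qsol Q z x0 t)" using z by (intro mult_right_mono) auto
    finally show "norm (qsys Q z t (qsol Q z x0 t)) \<le> ?B * norm (qsol Q z x0 t) + 0" by simp
  qed (use QK_nonneg order_trans[OF norm_ge_zero z] in auto)
  then have "(norm (qsol Q z x0 t))\<^sup>2 \<le> exp (2 * ?B + 1) * (norm x0)\<^sup>2"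
    using is_qsol_qsol[of z x0] by (simp add: is_qsol_def)
  then show "norm (qsol Q z x0 t) \<le> ?C" by (rule real_le_rsqrt)
qed auto

lemma qsol_lipschitz:
  "\<exists>C\<ge>0. \<forall>z w. norm z \<le> R \<longrightarrow> norm w \<le> R \<longrightarrow>
     (\<forall>t\<in>{0..1}. norm (qsol Q z x0 t - qsol Q w x0 t) \<le> C * norm (z - w))"
proof -
  obtain M where M: "M \<ge> 0" "\<And>z t. norm z \<le> R \<Longrightarrow> t \<in> {0..1} \<Longrightarrow> norm (qsol Q z x0 t) \<le> M"
    using qsol_bound[of R x0] by auto
  let ?B = "2*QK + 1 + QK\<^sup>2 + R"
  let ?C = "sqrt (exp (2 * ?B + 1)) * M"
  show ?thesis
  proof (intro exI[of _ ?C] conjI allI ballI impI)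
    fix z w :: complex and t :: real
    assume z: "norm z \<le> R" and w: "norm w \<le> R" and t: "t \<in> {0..1}"
    have "(norm (qsol Q z x0 t - qsol Q w x0 t))\<^sup>2
       \<le> exp (2 * ?B + 1) * ((norm (qsol Q z x0 0 - qsol Q w x0 0))\<^sup>2 + (norm (z - w) * M)\<^sup>2)"
    proof (rule gronwall_sq[OF _ _ _ _ t])
      fix t :: real assume t: "t \<in> {0..1}"
      let ?a = "qsol Q z x0" and ?b = "qsol Q w x0"
      show "((\<lambda>t. ?a t - ?b t) has_vector_derivative (qsys Q z t (?a t) - qsys Q w t (?b t)))
          (at t within {0..1})"
        using is_qsol_qsol[of z x0] is_qsol_qsol[of w x0] t
        by (auto simp: is_qsol_def intro!: has_vector_derivative_diff)
      have "qsys Q z t (?a t) - qsys Q w t (?b t) = qsys Q z t (?a t - ?b t) + (0, (w - z) * fst (?b t))"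
        by (simp add: qsys_def algebra_simps)
      then have "norm (qsys Q z t (?a t) - qsys Q w t (?b t))
          \<le> norm (qsys Q z t (?a t - ?b t)) + norm (0::complex, (w - z) * fst (?b t))"
        using norm_triangle_ineq by metis
      also have "norm (qsys Q z t (?a t - ?b t)) \<le> (2*QK + 1 + QK\<^sup>2 + norm z) * norm (?a t - ?b t)"
        by (intro norm_qsys_le QK t)
      also have "\<dots> \<le> ?B * norm (?a t - ?b t)" using z by (intro mult_right_mono) auto
      also have "norm (0::complex, (w - z) * fst (?b t)) = norm (z - w) * norm (fst (?b t))"
        by (simp add: norm_mult norm_minus_commute)
      also have "\<dots> \<le> norm (z - w) * M"
        by (intro mult_left_mono order_trans[OF norm_fst_le_norm M(2)[OF w t]]) simp
      finally show "norm (qsys Q z t (?a t) - qsys Q w t (?b t)) \<le> ?B * norm (?a t - ?b t) + norm (z - w) * M"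
        by simp
    qed (use QK_nonneg order_trans[OF norm_ge_zero z] M in auto)
    then have "(norm (qsol Q z x0 t - qsol Q w x0 t))\<^sup>2 \<le> exp (2 * ?B + 1) * (norm (z - w) * M)\<^sup>2"
      using is_qsol_qsol[of z x0] is_qsol_qsol[of w x0] by (simp add: is_qsol_def)
    then have "norm (qsol Q z x0 t - qsol Q w x0 t) \<le> sqrt (exp (2 * ?B + 1) * (norm (z - w) * M)\<^sup>2)"
      by (rule real_le_rsqrt)
    then show "norm (qsol Q z x0 t - qsol Q w x0 t) \<le> ?C * norm (z - w)"
      using M by (simp add: real_sqrt_mult mult_ac)
  qed (use M in auto)
qed

text \<open>The two parameters are kept apart because the increments of the transfer matrix between
  \<open>z\<close> and \<open>w\<close> are exactly \<open>w - z\<close> times combinations of such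
  integrals; the diagonal \<open>w = z\<close> then gives the derivative.\<close>

definition solint :: "complex \<times> complex \<Rightarrow> complex \<times> complex \<Rightarrow> complex \<Rightarrow> complex \<Rightarrow> complex" where
  "solint a0 b0 z w = integral {0..1} (\<lambda>t. fst (qsol Q z a0 t) * fst (qsol Q w b0 t))"

lemma solint_continuous: "isCont (solint a0 b0 z) z"
proof -
  obtain M where M: "M \<ge> 0" "\<And>t. t \<in> {0..1} \<Longrightarrow> norm (qsol Q z a0 t) \<le> M"
    using qsol_bound[of "norm z" a0] by auto
  obtain C where C: "C \<ge> 0" "\<And>w t. norm w \<le> norm z + 1 \<Longrightarrow> t \<in> {0..1}
      \<Longrightarrow> norm (qsol Q w b0 t - qsol Q z b0 t) \<le> C * norm (w - z)"
    using qsol_lipschitz[of "norm z + 1" b0] by force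
  have c: "continuous_on {0..1} (qsol Q v x)" for v x by (rule is_qsol_cont[OF is_qsol_qsol])
  have ev: "\<forall>\<^sub>F w in at z. norm (solint a0 b0 z w - solint a0 b0 z z) \<le> (M * C) * norm (w - z)"
  proof -
    have "\<forall>\<^sub>F w in at z. dist w z < 1" by (simp add: eventually_at_ball' eventually_at) (metis zero_less_one)
    then show ?thesis
    proof eventually_elim
      case (elim w)
      then have w: "norm w \<le> norm z + 1" using norm_triangle_sub[of w z] by (simp add: dist_norm)
      let ?h = "\<lambda>t. fst (qsol Q z a0 t) * (fst (qsol Q w b0 t) - fst (qsol Q z b0 t))"
      have "solint a0 b0 z w - solint a0 b0 z z = integral {0..1} ?h"
        unfolding solint_def
        by (subst integral_diff[symmetric])
           (auto intro!: integrable_continuous_real continuous_intros c simp: algebra_simps)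
      also have "norm \<dots> \<le> M * (C * norm (w - z)) * (1 - 0)"
      proof (rule integral_bound)
        show "continuous_on {0..1} ?h" by (intro continuous_intros c)
        fix t :: real assume t: "t \<in> {0..1}"
        have "norm (fst (qsol Q z a0 t)) \<le> M" by (rule order_trans[OF norm_fst_le_norm M(2)[OF t]])
        moreover have "norm (fst (qsol Q w b0 t) - fst (qsol Q z b0 t)) \<le> C * norm (w - z)"
          using order_trans[OF norm_fst_le_norm C(2)[OF w t]] by simp
        ultimately show "norm (?h t) \<le> M * (C * norm (w - z))"
          unfolding norm_mult using M by (intro mult_mono) auto
      qed simp
      finally show ?case by simp
    qed
  qed
  have "((\<lambda>w. solint a0 b0 z w - solint a0 b0 z z) \<longlongrightarrow> 0) (at z)"
  proof (rule Lim_null_comparison[OF ev])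
    have "((\<lambda>w. M * C * norm (w - z)) \<longlongrightarrow> M * C * norm (z - z)) (at z)" by (intro tendsto_intros)
    then show "((\<lambda>w. M * C * norm (w - z)) \<longlongrightarrow> 0) (at z)" by simp
  qed
  then show ?thesis by (simp add: isCont_def LIM_zero_iff)
qed

definition th :: "complex \<Rightarrow> complex" where "th z = fst (qsol Q z (1, 0) 1)"
definition thd :: "complex \<Rightarrow> complex" where "thd z = snd (qsol Q z (1, 0) 1)"
definition ph :: "complex \<Rightarrow> complex" where "ph z = fst (qsol Q z (0, 1) 1)"
definition phd :: "complex \<Rightarrow> complex" where "phd z = snd (qsol Q z (0, 1) 1)"

abbreviation J11 :: "complex \<Rightarrow> complex" where "J11 z \<equiv> solint (1, 0) (1, 0) z z"
abbreviation J12 :: "complex \<Rightarrow> complex" where "J12 z \<equiv> solint (1, 0) (0, 1) z z"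
abbreviation J22 :: "complex \<Rightarrow> complex" where "J22 z \<equiv> solint (0, 1) (0, 1) z z"

lemma wronskian_th_ph: "th z * phd z - thd z * ph z = 1"
  using is_qsol_wronskian[OF is_qsol_qsol[of z "(1,0)"] is_qsol_qsol[of z "(0,1)"]]
  by (simp add: th_def thd_def ph_def phd_def)

lemma wronskian_pairs:
  "th z * thd w - thd z * th w = (z - w) * solint (1,0) (1,0) z w"
  "ph z * phd w - phd z * ph w = (z - w) * solint (0,1) (0,1) z w"
  "th z * phd w - thd z * ph w = 1 + (z - w) * solint (1,0) (0,1) z w"
  "ph z * thd w - phd z * th w = -1 + (z - w) * solint (0,1) (1,0) z w"
  using is_qsol_wronskian[OF is_qsol_qsol[of z "(1,0)"] is_qsol_qsol[of w "(1,0)"]]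
    is_qsol_wronskian[OF is_qsol_qsol[of z "(0,1)"] is_qsol_qsol[of w "(0,1)"]]
    is_qsol_wronskian[OF is_qsol_qsol[of z "(1,0)"] is_qsol_qsol[of w "(0,1)"]]
    is_qsol_wronskian[OF is_qsol_qsol[of z "(0,1)"] is_qsol_qsol[of w "(1,0)"]]
  by (simp_all add: th_def thd_def ph_def phd_def solint_def algebra_simps)

lemma solint_sym: "solint b0 a0 z z = solint a0 b0 z z"
  by (simp add: solint_def mult.commute)

text \<open>Cramer's rule for \<open>(A, B)\<close> in the basis \<open>(a, b)\<close>,
  \<open>(c, d)\<close>. The coefficients are Wronskians, the form in which
  \<open>wronskian_pairs\<close> delivers the data.\<close>

lemma cramer_2x2:
  fixes a b c d A B :: complex
  assumes "a * d - b * c = 1"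
  shows "A = (A * d - B * c) * a - (A * b - B * a) * c" "B = (A * d - B * c) * b - (A * b - B * a) * d"
proof -
  have "(A * d - B * c) * a - (A * b - B * a) * c = A * (a * d - b * c)" by algebra
  then show "A = (A * d - B * c) * a - (A * b - B * a) * c" using assms by simp
  have "(A * d - B * c) * b - (A * b - B * a) * d = B * (a * d - b * c)" by algebra
  then show "B = (A * d - B * c) * b - (A * b - B * a) * d" using assms by simp
qed

text \<open>The increments are exact multiples of \<open>w - z\<close> with a factor continuous in
  \<open>w\<close>, so Caratheodory's criterion gives the derivative at once. Since the parameter is
  complex, the transfer matrix is entire.\<close>

lemma deriv_transfer:
  fixes z :: complex
  shows
  "(th has_field_derivative (th z * J12 z - ph z * J11 z)) (at z)"
  "(thd has_field_derivative (thd z * J12 z - phd z * J11 z)) (at z)"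
  "(ph has_field_derivative (th z * J22 z - ph z * J12 z)) (at z)"
  "(phd has_field_derivative (thd z * J22 z - phd z * J12 z)) (at z)"
proof -
  note c = solint_continuous[of z]
  have W: "th z * phd z - thd z * ph z = 1" by (rule wronskian_th_ph)
  have D: "(f has_field_derivative (a * solint x0 x1 z z - b * solint y0 y1 z z)) (at z)"
    if "\<And>w. f w - f z = (a * solint x0 x1 z w - b * solint y0 y1 z w) * (w - z)"
    for f a b x0 x1 y0 y1
    unfolding DERIV_caratheodory_within
    by (intro exI[of _ "\<lambda>w. a * solint x0 x1 z w - b * solint y0 y1 z w"] conjI allI that
        continuous_intros c refl)
  have 1: "th w - th z = (th z * solint (0,1) (1,0) z w - ph z * solint (1,0) (1,0) z w) * (w - z)"
    and 2: "thd w - thd z = (thd z * solint (0,1) (1,0) z w - phd z * solint (1,0) (1,0) z w) * (w - z)" for w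
    using cramer_2x2(1)[OF W, of "th w" "thd w"] wronskian_pairs(1,4)[of z w] apply algebra
    using cramer_2x2(2)[OF W, of "thd w" "th w"] wronskian_pairs(1,4)[of z w] by algebra
  have 3: "ph w - ph z = (th z * solint (0,1) (0,1) z w - ph z * solint (1,0) (0,1) z w) * (w - z)"
    and 4: "phd w - phd z = (thd z * solint (0,1) (0,1) z w - phd z * solint (1,0) (0,1) z w) * (w - z)" for w
    using cramer_2x2(1)[OF W, of "ph w" "phd w"] wronskian_pairs(2,3)[of z w] apply algebra
    using cramer_2x2(2)[OF W, of "phd w" "ph w"] wronskian_pairs(2,3)[of z w] by algebra
  show "(th has_field_derivative (th z * J12 z - ph z * J11 z)) (at z)"
    "(thd has_field_derivative (thd z * J12 z - phd z * J11 z)) (at z)"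
    "(ph has_field_derivative (th z * J22 z - ph z * J12 z)) (at z)"
    "(phd has_field_derivative (thd z * J22 z - phd z * J12 z)) (at z)"
    using D[OF 1] D[OF 2] D[OF 3] D[OF 4] by (simp_all add: solint_sym[of "(0,1)" "(1,0)"])
qed

end

section \<open>Real spectral parameter: signs, reflection and monotonicity\<close>

definition is_rqsol :: "(real \<Rightarrow> real) \<Rightarrow> real \<Rightarrow> real \<Rightarrow> real \<Rightarrow> (real \<Rightarrow> real) \<Rightarrow> (real \<Rightarrow> real) \<Rightarrow> bool" where
  "is_rqsol Q x p r y v \<longleftrightarrow> y 0 = p \<and> v 0 = r \<and>
     (\<forall>t\<in>{0..1}. (y has_real_derivative Q t * y t + v t) (at t within {0..1}) \<and>
        (v has_real_derivative -(x + (Q t)\<^sup>2) * y t - Q t * v t) (at t within {0..1}))"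

lemma is_rqsolD:
  assumes "is_rqsol Q x p r y v" "t \<in> {0..1}"
  shows "(y has_real_derivative Q t * y t + v t) (at t within {0..1})"
    "(v has_real_derivative -(x + (Q t)\<^sup>2) * y t - Q t * v t) (at t within {0..1})"
  using assms by (auto simp: is_rqsol_def)

lemma is_rqsol_cont:
  assumes "is_rqsol Q x p r y v"
  shows "continuous_on {0..1} y" "continuous_on {0..1} v"
  using is_rqsolD[OF assms] DERIV_continuous continuous_on_eq_continuous_within by blast+

lemma is_rqsol_imp_is_qsol:
  assumes "is_rqsol Q x p r y v"
  shows "is_qsol Q (of_real x) (of_real p, of_real r) (\<lambda>t. (of_real (y t), of_real (v t)))"
proof (rule is_qsolI)
  show "(complex_of_real (y 0), complex_of_real (v 0)) = (of_real p, of_real r)"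
    using assms by (simp add: is_rqsol_def)
  fix t :: real assume t: "t \<in> {0..1}"
  note d = is_rqsolD[OF assms t, unfolded has_real_derivative_iff_has_vector_derivative,
      THEN bounded_linear.has_vector_derivative[OF bounded_linear_of_real]]
  show "((\<lambda>t. fst (complex_of_real (y t), complex_of_real (v t))) has_vector_derivative
      of_real (Q t) * fst (complex_of_real (y t), complex_of_real (v t)) + snd (complex_of_real (y t), complex_of_real (v t)))
      (at t within {0..1})"
    using d(1) by simp
  show "((\<lambda>t. snd (complex_of_real (y t), complex_of_real (v t))) has_vector_derivative
      -(of_real x + of_real ((Q t)\<^sup>2)) * fst (complex_of_real (y t), complex_of_real (v t))
        - of_real (Q t) * snd (complex_of_real (y t), complex_of_real (v t))) (at t within {0..1})"
    using d(2) by simp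
qed

lemma is_rqsol_reflect:
  assumes s: "is_rqsol Q x p r y v" and odd: "\<And>t. t \<in> {0..1} \<Longrightarrow> Q (1 - t) = - Q t"
  shows "is_rqsol Q x (y 1) (- v 1) (\<lambda>t. y (1 - t)) (\<lambda>t. - v (1 - t))"
  unfolding is_rqsol_def
proof (intro conjI ballI)
  fix t :: real assume t: "t \<in> {0..1}"
  then have t': "1 - t \<in> {0..1}" by auto
  have im: "(\<lambda>t. 1 - t) ` {0..1::real} = {0..1}" by auto
  have d: "((\<lambda>t. f (1 - t)) has_real_derivative - f') (at t within {0..1})"
    if "(f has_real_derivative f') (at (1 - t) within {0..1})" for f :: "real \<Rightarrow> real" and f'
  proof -
    have "((f \<circ> (\<lambda>t. 1 - t)) has_real_derivative f' * (-1)) (at t within {0..1})"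
      by (rule DERIV_image_chain) (auto simp: im that intro!: derivative_eq_intros)
    then show ?thesis by (simp add: o_def)
  qed
  show "((\<lambda>t. y (1 - t)) has_real_derivative Q t * y (1 - t) + - v (1 - t)) (at t within {0..1})"
    using d[OF is_rqsolD(1)[OF s t']] odd[OF t] by simp
  show "((\<lambda>t. - v (1 - t)) has_real_derivative - (x + (Q t)\<^sup>2) * y (1 - t) - Q t * - v (1 - t)) (at t within {0..1})"
    using DERIV_minus[OF d[OF is_rqsolD(2)[OF s t']]] odd[OF t] by (simp add: algebra_simps)
qed auto

text \<open>Below \<open>- Q\<^sup>2\<close> the product \<open>y v\<close> has the nonnegative derivative \<open>v\<^sup>2 - (x + Q\<^sup>2) y\<^sup>2\<close>.\<close>
lemma is_rqsol_product_pos: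
  assumes s: "is_rqsol Q x p r y v" and Q: "continuous_on {0..1} Q" and x: "\<And>t. t \<in> {0..1} \<Longrightarrow> (Q t)\<^sup>2 < - x"
    and pr: "p \<noteq> 0 \<or> r \<noteq> 0" "p * r \<ge> 0" and t: "0 < t" "t \<le> 1"
  shows "y t * v t > 0"
proof -
  define g where "g = (\<lambda>t. (v t)\<^sup>2 + (- x - (Q t)\<^sup>2) * (y t)\<^sup>2)"
  have sub: "{0..t} \<subseteq> {0..1}" using t by auto
  have gc: "continuous_on {0..t} g"
    unfolding g_def by (intro continuous_intros continuous_on_subset[OF _ sub] Q is_rqsol_cont[OF s])
  have g0: "g u \<ge> 0" if "u \<in> {0..t}" for u
    using that x[of u] t unfolding g_def by (intro add_nonneg_nonneg mult_nonneg_nonneg) auto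
  have "(g has_integral (y t * v t - y 0 * v 0)) {0..t}"
  proof (rule fundamental_theorem_of_calculus)
    fix u assume u: "u \<in> {0..t}"
    then have u': "u \<in> {0..1}" using t by auto
    have "((\<lambda>t. y t * v t) has_real_derivative g u) (at u within {0..1})"
      by (rule derivative_eq_intros is_rqsolD[OF s u'] refl)+
         (simp add: g_def algebra_simps power2_eq_square)
    then show "((\<lambda>t. y t * v t) has_vector_derivative g u) (at u within {0..t})"
      unfolding has_real_derivative_iff_has_vector_derivative[symmetric]
      by (rule DERIV_subset[OF _ sub])
  qed (use t in simp)
  then have "y t * v t = p * r + integral {0..t} g"
    using s by (auto simp: is_rqsol_def dest: integral_unique)
  moreover have "integral {0..t} g \<ge> 0" by (intro integral_nonneg integrable_continuous_real gc g0)
  moreover have "integral {0..t} g \<noteq> 0"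
  proof
    assume "integral {0..t} g = 0"
    then have "g 0 = 0" using integral_eq_0_iff[OF gc _ g0] t by auto
    moreover have "- x - (Q 0)\<^sup>2 > 0" using x[of 0] by simp
    ultimately have "v 0 = 0 \<and> y 0 = 0"
      unfolding g_def by (smt (verit) mult_nonneg_nonneg mult_pos_pos zero_le_power2 zero_eq_power2)
    then show False using s pr by (simp add: is_rqsol_def)
  qed
  ultimately show ?thesis using pr by linarith
qed

lemma continuous_nonzero_pos:
  fixes f :: "real \<Rightarrow> real"
  assumes "continuous_on {0..1} f" "f 0 > 0" "\<And>t. 0 < t \<Longrightarrow> t \<le> 1 \<Longrightarrow> f t \<noteq> 0"
  shows "f 1 > 0"
proof (rule ccontr)
  assume "\<not> f 1 > 0"
  then obtain t where "0 \<le> t" "t \<le> 1" "f t = 0"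
    using IVT2'[of f 1 0 0] assms(1,2) by auto
  then show False using assms(2,3) by (cases "t = 0") auto
qed

context quasi_potential
begin

lemma qsol_of_rqsol:
  assumes "is_rqsol Q x p r y v" "t \<in> {0..1}"
  shows "qsol Q (of_real x) (of_real p, of_real r) t = (of_real (y t), of_real (v t))"
  using is_qsol_unique[OF is_qsol_qsol is_rqsol_imp_is_qsol[OF assms(1)] assms(2)] .

lemma is_rqsol_Re_qsol:
  "is_rqsol Q x p r (\<lambda>t. Re (fst (qsol Q (of_real x) (of_real p, of_real r) t)))
     (\<lambda>t. Re (snd (qsol Q (of_real x) (of_real p, of_real r) t)))"
  (is "is_rqsol Q x p r (\<lambda>t. Re (fst (?s t))) _")
  unfolding is_rqsol_def
proof (intro conjI ballI)
  have s: "is_qsol Q (of_real x) (of_real p, of_real r) ?s" by (rule is_qsol_qsol)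
  show "Re (fst (?s 0)) = p" "Re (snd (?s 0)) = r" using s by (simp_all add: is_qsol_def)
  fix t :: real assume t: "t \<in> {0..1}"
  note d = is_qsol_fst_snd[OF s t, THEN bounded_linear.has_vector_derivative[OF bounded_linear_Re],
      folded has_real_derivative_iff_has_vector_derivative]
  show "((\<lambda>t. Re (fst (?s t))) has_real_derivative Q t * Re (fst (?s t)) + Re (snd (?s t))) (at t within {0..1})"
    using d(1) by simp
  show "((\<lambda>t. Re (snd (?s t))) has_real_derivative - (x + (Q t)\<^sup>2) * Re (fst (?s t)) - Q t * Re (snd (?s t)))
     (at t within {0..1})"
    using d(2) by simp
qed

lemma ex_rqsol: "\<exists>y v. is_rqsol Q x p r y v"
  using is_rqsol_Re_qsol by blast

definition rth :: "real \<Rightarrow> real" where "rth x = Re (th (of_real x))"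
definition rthd :: "real \<Rightarrow> real" where "rthd x = Re (thd (of_real x))"
definition rph :: "real \<Rightarrow> real" where "rph x = Re (ph (of_real x))"
definition rphd :: "real \<Rightarrow> real" where "rphd x = Re (phd (of_real x))"

lemma rqsol_th:
  assumes "is_rqsol Q x 1 0 y v"
  shows "y 1 = rth x" "v 1 = rthd x"
  using qsol_of_rqsol[OF assms, of 1] by (simp_all add: rth_def rthd_def th_def thd_def)

lemma rqsol_ph:
  assumes "is_rqsol Q x 0 1 y v"
  shows "y 1 = rph x" "v 1 = rphd x"
  using qsol_of_rqsol[OF assms, of 1] by (simp_all add: rph_def rphd_def ph_def phd_def)

lemma of_real_transfer:
  "th (of_real x) = of_real (rth x)" "thd (of_real x) = of_real (rthd x)"
  "ph (of_real x) = of_real (rph x)" "phd (of_real x) = of_real (rphd x)"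
proof -
  obtain y v where "is_rqsol Q x 1 0 y v" using ex_rqsol by blast
  from qsol_of_rqsol[OF this, of 1] rqsol_th[OF this]
  show "th (of_real x) = of_real (rth x)" "thd (of_real x) = of_real (rthd x)"
    by (simp_all add: th_def thd_def)
  obtain y v where "is_rqsol Q x 0 1 y v" using ex_rqsol by blast
  from qsol_of_rqsol[OF this, of 1] rqsol_ph[OF this]
  show "ph (of_real x) = of_real (rph x)" "phd (of_real x) = of_real (rphd x)"
    by (simp_all add: ph_def phd_def)
qed

lemma rwronskian: "rth x * rphd x - rthd x * rph x = 1"
  using wronskian_th_ph[of "of_real x"] unfolding of_real_transfer
  by (metis of_real_1 of_real_diff of_real_eq_iff of_real_mult)

text \<open>The Wronskian of the theta solution with the reflected phi solution is
  \<open>- rphd x\<close> at 0 and \<open>- rth x\<close> at 1.\<close>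

lemma transfer_reflect:
  assumes "\<And>t. t \<in> {0..1} \<Longrightarrow> Q (1 - t) = - Q t"
  shows "rth x = rphd x"
proof -
  obtain y v where s: "is_rqsol Q x 0 1 y v" using ex_rqsol by blast
  note b = is_rqsol_imp_is_qsol[OF is_rqsol_reflect[OF s assms]]
  have i: "y 0 = 0" "v 0 = 1" using s by (simp_all add: is_rqsol_def)
  have "complex_of_real (rth x) = of_real (rphd x)"
    using is_qsol_wronskian[OF is_qsol_qsol[of "of_real x" "(1,0)"] b] rqsol_ph[OF s] i
      of_real_transfer[of x]
    by (simp add: th_def thd_def)
  then show ?thesis by simp
qed

text \<open>Below \<open>- QK\<^sup>2\<close> the product of a solution and its quasi-derivative is
  positive for \<open>t > 0\<close>, so neither changes sign. This fixes all signs to the left of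
  the first Dirichlet eigenvalue.\<close>

lemma transfer_pos:
  assumes "x < - QK\<^sup>2"
  shows "rth x > 0" "rthd x > 0" "rph x > 0" "rphd x > 0"
proof -
  have Qx: "(Q t)\<^sup>2 < - x" if "t \<in> {0..1}" for t
    using QK[OF that] assms abs_le_square_iff[of "Q t" QK] QK_nonneg by simp
  obtain y v where s: "is_rqsol Q x 1 0 y v" using ex_rqsol by blast
  have yv: "y t * v t > 0" if "0 < t" "t \<le> 1" for t
    by (rule is_rqsol_product_pos[OF s Q_cont Qx _ _ that]) auto
  have "y 1 > 0"
    by (rule continuous_nonzero_pos[OF is_rqsol_cont(1)[OF s]]) (use s yv in \<open>auto simp: is_rqsol_def\<close>, force)
  then show "rth x > 0" "rthd x > 0"
    using yv[of 1] rqsol_th[OF s] by (auto simp: zero_less_mult_iff)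
  obtain y v where s: "is_rqsol Q x 0 1 y v" using ex_rqsol by blast
  have yv: "y t * v t > 0" if "0 < t" "t \<le> 1" for t
    by (rule is_rqsol_product_pos[OF s Q_cont Qx _ _ that]) auto
  have "v 1 > 0"
    by (rule continuous_nonzero_pos[OF is_rqsol_cont(2)[OF s]]) (use s yv in \<open>auto simp: is_rqsol_def\<close>, force)
  then show "rph x > 0" "rphd x > 0"
    using yv[of 1] rqsol_ph[OF s] by (auto simp: zero_less_mult_iff)
qed

text \<open>The numbers \<open>i11\<close>, \<open>i12\<close>, \<open>i22\<close> form the Gram
  matrix of the two fundamental solutions. A quadratic form with negative discriminant is definite,
  so its integral has the sign of the leading coefficient \<open>a\<close>; the extra factor
  \<open>a\<close> avoids a case split.\<close>

lemma transfer_real_deriv: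
  obtains i11 i12 i22 where
    "(rth has_real_derivative (rth x * i12 - rph x * i11)) (at x)"
    "(rphd has_real_derivative (rthd x * i22 - rphd x * i12)) (at x)"
    "(rph has_real_derivative (rth x * i22 - rph x * i12)) (at x)"
    "i22 > 0"
    "\<And>a b c. b\<^sup>2 < 4 * a * c \<Longrightarrow> a * (a * i11 + b * i12 + c * i22) > 0"
proof -
  obtain y1 v1 where s1: "is_rqsol Q x 1 0 y1 v1" using ex_rqsol by blast
  obtain y2 v2 where s2: "is_rqsol Q x 0 1 y2 v2" using ex_rqsol by blast
  note c1 = is_rqsol_cont(1)[OF s1] and c2 = is_rqsol_cont(1)[OF s2]
  define i11 i12 i22 where "i11 = integral {0..1} (\<lambda>t. y1 t * y1 t)"
    and "i12 = integral {0..1} (\<lambda>t. y1 t * y2 t)" and "i22 = integral {0..1} (\<lambda>t. y2 t * y2 t)"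
  have sol: "t \<in> {0..1} \<Longrightarrow> fst (qsol Q (of_real x) (1, 0) t) = of_real (y1 t)"
      "t \<in> {0..1} \<Longrightarrow> fst (qsol Q (of_real x) (0, 1) t) = of_real (y2 t)" for t
    using qsol_of_rqsol[OF s1, of t] qsol_of_rqsol[OF s2, of t] by simp_all
  have of_int: "integral {0..1} (\<lambda>t. complex_of_real (f t)) = of_real (integral {0..1} f)"
    if "continuous_on {0..1} f" for f :: "real \<Rightarrow> real"
    using integral_linear[OF integrable_continuous_real[OF that] bounded_linear_of_real]
    by (simp add: o_def)
  have J: "J11 (of_real x) = of_real i11" "J12 (of_real x) = of_real i12" "J22 (of_real x) = of_real i22"
    unfolding solint_def i11_def i12_def i22_def
    by (subst of_int[symmetric], intro continuous_intros c1 c2, intro integral_cong, simp add: sol)+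
  have D: "((\<lambda>x. Re (f (of_real x))) has_real_derivative r) (at x)"
    if "(f has_field_derivative (of_real r)) (at (of_real x))" for f r
    using bounded_linear.has_vector_derivative[OF bounded_linear_Re has_vector_derivative_real_field[OF that]]
    by (simp add: has_real_derivative_iff_has_vector_derivative)
  note dt = deriv_transfer[of "of_real x", unfolded of_real_transfer J of_real_mult[symmetric] of_real_diff[symmetric],
      THEN D, folded rth_def rthd_def rph_def rphd_def]
  have pos: "a * (a * i11 + b * i12 + c * i22) > 0" if "b\<^sup>2 < 4 * a * c" for a b c
  proof -
    define g where "g = (\<lambda>t. a * (a * (y1 t * y1 t) + b * (y1 t * y2 t) + c * (y2 t * y2 t)))"
    have gc: "continuous_on {0..1} g" unfolding g_def by (intro continuous_intros c1 c2)
    have g4: "4 * g t = (2 * a * y1 t + b * y2 t)\<^sup>2 + (4 * a * c - b\<^sup>2) * (y2 t)\<^sup>2" for t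
      unfolding g_def by algebra
    have g0: "g t \<ge> 0" for t
    proof -
      have "4 * g t \<ge> 0" unfolding g4 using that by (intro add_nonneg_nonneg mult_nonneg_nonneg) auto
      then show ?thesis by simp
    qed
    have "a \<noteq> 0" using that by auto
    have "g 0 = a\<^sup>2" using s1 s2 by (simp add: g_def is_rqsol_def power2_eq_square)
    then have "integral {0..1} g \<noteq> 0"
      using integral_eq_0_iff[OF gc _ g0] \<open>a \<noteq> 0\<close> by fastforce
    moreover have "integral {0..1} g \<ge> 0" by (intro integral_nonneg integrable_continuous_real gc g0)
    moreover have "integral {0..1} g = a * (a * i11 + b * i12 + c * i22)"
    proof (rule integral_unique)
      note hi = integrable_integral[OF integrable_continuous_real]
      show "(g has_integral a * (a * i11 + b * i12 + c * i22)) {0..1}"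
        unfolding g_def i11_def i12_def i22_def
        by (intro has_integral_mult_right has_integral_add hi continuous_intros c1 c2)
    qed
    ultimately show ?thesis by linarith
  qed
  \<comment> \<open>The form \<open>y2\<^sup>2\<close> has leading coefficient zero and is not
    covered by \<open>pos\<close>. Here \<open>y2\<close> would vanish identically, although its
    derivative at 0 is 1.\<close>
  have "i22 \<noteq> 0"
  proof
    assume "i22 = 0"
    then have z: "\<forall>t\<in>{0..1}. y2 t * y2 t = 0"
      unfolding i22_def by (subst (asm) integral_eq_0_iff) (auto intro!: continuous_intros c2)
    have d: "(y2 has_real_derivative 1) (at 0 within {0..1})"
      using is_rqsolD(1)[OF s2, of 0] s2 by (simp add: is_rqsol_def)
    have "((\<lambda>t. 0) has_real_derivative 1) (at 0 within {0..1})"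
      by (rule has_field_derivative_transform_within[OF d, of 1]) (use z in auto)
    then have "(1::real) = 0"
      unfolding has_real_derivative_iff_has_vector_derivative
      by (intro vector_derivative_unique_within_closed_interval[of 0 1 0 "\<lambda>t. 0"]) auto
    then show False by simp
  qed
  moreover have "i22 \<ge> 0" unfolding i22_def
    by (intro integral_nonneg integrable_continuous_real continuous_intros c2) auto
  ultimately have "i22 > 0" by simp
  then show ?thesis using that[OF dt(1) dt(4) dt(3) _ pos] by blast
qed

text \<open>The derivative is minus the integral of a quadratic form in the two solutions with leading
  coefficient \<open>b1 * rph x\<close> and discriminant \<open>(b1 * rth x + b2 * rphd x)\<^sup>2 - 4 * b1 * b2\<close>.\<close>
lemma weighted_trace_deriv:
  assumes "b1 > 0" "b2 > 0" "(b1 * rth x + b2 * rphd x)\<^sup>2 < 4 * b1 * b2"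
  shows "(b1 * deriv rth x + b2 * deriv rphd x) * rph x < 0"
proof -
  obtain i11 i12 i22 where d:
    "(rth has_real_derivative (rth x * i12 - rph x * i11)) (at x)"
    "(rphd has_real_derivative (rthd x * i22 - rphd x * i12)) (at x)"
    and pos: "\<And>a b c. b\<^sup>2 < 4 * a * c \<Longrightarrow> a * (a * i11 + b * i12 + c * i22) > 0"
    by (rule transfer_real_deriv[of x]) blast
  let ?a = "b1 * rph x" and ?b = "b2 * rphd x - b1 * rth x" and ?c = "- (b2 * rthd x)"
  have "?b\<^sup>2 - 4 * ?a * ?c = (b1 * rth x + b2 * rphd x)\<^sup>2 - 4 * b1 * b2 * (rth x * rphd x - rthd x * rph x)"
    by algebra
  then have "?b\<^sup>2 < 4 * ?a * ?c" using assms(3) rwronskian[of x] by simp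
  from pos[OF this] have "b1 * (rph x * (?a * i11 + ?b * i12 + ?c * i22)) > 0" by (simp only: mult.assoc)
  then have "rph x * (?a * i11 + ?b * i12 + ?c * i22) > 0" using assms(1) by (simp add: zero_less_mult_iff)
  moreover have "b1 * deriv rth x + b2 * deriv rphd x = - (?a * i11 + ?b * i12 + ?c * i22)"
    using d by (simp add: DERIV_imp_deriv algebra_simps)
  then have "(b1 * deriv rth x + b2 * deriv rphd x) * rph x = - (rph x * (?a * i11 + ?b * i12 + ?c * i22))"
    by (simp only: mult_minus_left mult.commute)
  ultimately show ?thesis by linarith
qed

text \<open>At a Dirichlet eigenvalue the slope of \<open>rph\<close> is \<open>rth x\<close> times
  the squared norm of the eigenfunction. So these zeros are simple, and the sign of theta(1) follows
  the direction of crossing.\<close>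

lemma dirichlet_simple:
  assumes "rph x = 0"
  shows "deriv rph x * rth x > 0"
proof -
  obtain i12 i22 where d:
    "(rph has_real_derivative (rth x * i22 - rph x * i12)) (at x)" and "i22 > 0"
    by (rule transfer_real_deriv[of x]) blast
  then have "deriv rph x * rth x = (rth x)\<^sup>2 * i22"
    using assms by (simp add: DERIV_imp_deriv power2_eq_square)
  moreover have "rth x \<noteq> 0" using rwronskian[of x] assms by auto
  ultimately show ?thesis using \<open>i22 > 0\<close> by simp
qed

end

section \<open>Asymptotics of the transfer matrix\<close>

context quasi_potential
begin

text \<open>With \<open>w = y + \<i> v / k\<close> the system reads \<open>w' = - \<i> k w + Q cnj w + O(1/k)\<close>, so that
  \<open>c = exp (\<i> k t) w\<close> is driven by the oscillating term \<open>Q exp (2 \<i> k t) cnj c\<close> only. It is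
  integrated by parts after replacing \<open>Q\<close> by a uniformly close polynomial.\<close>
lemma rotating_frame:
  assumes e: "e > 0"
  obtains k0 where "k0 \<ge> 1"
    "\<And>k p r y v. k \<ge> k0 \<Longrightarrow> is_rqsol Q (k\<^sup>2) p r y v \<Longrightarrow> p\<^sup>2 + (r / k)\<^sup>2 = 1
       \<Longrightarrow> norm (Complex (y 1) (v 1 / k) - cis (- k) * Complex p (r / k)) \<le> e"
proof -
  define B where "B = QK + QK\<^sup>2"
  define M where "M = sqrt (exp (2 * B + 1))"
  have M: "M > 0" by (simp add: M_def)
  have B: "B \<ge> 0" using QK_nonneg by (simp add: B_def)
  \<comment> \<open>Half of the error \<open>e\<close> is spent on replacing \<open>Q\<close> by
    \<open>P\<close>, the other half on the terms of order \<open>1 / k\<close>.\<close>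
  define d where "d = e / (2 * M)"
  have d: "d > 0" using e M by (simp add: d_def)
  obtain P where P: "real_polynomial_function P" "\<And>t. t \<in> {0..1} \<Longrightarrow> \<bar>Q t - P t\<bar> < d"
    using Stone_Weierstrass_real_polynomial_function[OF compact_Icc Q_cont d] by auto
  obtain P' where P': "real_polynomial_function P'" "\<And>t. (P has_real_derivative P' t) (at t)"
    using has_real_derivative_polynomial_function[OF P(1)] by auto
  have "bounded (P ` {0..1})" "bounded (P' ` {0..1})"
    using P(1) P'(1)
    by (auto intro!: compact_imp_bounded compact_continuous_image compact_Icc
        continuous_on_polymonial_function simp: real_polynomial_function_eq)
  then obtain L1 L2 where "\<forall>t\<in>{0..1}. \<bar>P t\<bar> \<le> L1" "\<forall>t\<in>{0..1}. \<bar>P' t\<bar> \<le> L2"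
    by (auto simp: bounded_iff)
  then obtain L where L: "\<And>t. t \<in> {0..1} \<Longrightarrow> \<bar>P t\<bar> \<le> L" "\<And>t. t \<in> {0..1} \<Longrightarrow> \<bar>P' t\<bar> \<le> L"
    by (metis max.coboundedI1 max.coboundedI2)
  have L0: "L \<ge> 0" using L(1)[of 0] by simp
  \<comment> \<open>Collects the coefficients of \<open>1 / k\<close>: the term with
    \<open>Q\<^sup>2\<close>, the integrand left after partial integration, and two boundary terms
    of size \<open>L * M / 2\<close> each.\<close>
  define C where "C = QK\<^sup>2 * M + (L * M + L * (B * M)) / 2 + L * M"
  have C: "C \<ge> 0" using L0 M B by (auto simp: C_def)
  show ?thesis
  proof (rule that)
    show "max 1 (2 * C / e) \<ge> 1" by simp
    fix k p r y v
    assume k: "k \<ge> max 1 (2 * C / e)" and s: "is_rqsol Q (k\<^sup>2) p r y v" and pr: "p\<^sup>2 + (r / k)\<^sup>2 = 1"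
    have k1: "k \<ge> 1" "k > 0" and kC: "C / k \<le> e / 2" using k e by (auto simp: field_simps)
    define E where "E = (\<lambda>t. exp (\<i> * of_real k * of_real t))"
    define w where "w = (\<lambda>t. complex_of_real (y t) + \<i> * of_real (v t) / of_real k)"
    define c where "c = (\<lambda>t. E t * w t)"
    define c' where "c' = (\<lambda>t. of_real (Q t) * (E t * E t) * cnj (c t) - \<i> * of_real ((Q t)\<^sup>2 / k) * E t * of_real (y t))"
    have normE: "norm (E t) = 1" for t by (simp add: E_def norm_exp_i_times flip: of_real_mult mult.assoc)
    have EE: "E t * cnj (E t) = 1" for t using complex_norm_square[of "E t"] normE[of t] by simp
    have dE: "(E has_vector_derivative \<i> * of_real k * E t) (at t within {0..1})" for t
      unfolding E_def
      by (rule has_vector_derivative_real_field) (auto intro!: derivative_eq_intros)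
    have dc: "(c has_vector_derivative c' t) (at t within {0..1})" if t: "t \<in> {0..1}" for t
    proof -
      note ds = is_rqsolD[OF s t, unfolded has_real_derivative_iff_has_vector_derivative,
          THEN bounded_linear.has_vector_derivative[OF bounded_linear_of_real]]
      have "(c has_vector_derivative (E t * (of_real (Q t * y t + v t)
          + \<i> * of_real (- (k\<^sup>2 + (Q t)\<^sup>2) * y t - Q t * v t) / of_real k)
          + \<i> * of_real k * E t * w t)) (at t within {0..1})"
        unfolding c_def w_def
        by (rule derivative_eq_intros dE ds refl)+ simp
      also have "E t * (of_real (Q t * y t + v t)
          + \<i> * of_real (- (k\<^sup>2 + (Q t)\<^sup>2) * y t - Q t * v t) / of_real k) + \<i> * of_real k * E t * w t = c' t"
      proof -
        have "c' t = of_real (Q t) * E t * (E t * cnj (E t)) * cnj (w t) - \<i> * of_real ((Q t)\<^sup>2 / k) * E t * of_real (y t)"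
          by (simp add: c'_def c_def)
        also have "\<dots> = E t * (of_real (Q t * y t + v t)
          + \<i> * of_real (- (k\<^sup>2 + (Q t)\<^sup>2) * y t - Q t * v t) / of_real k) + \<i> * of_real k * E t * w t"
          unfolding EE using k1 by (simp add: w_def field_simps power2_eq_square)
        finally show ?thesis by simp
      qed
      finally show ?thesis .
    qed
    have nw: "norm (c t) = norm (w t)" for t by (simp add: c_def norm_mult normE)
    have wC: "w t = Complex (y t) (v t / k)" for t by (simp add: w_def Complex_eq)
    have yc: "\<bar>y t\<bar> \<le> norm (c t)" for t
      using abs_Re_le_cmod[of "w t"] unfolding nw by (simp add: wC)
    have Q2: "(Q t)\<^sup>2 \<le> QK\<^sup>2" if "t \<in> {0..1}" for t
      using QK[OF that] QK_nonneg abs_le_square_iff[of "Q t" QK] by simp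
    have bc1: "norm (\<i> * of_real ((Q t)\<^sup>2 / k) * E t * of_real (y t)) \<le> QK\<^sup>2 / k * norm (c t)"
      if t: "t \<in> {0..1}" for t
    proof -
      have "norm (\<i> * of_real ((Q t)\<^sup>2 / k) * E t * of_real (y t)) = (Q t)\<^sup>2 / k * \<bar>y t\<bar>"
        using k1 by (simp add: norm_mult normE norm_divide norm_power)
      also have "\<dots> \<le> QK\<^sup>2 / k * norm (c t)"
        using Q2[OF t] k1 yc[of t] by (intro mult_mono divide_right_mono) auto
      finally show ?thesis .
    qed
    have bc: "norm (c' t) \<le> B * norm (c t) + 0" if t: "t \<in> {0..1}" for t
    proof -
      have "norm (c' t) \<le> norm (of_real (Q t) * (E t * E t) * cnj (c t)) + QK\<^sup>2 / k * norm (c t)"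
        unfolding c'_def by (rule order_trans[OF norm_triangle_ineq4]) (use bc1[OF t] in simp)
      also have "norm (of_real (Q t) * (E t * E t) * cnj (c t)) \<le> QK * norm (c t)"
        using QK[OF t] by (simp add: norm_mult normE mult_right_mono)
      also have "QK\<^sup>2 / k * norm (c t) \<le> QK\<^sup>2 * norm (c t)"
        using k1 by (intro mult_right_mono) (use mult_right_mono[of 1 k "QK\<^sup>2"] in \<open>auto simp: field_simps\<close>)
      finally show ?thesis by (simp add: B_def algebra_simps)
    qed
    have c0: "c 0 = Complex p (r / k)" using s by (simp add: c_def E_def wC is_rqsol_def)
    have cM: "norm (c t) \<le> M" if t: "t \<in> {0..1}" for t
    proof -
      have "(norm (c t))\<^sup>2 \<le> exp (2 * B + 1) * ((norm (c 0))\<^sup>2 + 0\<^sup>2)"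
        by (rule gronwall_sq[OF dc bc B _ t]) auto
      also have "(norm (c 0))\<^sup>2 = 1" unfolding c0 using pr by (simp add: cmod_power2)
      finally show ?thesis unfolding M_def by (intro real_le_rsqrt) simp
    qed
    have c'M: "norm (c' t) \<le> B * M" if t: "t \<in> {0..1}" for t
      using order_trans[OF bc[OF t]] mult_left_mono[OF cM[OF t] B] by simp
    \<comment> \<open>The boundary term of the partial integration,
      \<open>E t * E t / (2 * \<i> * k)\<close> being a primitive of \<open>E t * E t\<close>. In
      the derivative \<open>H'\<close> of \<open>c - G\<close> the oscillating term keeps only the
      small factor \<open>Q - P\<close>.\<close>
    define G where "G = (\<lambda>t. of_real (P t) * (E t * E t) * cnj (c t) / (2 * \<i> * of_real k))"
    define H' where "H' = (\<lambda>t. of_real (Q t - P t) * (E t * E t) * cnj (c t)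
        - \<i> * of_real ((Q t)\<^sup>2 / k) * E t * of_real (y t)
        - (E t * E t) * (of_real (P' t) * cnj (c t) + of_real (P t) * cnj (c' t)) / (2 * \<i> * of_real k))"
    have dH: "((\<lambda>t. c t - G t) has_vector_derivative H' t) (at t within {0..1})" if t: "t \<in> {0..1}" for t
    proof -
      have dP: "((\<lambda>t. complex_of_real (P t)) has_vector_derivative of_real (P' t)) (at t within {0..1})"
        by (intro bounded_linear.has_vector_derivative[OF bounded_linear_of_real])
           (simp add: P'(2) has_field_derivative_at_within flip: has_real_derivative_iff_has_vector_derivative)
      note dcc = bounded_linear.has_vector_derivative[OF bounded_linear_cnj dc[OF t]]
      have kk: "2 * \<i> * complex_of_real k \<noteq> 0" using k1 by simp
      have "((\<lambda>t. c t - G t) has_vector_derivative (c' t -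
          (of_real (P t) * (E t * E t) * cnj (c' t) + (of_real (P t) * (E t * (\<i> * of_real k * E t) + \<i> * of_real k * E t * E t)
            + of_real (P' t) * (E t * E t)) * cnj (c t)) / (2 * \<i> * of_real k))) (at t within {0..1})"
        unfolding G_def
        by (rule derivative_eq_intros dE dP dcc dc[OF t] refl)+
      also have "c' t - (of_real (P t) * (E t * E t) * cnj (c' t) + (of_real (P t) * (E t * (\<i> * of_real k * E t) + \<i> * of_real k * E t * E t)
            + of_real (P' t) * (E t * E t)) * cnj (c t)) / (2 * \<i> * of_real k) = H' t"
        using kk by (simp add: H'_def c'_def add_divide_distrib diff_divide_distrib algebra_simps)
      finally show ?thesis .
    qed
    have bH: "norm (H' t) \<le> d * M + QK\<^sup>2 * M / k + (L * M + L * (B * M)) / (2 * k)" if t: "t \<in> {0..1}" for t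
    proof -
      have a: "norm (of_real (Q t - P t) * (E t * E t) * cnj (c t)) \<le> d * M"
        using P(2)[OF t] cM[OF t] M d unfolding norm_mult normE
        by (simp add: norm_of_real del: of_real_diff) (intro mult_mono, auto)
      have "norm (\<i> * of_real ((Q t)\<^sup>2 / k) * E t * of_real (y t)) \<le> QK\<^sup>2 / k * norm (c t)" by (rule bc1[OF t])
      also have "\<dots> \<le> QK\<^sup>2 / k * M" using k1 cM[OF t] by (intro mult_left_mono) auto
      finally have b: "norm (\<i> * of_real ((Q t)\<^sup>2 / k) * E t * of_real (y t)) \<le> QK\<^sup>2 * M / k" by simp
      have "norm ((E t * E t) * (of_real (P' t) * cnj (c t) + of_real (P t) * cnj (c' t)))
          \<le> \<bar>P' t\<bar> * norm (c t) + \<bar>P t\<bar> * norm (c' t)"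
        unfolding norm_mult normE using norm_triangle_ineq[of "of_real (P' t) * cnj (c t)" "of_real (P t) * cnj (c' t)"]
        by (simp add: norm_mult)
      also have "\<dots> \<le> L * M + L * (B * M)"
        using L[OF t] L0 cM[OF t] c'M[OF t] by (intro add_mono mult_mono) auto
      finally have "norm ((E t * E t) * (of_real (P' t) * cnj (c t) + of_real (P t) * cnj (c' t)) / (2 * \<i> * of_real k))
          \<le> (L * M + L * (B * M)) / (2 * k)"
        unfolding norm_divide using k1 by (simp add: norm_mult divide_right_mono)
      with a b show ?thesis unfolding H'_def
        by (intro order_trans[OF norm_triangle_ineq4] add_mono order_trans[OF norm_triangle_ineq4]) auto
    qed
    have bG: "norm (G t) \<le> L * M / (2 * k)" if t: "t \<in> {0..1}" for t
    proof -
      have "norm (G t) = \<bar>P t\<bar> * norm (c t) / (2 * k)"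
        using k1 by (simp add: G_def norm_mult norm_divide normE)
      also have "\<dots> \<le> L * M / (2 * k)"
        using L[OF t] L0 cM[OF t] k1 by (intro divide_right_mono mult_mono) auto
      finally show ?thesis .
    qed
    have "(H' has_integral ((c 1 - G 1) - (c 0 - G 0))) {0..1}"
      by (rule fundamental_theorem_of_calculus) (auto intro!: dH)
    then have "norm ((c 1 - G 1) - (c 0 - G 0))
        \<le> (d * M + QK\<^sup>2 * M / k + (L * M + L * (B * M)) / (2 * k)) * measure lborel (cbox 0 (1::real))"
      using bH d M k1 L0 B by (intro has_integral_bound) auto
    moreover have "norm (c 1 - c 0) \<le> norm ((c 1 - G 1) - (c 0 - G 0)) + (norm (G 1) + norm (G 0))"
    proof -
      have "c 1 - c 0 = ((c 1 - G 1) - (c 0 - G 0)) + (G 1 - G 0)" by simp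
      then show ?thesis by (metis add_left_mono norm_triangle_ineq norm_triangle_ineq4 order_trans)
    qed
    ultimately have "norm (c 1 - c 0) \<le> d * M + QK\<^sup>2 * M / k + (L * M + L * (B * M)) / (2 * k) + L * M / (2 * k) + L * M / (2 * k)"
      using bG[of 0] bG[of 1] by simp
    also have "\<dots> = d * M + C / k" using k1 by (simp add: C_def field_simps)
    also have "d * M = e / 2" using M by (simp add: d_def)
    also have "e / 2 + C / k \<le> e" using kC by linarith
    finally have "norm (c 1 - c 0) \<le> e" .
    moreover have "c 1 - c 0 = E 1 * (Complex (y 1) (v 1 / k) - cis (- k) * Complex p (r / k))"
    proof -
      have "E 1 * cis (- k) = 1" by (simp add: E_def cis_conv_exp flip: exp_add)
      then show ?thesis by (simp add: c0 right_diff_distrib flip: mult.assoc) (simp add: c_def wC)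
    qed
    ultimately show "norm (Complex (y 1) (v 1 / k) - cis (- k) * Complex p (r / k)) \<le> e"
      by (simp add: norm_mult normE)
  qed
qed

lemma transfer_asymptotics:
  assumes "e > 0"
  obtains k0 where "k0 \<ge> 1" "\<And>k. k \<ge> k0 \<Longrightarrow> \<bar>rth (k\<^sup>2) - cos k\<bar> \<le> e"
    "\<And>k. k \<ge> k0 \<Longrightarrow> \<bar>rphd (k\<^sup>2) - cos k\<bar> \<le> e" "\<And>k. k \<ge> k0 \<Longrightarrow> \<bar>k * rph (k\<^sup>2) - sin k\<bar> \<le> e"
proof -
  obtain k0 where k0: "k0 \<ge> 1"
    and b: "\<And>k p r y v. k \<ge> k0 \<Longrightarrow> is_rqsol Q (k\<^sup>2) p r y v \<Longrightarrow> p\<^sup>2 + (r / k)\<^sup>2 = 1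
       \<Longrightarrow> norm (Complex (y 1) (v 1 / k) - cis (- k) * Complex p (r / k)) \<le> e"
    using rotating_frame[OF assms] by blast
  show ?thesis
  proof (rule that[OF k0])
    fix k assume k: "k \<ge> k0"
    then have kp: "k > 0" using k0 by simp
    obtain y v where s: "is_rqsol Q (k\<^sup>2) 1 0 y v" using ex_rqsol by blast
    have "norm (Complex (y 1) (v 1 / k) - cis (- k) * Complex 1 (0 / k)) \<le> e"
      by (rule b[OF k s]) simp
    from order_trans[OF abs_Re_le_cmod this] show "\<bar>rth (k\<^sup>2) - cos k\<bar> \<le> e"
      using rqsol_th[OF s] by simp
    obtain y v where s: "is_rqsol Q (k\<^sup>2) 0 1 y v" using ex_rqsol by blast
    \<comment> \<open>The solution with data \<open>(0, 1)\<close> is multiplied by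
      \<open>k\<close>, since \<open>rotating_frame\<close> normalizes the data by
      \<open>p\<^sup>2 + (r / k)\<^sup>2 = 1\<close>.\<close>
    have s': "is_rqsol Q (k\<^sup>2) 0 k (\<lambda>t. k * y t) (\<lambda>t. k * v t)"
      using s unfolding is_rqsol_def
      by (auto intro!: derivative_eq_intros simp: algebra_simps dest: bspec)
    have n: "norm (Complex (k * y 1) (k * v 1 / k) - cis (- k) * Complex 0 (k / k)) \<le> e"
      by (rule b[OF k s']) (use kp in simp)
    from order_trans[OF abs_Re_le_cmod n] show "\<bar>k * rph (k\<^sup>2) - sin k\<bar> \<le> e"
      using rqsol_ph[OF s] kp by simp
    from order_trans[OF abs_Im_le_cmod n] show "\<bar>rphd (k\<^sup>2) - cos k\<bar> \<le> e"
      using rqsol_ph[OF s] kp by simp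
  qed
qed

lemma transfer_differentiable: "rth differentiable at x" "rphd differentiable at x" "rph differentiable at x"
  by (rule transfer_real_deriv[of x]; force simp: real_differentiable_def)+

lemma transfer_trace_diff_tendsto: "((\<lambda>x. rphd x - rth x) \<longlongrightarrow> 0) at_top"
proof (rule tendstoI)
  fix e :: real assume e: "e > 0"
  then have "e / 3 > 0" by simp
  then obtain k0 where k0: "k0 \<ge> 1" "\<And>k. k \<ge> k0 \<Longrightarrow> \<bar>rth (k\<^sup>2) - cos k\<bar> \<le> e / 3"
    "\<And>k. k \<ge> k0 \<Longrightarrow> \<bar>rphd (k\<^sup>2) - cos k\<bar> \<le> e / 3"
    by (rule transfer_asymptotics) blast
  show "\<forall>\<^sub>F x in at_top. dist (rphd x - rth x) 0 < e"
    using eventually_ge_at_top[of "k0\<^sup>2"]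
  proof eventually_elim
    case (elim x)
    then have "sqrt x \<ge> k0" by (rule real_le_rsqrt)
    note b = k0(2,3)[OF this]
    have "(sqrt x)\<^sup>2 = x" using elim order_trans[OF zero_le_power2] by simp
    with b have "\<bar>rth x - cos (sqrt x)\<bar> \<le> e / 3" "\<bar>rphd x - cos (sqrt x)\<bar> \<le> e / 3" by simp_all
    then show ?case using e unfolding dist_real_def by linarith
  qed
qed

lemma dirichlet_unbounded: "\<exists>x\<ge>X. rph x = 0"
proof -
  obtain k0 where k0: "k0 \<ge> 1" "\<And>k. k \<ge> k0 \<Longrightarrow> \<bar>k * rph (k\<^sup>2) - sin k\<bar> \<le> 1 / 2"
    by (rule transfer_asymptotics[of "1/2"]) auto
  obtain n where n: "max k0 (max X 1) < real n" using reals_Archimedean2 by blast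
  \<comment> \<open>At \<open>k 0\<close> and \<open>k 1\<close> the sine takes the values 1 and -1,
    so an error of 1/2 leaves the sign of \<open>rph\<close> intact.\<close>
  define k where "k m = (2 * real n + m + 1 / 2) * pi" for m :: real
  have k_ge: "k m \<ge> real n" if "m \<ge> 0" for m
  proof -
    have "real n * 1 \<le> (2 * real n + m + 1 / 2) * pi"
      using that pi_ge_two by (intro mult_mono) auto
    then show ?thesis by (simp add: k_def)
  qed
  have s0: "sin (k 0) = 1"
  proof -
    have "k 0 = pi / 2 + 2 * real n * pi" by (simp add: k_def algebra_simps)
    then show ?thesis by (simp only: sin_add cos_2npi sin_2npi) simp
  qed
  have s1: "sin (k 1) = -1"
  proof -
    have "k 1 = k 0 + pi" by (simp add: k_def algebra_simps)
    then show ?thesis by (simp add: s0)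
  qed
  have kp: "k 0 \<ge> k0" "k 1 \<ge> k0" "k 0 > 0" "k 1 > 0" "k 0 \<le> k 1"
    using k_ge[of 0] k_ge[of 1] n by (auto simp: k_def algebra_simps)
  have "k 0 * rph ((k 0)\<^sup>2) > 0" using k0(2)[OF kp(1), unfolded s0] by linarith
  then have r0: "rph ((k 0)\<^sup>2) > 0" using kp by (simp add: zero_less_mult_iff)
  have "k 1 * rph ((k 1)\<^sup>2) < 0" using k0(2)[OF kp(2), unfolded s1] by linarith
  then have r1: "rph ((k 1)\<^sup>2) < 0" using kp by (simp add: mult_less_0_iff)
  have "continuous_on {(k 0)\<^sup>2..(k 1)\<^sup>2} rph"
    by (intro differentiable_imp_continuous_on differentiable_at_imp_differentiable_on transfer_differentiable)
  then obtain x where x: "(k 0)\<^sup>2 \<le> x" "rph x = 0"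
    using IVT2'[of rph "(k 1)\<^sup>2" 0 "(k 0)\<^sup>2"] r0 r1 kp by (auto intro: power_mono)
  have "X \<le> real n" using n by simp
  also have "\<dots> \<le> k 0" using k_ge[of 0] by simp
  also have "\<dots> \<le> (k 0)\<^sup>2" using kp k0(1) self_le_power[of "k 0" 2] by simp
  finally show ?thesis using x by (intro exI[of _ x]) simp
qed

end

section \<open>Square integrable potentials\<close>

lemma integral_increment_le:
  fixes f g :: "real \<Rightarrow> real"
  assumes f: "f integrable_on {0..1}" and g: "(\<lambda>r. \<bar>g r\<bar>) integrable_on {0..1}"
    and s: "s \<in> {0..1}" and t: "t \<in> {0..1}"
    and le: "\<And>r. r \<in> {min s t..max s t} \<Longrightarrow> \<bar>f r\<bar> \<le> d * \<bar>g r\<bar>"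
  shows "\<bar>integral {0..s} f - integral {0..t} f\<bar>
       \<le> d * \<bar>integral {0..s} (\<lambda>r. \<bar>g r\<bar>) - integral {0..t} (\<lambda>r. \<bar>g r\<bar>)\<bar>"
proof -
  have *: "\<bar>integral {0..b} f - integral {0..a} f\<bar>
       \<le> d * \<bar>integral {0..b} (\<lambda>r. \<bar>g r\<bar>) - integral {0..a} (\<lambda>r. \<bar>g r\<bar>)\<bar>"
    if ab: "0 \<le> a" "a \<le> b" "b \<le> 1" and le: "\<And>r. r \<in> {a..b} \<Longrightarrow> \<bar>f r\<bar> \<le> d * \<bar>g r\<bar>" for a b
  proof -
    have fi: "f integrable_on {a..b}" "f integrable_on {0..b}"
      using ab by (auto intro: integrable_on_subinterval[OF f])
    have gi: "(\<lambda>r. \<bar>g r\<bar>) integrable_on {a..b}" "(\<lambda>r. \<bar>g r\<bar>) integrable_on {0..b}"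
      using ab by (auto intro: integrable_on_subinterval[OF g])
    have 1: "integral {0..b} f - integral {0..a} f = integral {a..b} f"
      using Henstock_Kurzweil_Integration.integral_combine[OF ab(1,2) fi(2)] by simp
    have 2: "integral {0..b} (\<lambda>r. \<bar>g r\<bar>) - integral {0..a} (\<lambda>r. \<bar>g r\<bar>) = integral {a..b} (\<lambda>r. \<bar>g r\<bar>)"
      using Henstock_Kurzweil_Integration.integral_combine[OF ab(1,2) gi(2)] by simp
    have "norm (integral {a..b} f) \<le> integral {a..b} (\<lambda>r. d * \<bar>g r\<bar>)"
      by (rule integral_norm_bound_integral) (use fi gi le in \<open>auto intro: integrable_on_mult_right\<close>)
    also have "\<dots> = d * integral {a..b} (\<lambda>r. \<bar>g r\<bar>)" by simp
    also have "integral {a..b} (\<lambda>r. \<bar>g r\<bar>) = \<bar>integral {a..b} (\<lambda>r. \<bar>g r\<bar>)\<bar>"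
      using integral_nonneg[OF gi(1)] by simp
    finally show ?thesis unfolding 1 2 by simp
  qed
  show ?thesis
  proof (cases "t \<le> s")
    case True
    then show ?thesis using *[of t s] le s t by auto
  next
    case False
    then show ?thesis using *[of s t] le s t by (auto simp: abs_minus_commute)
  qed
qed

lemma has_derivative_of_increment:
  fixes H :: "real \<Rightarrow> real"
  assumes b: "\<And>s. s \<in> S \<Longrightarrow> \<bar>H s - H t - (s - t) * D\<bar> \<le> \<bar>s - t\<bar> * w s"
    and w: "(w \<longlongrightarrow> 0) (at t within S)"
  shows "(H has_real_derivative D) (at t within S)"
  unfolding has_field_derivative_iff
proof (rule Lim_transform2)
  show "((\<lambda>s. D) \<longlongrightarrow> D) (at t within S)" by simp
  have "\<forall>\<^sub>F s in at t within S. norm (D - (H s - H t) / (s - t)) \<le> w s"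
      unfolding eventually_at_filter
    proof (intro always_eventually allI impI)
      fix s assume s: "s \<noteq> t" "s \<in> S"
      have "D - (H s - H t) / (s - t) = - (H s - H t - (s - t) * D) / (s - t)" using s by (simp add: field_simps)
      then have "norm (D - (H s - H t) / (s - t)) = \<bar>H s - H t - (s - t) * D\<bar> / \<bar>s - t\<bar>"
        by (metis abs_divide abs_minus_cancel real_norm_def)
      also have "\<dots> \<le> w s" using b[OF s(2)] s(1) by (simp add: divide_le_eq mult.commute)
      finally show "norm (D - (H s - H t) / (s - t)) \<le> w s" .
    qed
  then show "((\<lambda>s. D - (H s - H t) / (s - t)) \<longlongrightarrow> 0) (at t within S)"
    by (rule Lim_null_comparison[OF _ w])
qed

lemma integral_abs_tendsto:
  assumes g: "(\<lambda>r. \<bar>g r\<bar>) integrable_on {0..1::real}" and t: "t \<in> {0..1}"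
  shows "((\<lambda>s. C * \<bar>integral {0..s} (\<lambda>r. \<bar>g r :: real\<bar>) - integral {0..t} (\<lambda>r. \<bar>g r\<bar>)\<bar>) \<longlongrightarrow> 0) (at t within {0..1})"
proof -
  have "((\<lambda>s. integral {0..s} (\<lambda>r. \<bar>g r\<bar>)) \<longlongrightarrow> integral {0..t} (\<lambda>r. \<bar>g r\<bar>)) (at t within {0..1})"
    using indefinite_integral_continuous_1[OF g] t unfolding continuous_on_def by blast
  from tendsto_mult_right_zero[OF tendsto_rabs_zero[OF LIM_zero[OF this]]] show ?thesis .
qed

text \<open>As \<open>p\<close> is merely integrable, its indefinite integral need not be
  differentiable at \<open>t\<close>. The factor \<open>s - r\<close> helps: it bounds the error of
  the increment by \<open>\<bar>s - t\<bar>\<close> times the integral of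
  \<open>\<bar>p\<bar>\<close> between \<open>t\<close> and \<open>s\<close>, which tends to
  0.\<close>

lemma has_derivative_Volterra:
  fixes p :: "real \<Rightarrow> real"
  assumes p: "p integrable_on {0..1}" "(\<lambda>r. r * p r) integrable_on {0..1}" "(\<lambda>r. \<bar>p r\<bar>) integrable_on {0..1}"
    and t: "t \<in> {0..1}"
  shows "((\<lambda>s. integral {0..s} (\<lambda>r. (s - r) * p r)) has_real_derivative integral {0..t} p) (at t within {0..1})"
proof (rule has_derivative_of_increment[OF _ integral_abs_tendsto[OF p(3) t]])
  fix s :: real assume s: "s \<in> {0..1}"
  have pu: "p integrable_on {0..u}" "(\<lambda>r. r * p r) integrable_on {0..u}" if "u \<in> {0..1}" for u
    using that by (auto intro: integrable_on_subinterval[OF p(1)] integrable_on_subinterval[OF p(2)])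
  have lin: "integral {0..u} (\<lambda>r. (c - r) * p r) = c * integral {0..u} p - integral {0..u} (\<lambda>r. r * p r)"
    if "u \<in> {0..1}" for u c
    unfolding left_diff_distrib using pu[OF that]
    by (subst integral_diff) (auto intro: integrable_on_mult_right)
  have "(\<lambda>r. (s - r) * p r) integrable_on {0..1}"
    unfolding left_diff_distrib by (intro integrable_diff integrable_on_mult_right p)
  then have "\<bar>integral {0..s} (\<lambda>r. (s - r) * p r) - integral {0..t} (\<lambda>r. (s - r) * p r)\<bar>
      \<le> \<bar>s - t\<bar> * \<bar>integral {0..s} (\<lambda>r. \<bar>p r\<bar>) - integral {0..t} (\<lambda>r. \<bar>p r\<bar>)\<bar>"
  proof (rule integral_increment_le[OF _ p(3) s t])
    fix r assume "r \<in> {min s t..max s t}"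
    then have "\<bar>s - r\<bar> \<le> \<bar>s - t\<bar>" by auto
    then show "\<bar>(s - r) * p r\<bar> \<le> \<bar>s - t\<bar> * \<bar>p r\<bar>" by (simp add: abs_mult mult_right_mono)
  qed
  then show "\<bar>integral {0..s} (\<lambda>r. (s - r) * p r) - integral {0..t} (\<lambda>r. (t - r) * p r) - (s - t) * integral {0..t} p\<bar>
      \<le> \<bar>s - t\<bar> * (1 * \<bar>integral {0..s} (\<lambda>r. \<bar>p r\<bar>) - integral {0..t} (\<lambda>r. \<bar>p r\<bar>)\<bar>)"
    unfolding lin[OF s] lin[OF t] by (simp add: algebra_simps)
qed

text \<open>A product rule for a second factor that is only continuous. It is applied to an
  indefinite integral of \<open>q\<close>, multiplied by \<open>y t - y s\<close>.\<close>

lemma DERIV_mult_continuous_at_zero: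
  fixes u h :: "real \<Rightarrow> real"
  assumes "(u has_real_derivative D) (at t within S)" "u t = 0" "continuous (at t within S) h"
  shows "((\<lambda>s. u s * h s) has_real_derivative D * h t) (at t within S)"
proof -
  obtain g where g: "\<And>z. u z - u t = g z * (z - t)" "continuous (at t within S) g" "g t = D"
    using assms(1) unfolding DERIV_caratheodory_within by blast
  show ?thesis unfolding DERIV_caratheodory_within
    by (intro exI[of _ "\<lambda>s. g s * h s"] conjI allI continuous_intros g(2) assms(3))
       (use g(1,3) assms(2) in \<open>auto simp: mult_ac\<close>)
qed

text \<open>\<open>P\<close> and \<open>Qh * y\<close> need not be differentiable at
  \<open>t\<close>, but the contributions of \<open>q * y\<close> cancel in their difference. This
  makes the quasi-derivative differentiable at every point although \<open>q\<close> is only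
  integrable.\<close>

lemma quasi_derivative_product:
  fixes q y :: "real \<Rightarrow> real" and l m D :: real
  defines "P \<equiv> \<lambda>s. integral {0..s} (\<lambda>r. (q r - l) * y r)"
    and "Qh \<equiv> \<lambda>s. integral {0..s} q - s * m"
  assumes q: "q integrable_on {0..1}" and aq: "(\<lambda>r. \<bar>q r - l\<bar>) integrable_on {0..1}"
    and qy: "(\<lambda>r. (q r - l) * y r) integrable_on {0..1}"
    and t: "t \<in> {0..1}" and y: "(y has_real_derivative D) (at t within {0..1})"
    and lip: "\<And>s. s \<in> {0..1} \<Longrightarrow> \<bar>y s - y t\<bar> \<le> L * \<bar>s - t\<bar>"
  shows "((\<lambda>s. P s - Qh s * y s) has_real_derivative (m - l) * y t - Qh t * D) (at t within {0..1})"
proof -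
  define Iq where "Iq = (\<lambda>s. integral {0..s} q)"
  \<comment> \<open>\<open>S\<close> isolates the part in which \<open>q\<close> is multiplied by
    \<open>y r - y t\<close>. By the Lipschitz bound it is of smaller order than
    \<open>s - t\<close>, so its derivative at \<open>t\<close> vanishes.\<close>
  define S where "S = (\<lambda>s. integral {0..s} (\<lambda>r. (q r - l) * (y r - y t)))"
  have ql: "(\<lambda>r. q r - l) integrable_on {0..1}" by (intro integrable_diff q integrable_const_ivl)
  have f: "(\<lambda>r. (q r - l) * (y r - y t)) integrable_on {0..1}"
    unfolding right_diff_distrib by (intro integrable_diff qy integrable_on_mult_left ql)
  have L0: "L \<ge> 0"
  proof -
    define s where "s = (if t = 0 then 1 else 0 :: real)"
    have "0 \<le> L * \<bar>s - t\<bar>" using order_trans[OF abs_ge_zero lip[of s]] by (simp add: s_def)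
    then show ?thesis using t by (auto simp: s_def zero_le_mult_iff split: if_splits)
  qed
  have dS: "(S has_real_derivative 0) (at t within {0..1})"
  proof (rule has_derivative_of_increment[OF _ integral_abs_tendsto[OF aq t]])
    fix s :: real assume s: "s \<in> {0..1}"
    have "\<bar>S s - S t\<bar> \<le> (L * \<bar>s - t\<bar>) * \<bar>integral {0..s} (\<lambda>r. \<bar>q r - l\<bar>) - integral {0..t} (\<lambda>r. \<bar>q r - l\<bar>)\<bar>"
      unfolding S_def
    proof (rule integral_increment_le[OF f aq s t])
      fix r assume r: "r \<in> {min s t..max s t}"
      then have "\<bar>y r - y t\<bar> \<le> L * \<bar>r - t\<bar>" using s t by (intro lip) auto
      also have "\<dots> \<le> L * \<bar>s - t\<bar>" using r L0 by (intro mult_left_mono) auto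
      finally show "\<bar>(q r - l) * (y r - y t)\<bar> \<le> L * \<bar>s - t\<bar> * \<bar>q r - l\<bar>"
        by (simp add: abs_mult mult.commute mult_left_mono)
    qed
    then show "\<bar>S s - S t - (s - t) * 0\<bar> \<le> \<bar>s - t\<bar> * (L * \<bar>integral {0..s} (\<lambda>r. \<bar>q r - l\<bar>) - integral {0..t} (\<lambda>r. \<bar>q r - l\<bar>)\<bar>)"
      by (simp add: algebra_simps)
  qed
  have Iqc: "continuous (at t within {0..1}) Iq"
    using indefinite_integral_continuous_1[OF q] t
    by (auto simp: Iq_def continuous_on_eq_continuous_within)
  have "((\<lambda>s. S s + ((y t - y s) * Iq s - l * s * y t + s * m * y s)) has_real_derivative
      0 + ((- D) * Iq t - l * y t + (m * y t + t * m * D))) (at t within {0..1})"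
    by (rule derivative_eq_intros dS DERIV_mult_continuous_at_zero[OF _ _ Iqc] y refl | simp)+
  then have "((\<lambda>s. P s - Qh s * y s) has_real_derivative
      0 + ((- D) * Iq t - l * y t + (m * y t + t * m * D))) (at t within {0..1})"
  proof (rule has_field_derivative_transform_within[of _ _ _ _ 1])
    fix s :: real assume s: "s \<in> {0..1}"
    have sub: "{0..s} \<subseteq> {0..1}" using s by auto
    note i = integrable_on_subinterval[OF q sub] integrable_on_subinterval[OF ql sub]
      integrable_on_subinterval[OF qy sub]
    have "S s = P s - y t * (Iq s - l * s)"
    proof -
      have "S s = integral {0..s} (\<lambda>r. (q r - l) * y r - (q r - l) * y t)"
        by (simp add: S_def right_diff_distrib)
      also have "\<dots> = P s - integral {0..s} (\<lambda>r. q r - l) * y t"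
        unfolding P_def using i by (subst integral_diff) (auto intro: integrable_on_mult_left)
      also have "integral {0..s} (\<lambda>r. q r - l) = Iq s - l * s"
        unfolding Iq_def using i s by (subst integral_diff) auto
      finally show ?thesis by simp
    qed
    then show "S s + ((y t - y s) * Iq s - l * s * y t + s * m * y s) = P s - Qh s * y s"
      by (simp add: Qh_def Iq_def algebra_simps)
  qed (use t in auto)
  then show ?thesis by (simp add: Qh_def Iq_def algebra_simps)
qed

lemma is_rqsol_from_derivs:
  assumes "y 0 = p" "v 0 = r"
    and "\<And>t. t \<in> {0..1} \<Longrightarrow> (y has_real_derivative Q t * y t + v t) (at t within {0..1})"
    and "\<And>t. t \<in> {0..1} \<Longrightarrow> (v has_real_derivative -(x + (Q t)\<^sup>2) * y t - Q t * v t) (at t within {0..1})"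
  shows "is_rqsol Q x p r y v"
  using assms unfolding is_rqsol_def by blast

lemma bounded_deriv_imp_lipschitz:
  fixes y :: "real \<Rightarrow> real"
  assumes "\<And>t. t \<in> {0..1} \<Longrightarrow> (y has_real_derivative y' t) (at t within {0..1})"
    and "continuous_on {0..1} y'"
  obtains L where "\<And>s t. s \<in> {0..1} \<Longrightarrow> t \<in> {0..1} \<Longrightarrow> \<bar>y s - y t\<bar> \<le> L * \<bar>s - t\<bar>"
proof -
  have "bounded (y' ` {0..1})"
    by (intro compact_imp_bounded compact_continuous_image assms compact_Icc)
  then obtain L where L: "\<forall>t\<in>{0..1}. \<bar>y' t\<bar> \<le> L" by (auto simp: bounded_iff)
  have "norm (y s - y t) \<le> L * norm (s - t)" if "s \<in> {0..1}" "t \<in> {0..1}" for s t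
    by (rule field_differentiable_bound[of "{0..1}" y y']) (use assms L that in auto)
  then show ?thesis using that by auto
qed

section \<open>Equivalence of the Volterra formulation with the quasi-derivative system\<close>

locale L2_potential =
  fixes q :: "real \<Rightarrow> real"
  assumes q_meas: "set_borel_measurable lborel {0..1} q"
    and q_L2: "set_integrable lborel {0..1} (\<lambda>t. (q t)\<^sup>2)"
begin

lemma q_int: "set_integrable lborel {0..1} q"
proof -
  have c: "set_integrable lborel {0..1::real} (\<lambda>t. 1 :: real)"
    by (simp add: set_integrable_def)
  have "set_integrable lborel {0..1} (\<lambda>t. 1 + (q t)\<^sup>2)"
    by (rule set_integral_add(1)[OF c q_L2])
  then show ?thesis
    unfolding set_integrable_def
  proof (rule Bochner_Integration.integrable_bound)
    show "(\<lambda>x. indicat_real {0..1} x *\<^sub>R q x) \<in> borel_measurable lborel"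
      using q_meas by (simp add: set_borel_measurable_def)
    have "\<bar>a\<bar> \<le> 1 + a\<^sup>2" for a :: real
      using zero_le_power2[of "\<bar>a\<bar> - 1"] unfolding power2_diff by simp
    then show "AE x in lborel. norm (indicat_real {0..1} x *\<^sub>R q x) \<le> norm (indicat_real {0..1} x *\<^sub>R (1 + (q x)\<^sup>2))"
      by (intro AE_I2) (auto simp: indicator_def)
  qed
qed

lemma q_mult_int:
  assumes y: "continuous_on {0..1} y"
  shows "set_integrable lborel {0..1} (\<lambda>s. (q s - l) * y s)"
proof -
  have c: "set_integrable lborel {0..1::real} (\<lambda>t. l)"
    by (simp add: set_integrable_def)
  have ql: "set_integrable lborel {0..1} (\<lambda>s. q s - l)" by (rule set_integral_diff(1)[OF q_int c])
  have "bounded (y ` {0..1})"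
    by (intro compact_imp_bounded compact_continuous_image y compact_Icc)
  then obtain B where B: "\<forall>t\<in>{0..1}. \<bar>y t\<bar> \<le> B" by (auto simp: bounded_iff)
  have "set_integrable lborel {0..1} (\<lambda>s. B * (q s - l))" using ql by simp
  then show ?thesis
    unfolding set_integrable_def
  proof (rule Bochner_Integration.integrable_bound)
    have "(\<lambda>x. indicat_real {0..1} x *\<^sub>R (q x - l)) \<in> borel_measurable lborel"
      using ql by (auto simp: set_integrable_def)
    moreover have "(\<lambda>x. indicat_real {0..1} x *\<^sub>R y x) \<in> borel_measurable lborel"
      using borel_measurable_continuous_on_indicator[OF _ y] by simp
    ultimately have "(\<lambda>x. (indicat_real {0..1} x *\<^sub>R (q x - l)) * (indicat_real {0..1} x *\<^sub>R y x)) \<in> borel_measurable lborel"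
      by (rule borel_measurable_times)
    also have "(\<lambda>x. (indicat_real {0..1} x *\<^sub>R (q x - l)) * (indicat_real {0..1} x *\<^sub>R y x))
        = (\<lambda>x. indicat_real {0..1} x *\<^sub>R ((q x - l) * y x))"
      by (auto simp: indicator_def)
    finally show "(\<lambda>x. indicat_real {0..1} x *\<^sub>R ((q x - l) * y x)) \<in> borel_measurable lborel" .
    show "AE x in lborel. norm (indicat_real {0..1} x *\<^sub>R ((q x - l) * y x))
        \<le> norm (indicat_real {0..1} x *\<^sub>R (B * (q x - l)))"
    proof (intro AE_I2)
      fix x :: real
      have "\<bar>q x - l\<bar> * \<bar>y x\<bar> \<le> \<bar>q x - l\<bar> * \<bar>B\<bar>" if "x \<in> {0..1}"
        using order_trans[OF bspec[OF B that] abs_ge_self] by (intro mult_left_mono) auto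
      then show "norm (indicat_real {0..1} x *\<^sub>R ((q x - l) * y x))
        \<le> norm (indicat_real {0..1} x *\<^sub>R (B * (q x - l)))"
        by (auto simp: indicator_def abs_mult mult.commute)
    qed
  qed
qed

lemma HK_integrable:
  assumes y: "continuous_on {0..1} y"
  shows "(\<lambda>s. (q s - l) * y s) integrable_on {0..1}" "(\<lambda>s. \<bar>(q s - l) * y s\<bar>) integrable_on {0..1}"
  using set_borel_integral_eq_integral(1)[OF q_mult_int[OF y]]
    set_borel_integral_eq_integral(1)[OF set_integrable_abs[OF q_mult_int[OF y]]] by auto

lemma LINT_eq_integral:
  assumes y: "continuous_on {0..1} y" and t: "t \<in> {0..1}"
  shows "(LINT s:{0..t}|lborel. (q s - l) * y s) = integral {0..t} (\<lambda>s. (q s - l) * y s)"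
proof (rule set_borel_integral_eq_integral(2))
  show "set_integrable lborel {0..t} (\<lambda>s. (q s - l) * y s)"
    by (rule set_integrable_subset[OF q_mult_int[OF y]]) (use t in auto)
qed

definition qmean :: real where "qmean = integral {0..1} q"
text \<open>Subtracting the mean gives \<open>Qp 1 = 0\<close> besides \<open>Qp 0 = 0\<close>, so
  the quasi-derivative agrees with the derivative at both ends; the price is a shift of the spectral
  parameter by \<open>qmean\<close>.\<close>

definition Qp :: "real \<Rightarrow> real" where "Qp t = integral {0..t} q - t * qmean"

lemma q_HK: "q integrable_on {0..1}" "(\<lambda>s. \<bar>q s - l\<bar>) integrable_on {0..1}"
  using set_borel_integral_eq_integral(1)[OF q_int] HK_integrable(2)[of "\<lambda>_. 1" l] by auto

lemma Qp_0 [simp]: "Qp 0 = 0" and Qp_1 [simp]: "Qp 1 = 0"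
  by (simp_all add: Qp_def qmean_def)

sublocale quasi_potential Qp
proof
  show "continuous_on {0..1} Qp"
    unfolding Qp_def by (intro continuous_intros indefinite_integral_continuous_1 q_HK)
qed

lemma Volterra_term:
  assumes y: "continuous_on {0..1} y" and t: "t \<in> {0..1}"
  shows "(LINT s:{0..t}|lborel. (t - s) * (q s - l) * y s) = integral {0..t} (\<lambda>s. (t - s) * ((q s - l) * y s))"
proof -
  have c: "continuous_on {0..1} (\<lambda>s. (t - s) * y s)" by (intro continuous_intros y)
  show ?thesis using LINT_eq_integral[OF c t, of l] by (simp add: mult_ac)
qed

lemma Volterra_deriv:
  assumes y: "continuous_on {0..1} y" and t: "t \<in> {0..1}"
  shows "((\<lambda>s. integral {0..s} (\<lambda>r. (s - r) * ((q r - l) * y r))) has_real_derivative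
     integral {0..t} (\<lambda>r. (q r - l) * y r)) (at t within {0..1})"
proof (rule has_derivative_Volterra[OF HK_integrable(1)[OF y] _ HK_integrable(2)[OF y] t])
  have c: "continuous_on {0..1} (\<lambda>s. s * y s)" by (intro continuous_intros y)
  show "(\<lambda>r. r * ((q r - l) * y r)) integrable_on {0..1}"
    using HK_integrable(1)[OF c, of l] by (simp add: mult_ac)
qed

lemma rqsol_imp_is_sol:
  assumes s: "is_rqsol Qp (l - qmean) y0 y1 y v"
  shows "is_sol q l y0 y1 y" "y1 + (LINT s:{0..1}|lborel. (q s - l) * y s) = v 1"
proof -
  note yc = is_rqsol_cont(1)[OF s] and vc = is_rqsol_cont(2)[OF s]
  define P where "P = (\<lambda>s. integral {0..s} (\<lambda>r. (q r - l) * y r))"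
  define y' where "y' t = Qp t * y t + v t" for t
  have y'c: "continuous_on {0..1} y'" unfolding y'_def by (intro continuous_intros Q_cont yc vc)
  have dy: "(y has_real_derivative y' t) (at t within {0..1})" if "t \<in> {0..1}" for t
    using is_rqsolD(1)[OF s that] by (simp add: y'_def)
  obtain L where L: "\<And>s t. s \<in> {0..1} \<Longrightarrow> t \<in> {0..1} \<Longrightarrow> \<bar>y s - y t\<bar> \<le> L * \<bar>s - t\<bar>"
    using bounded_deriv_imp_lipschitz[OF dy y'c] by blast
  have i: "y 0 = y0" "v 0 = y1" using s by (simp_all add: is_rqsol_def)
  have y'eq: "y' t = y1 + P t" if t: "t \<in> {0..1}" for t
  proof -
    have "((\<lambda>s. P s - Qp s * y s - v s) has_real_derivative 0) (at u within {0..1})" if u: "u \<in> {0..1}" for u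
    proof -
      have "((\<lambda>s. P s - Qp s * y s) has_real_derivative (qmean - l) * y u - Qp u * y' u) (at u within {0..1})"
        unfolding P_def Qp_def
        by (rule quasi_derivative_product[OF q_HK HK_integrable(1)[OF yc] u dy[OF u] L]) (use u in auto)
      from DERIV_diff[OF this is_rqsolD(2)[OF s u]] show ?thesis
        by (simp add: y'_def algebra_simps power2_eq_square)
    qed
    then obtain c where c: "\<forall>s\<in>{0..1}. P s - Qp s * y s - v s = c"
      using has_field_derivative_zero_constant[of "{0..1}"] by blast
    moreover have "P 0 = 0" by (simp add: P_def)
    ultimately have "c = - y1" using i by force
    then show ?thesis using c t by (simp add: y'_def algebra_simps)
  qed
  show "y1 + (LINT s:{0..1}|lborel. (q s - l) * y s) = v 1"
    using LINT_eq_integral[OF yc, of 1 l] y'eq[of 1] by (simp add: P_def y'_def)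
  show "is_sol q l y0 y1 y" unfolding is_sol_def
  proof (intro conjI ballI yc q_mult_int)
    fix t :: real assume t: "t \<in> {0..1}"
    define G where "G = (\<lambda>s. integral {0..s} (\<lambda>r. (s - r) * ((q r - l) * y r)))"
    have "((\<lambda>s. y s - y1 * s - G s) has_real_derivative 0) (at u within {0..1})" if u: "u \<in> {0..1}" for u
      unfolding G_def
      by (rule derivative_eq_intros dy[OF u] Volterra_deriv[OF yc u] refl)+ (simp add: y'eq[OF u] P_def)
    then obtain c where c: "\<forall>s\<in>{0..1}. y s - y1 * s - G s = c"
      using has_field_derivative_zero_constant[of "{0..1}"] by blast
    moreover have "G 0 = 0" by (simp add: G_def)
    ultimately have "c = y0" using i by force
    then show "y t = y0 + y1 * t + (LINT s:{0..t}|lborel. (t - s) * (q s - l) * y s)"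
      using c t Volterra_term[OF yc t, of l] by (force simp: G_def algebra_simps)
  qed
qed

text \<open>This direction gives uniqueness in the descriptions \<open>sol_val1\<close> and
  \<open>sol_der1\<close>: each Volterra solution is traced back to the system, whose values at 1
  are determined by the initial data.\<close>

lemma is_sol_imp_rqsol:
  assumes s: "is_sol q l y0 y1 y"
  obtains v where "is_rqsol Qp (l - qmean) y0 y1 y v" "v 1 = y1 + (LINT s:{0..1}|lborel. (q s - l) * y s)"
proof -
  have yc: "continuous_on {0..1} y" using s by (simp add: is_sol_def)
  define P where "P = (\<lambda>s. integral {0..s} (\<lambda>r. (q r - l) * y r))"
  define v where "v t = y1 + P t - Qp t * y t" for t
  have Pc: "continuous_on {0..1} P"
    unfolding P_def by (intro indefinite_integral_continuous_1 HK_integrable yc)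
  have yeq: "y t = y0 + y1 * t + integral {0..t} (\<lambda>r. (t - r) * ((q r - l) * y r))" if "t \<in> {0..1}" for t
    using s that Volterra_term[OF yc that, of l] by (simp add: is_sol_def)
  have dy: "(y has_real_derivative y1 + P t) (at t within {0..1})" if t: "t \<in> {0..1}" for t
  proof -
    have "((\<lambda>t. y0 + y1 * t + integral {0..t} (\<lambda>r. (t - r) * ((q r - l) * y r))) has_real_derivative y1 + P t)
        (at t within {0..1})"
      by (rule derivative_eq_intros Volterra_deriv[OF yc t] refl)+ (simp add: P_def)
    then show ?thesis
      by (rule has_field_derivative_transform_within[of _ _ _ _ 1]) (use t yeq in auto)
  qed
  obtain L where L: "\<And>s t. s \<in> {0..1} \<Longrightarrow> t \<in> {0..1} \<Longrightarrow> \<bar>y s - y t\<bar> \<le> L * \<bar>s - t\<bar>"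
    using bounded_deriv_imp_lipschitz[OF dy continuous_on_add[OF continuous_on_const Pc]] by blast
  show ?thesis
  proof (rule that)
    show "v 1 = y1 + (LINT s:{0..1}|lborel. (q s - l) * y s)"
      using LINT_eq_integral[OF yc, of 1 l] by (simp add: v_def P_def)
    show "is_rqsol Qp (l - qmean) y0 y1 y v"
    proof (rule is_rqsol_from_derivs)
      show "y 0 = y0" using yeq[of 0] by simp
      show "v 0 = y1" by (simp add: v_def P_def)
      fix t :: real assume t: "t \<in> {0..1}"
      show "(y has_real_derivative Qp t * y t + v t) (at t within {0..1})"
        using dy[OF t] by (simp add: v_def)
      have "((\<lambda>s. P s - Qp s * y s) has_real_derivative (qmean - l) * y t - Qp t * (y1 + P t)) (at t within {0..1})"
        unfolding P_def Qp_def
        by (rule quasi_derivative_product[OF q_HK HK_integrable(1)[OF yc] t dy[OF t, unfolded P_def] L]) (use t in auto)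
      from DERIV_add[OF DERIV_const[of y1] this]
      show "(v has_real_derivative - (l - qmean + (Qp t)\<^sup>2) * y t - Qp t * v t) (at t within {0..1})"
        unfolding v_def by (simp add: algebra_simps power2_eq_square)
    qed
  qed
qed

lemma theta1_eq: "theta1 q l = rth (l - qmean)"
  unfolding theta1_def sol_val1_def
proof (rule the_equality)
  obtain y v where s: "is_rqsol Qp (l - qmean) 1 0 y v" using ex_rqsol by blast
  show "\<exists>y. is_sol q l 1 0 y \<and> y 1 = rth (l - qmean)"
    using rqsol_imp_is_sol(1)[OF s] rqsol_th(1)[OF s] by blast
  show "c = rth (l - qmean)" if c: "\<exists>y. is_sol q l 1 0 y \<and> y 1 = c" for c
  proof -
    from c obtain y where "is_sol q l 1 0 y" "y 1 = c" by blast
    then show ?thesis using is_sol_imp_rqsol[of l 1 0 y] rqsol_th(1) by metis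
  qed
qed

lemma phid1_eq: "phid1 q l = rphd (l - qmean)"
  unfolding phid1_def sol_der1_def
proof (rule the_equality)
  obtain y v where s: "is_rqsol Qp (l - qmean) 0 1 y v" using ex_rqsol by blast
  show "\<exists>y. is_sol q l 0 1 y \<and> rphd (l - qmean) = 1 + (LINT s:{0..1}|lborel. (q s - l) * y s)"
    using rqsol_imp_is_sol[OF s] rqsol_ph(2)[OF s] by metis
  show "c = rphd (l - qmean)" if c: "\<exists>y. is_sol q l 0 1 y \<and> c = 1 + (LINT s:{0..1}|lborel. (q s - l) * y s)" for c
  proof -
    from c obtain y where "is_sol q l 0 1 y" "c = 1 + (LINT s:{0..1}|lborel. (q s - l) * y s)" by blast
    then show ?thesis using is_sol_imp_rqsol[of l 0 1 y] rqsol_ph(2) by metis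
  qed
qed

text \<open>Only integrals of \<open>q\<close> are seen, so symmetry almost everywhere suffices. The
  integral up to \<open>1 - t\<close> equals \<open>qmean\<close> minus the one up to
  \<open>t\<close>, and the linear term of \<open>Qp\<close> absorbs \<open>qmean\<close>.\<close>

lemma Qp_reflect:
  assumes ev: "AE t in lborel. t \<in> {0..1} \<longrightarrow> q (1 - t) = q t" and t: "t \<in> {0..1}"
  shows "Qp (1 - t) = - Qp t"
proof -
  have si: "set_integrable lborel {a..b} q" if "0 \<le> a" "b \<le> 1" for a b
    by (rule set_integrable_subset[OF q_int]) (use that in auto)
  have eq: "(LINT s:{a..b}|lborel. q s) = integral {a..b} q" if "0 \<le> a" "b \<le> 1" for a b
    by (rule set_borel_integral_eq_integral(2)[OF si[OF that]])
  have "integral {0..1-t} q = (LINT x|lborel. indicator {0..1-t} x *\<^sub>R q x)"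
    using eq[of 0 "1 - t"] t by (simp add: set_lebesgue_integral_def)
  also have "\<dots> = (LINT x|lborel. indicator {0..1-t} (1 + (-1) * x) *\<^sub>R q (1 + (-1) * x))"
    by (subst lborel_integral_real_affine[where c = "-1" and t = 1]) auto
  also have "\<dots> = (LINT x|lborel. indicator {t..1} x *\<^sub>R q x)"
  proof (rule integral_cong_AE)
    have m: "(\<lambda>x. indicator {0..1-t} x *\<^sub>R q x) \<in> borel_measurable borel"
      using si[of 0 "1 - t"] t by (auto simp: set_integrable_def dest: borel_measurable_integrable)
    show "(\<lambda>x. indicat_real {0..1-t} (1 + (-1) * x) *\<^sub>R q (1 + (-1) * x)) \<in> borel_measurable lborel"
      using measurable_compose[of "\<lambda>x. 1 + (-1) * x" lborel borel, OF _ m] by simp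
    show "(\<lambda>x. indicat_real {t..1} x *\<^sub>R q x) \<in> borel_measurable lborel"
      using si[of t 1] t by (auto simp: set_integrable_def dest: borel_measurable_integrable)
    show "AE x in lborel. indicat_real {0..1-t} (1 + (-1) * x) *\<^sub>R q (1 + (-1) * x) = indicat_real {t..1} x *\<^sub>R q x"
      using ev by eventually_elim (use t in \<open>auto simp: indicator_def\<close>)
  qed
  also have "\<dots> = integral {t..1} q"
    using eq[of t 1] t by (simp add: set_lebesgue_integral_def)
  also have "\<dots> = qmean - integral {0..t} q"
    using Henstock_Kurzweil_Integration.integral_combine[of 0 t 1 q] t q_HK by (simp add: qmean_def)
  finally show ?thesis by (simp add: Qp_def algebra_simps)
qed

end

section \<open>Zeros and multiplicities of real entire functions\<close>

text \<open>\<open>zmult\<close> is defined by iterated real derivatives. A holomorphic extension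
  guarantees that these exist, that zeros of a function not identically zero have finite order, and
  that they are isolated.\<close>

definition real_entire :: "(real \<Rightarrow> real) \<Rightarrow> bool" where
  "real_entire f \<longleftrightarrow> (\<exists>g. g holomorphic_on UNIV \<and> (\<forall>x. g (of_real x) = of_real (f x)))"

lemma real_entire_const: "real_entire (\<lambda>x. c)"
  unfolding real_entire_def by (rule exI[of _ "\<lambda>z. of_real c"]) auto

lemma real_entire_add:
  assumes "real_entire f" "real_entire g"
  shows "real_entire (\<lambda>x. f x + g x)"
proof -
  obtain F G where "F holomorphic_on UNIV" "\<forall>x. F (of_real x) = of_real (f x)"
    "G holomorphic_on UNIV" "\<forall>x. G (of_real x) = of_real (g x)"
    using assms unfolding real_entire_def by blast
  then show ?thesis unfolding real_entire_def
    by (intro exI[of _ "\<lambda>z. F z + G z"]) (auto intro!: holomorphic_intros)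
qed

lemma real_entire_mult:
  assumes "real_entire f" "real_entire g"
  shows "real_entire (\<lambda>x. f x * g x)"
proof -
  obtain F G where "F holomorphic_on UNIV" "\<forall>x. F (of_real x) = of_real (f x)"
    "G holomorphic_on UNIV" "\<forall>x. G (of_real x) = of_real (g x)"
    using assms unfolding real_entire_def by blast
  then show ?thesis unfolding real_entire_def
    by (intro exI[of _ "\<lambda>z. F z * G z"]) (auto intro!: holomorphic_intros)
qed

lemma real_entire_diff: "real_entire f \<Longrightarrow> real_entire g \<Longrightarrow> real_entire (\<lambda>x. f x - g x)"
  using real_entire_add[OF _ real_entire_mult[OF real_entire_const[of "-1"]], of f g] by simp

lemma real_entire_power: "real_entire f \<Longrightarrow> real_entire (\<lambda>x. f x ^ n)"
  by (induction n) (simp_all add: real_entire_const real_entire_mult)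

lemma real_entire_shift:
  assumes "real_entire f"
  shows "real_entire (\<lambda>x. f (x - c))"
proof -
  obtain F where F: "F holomorphic_on UNIV" "\<forall>x. F (of_real x) = of_real (f x)"
    using assms unfolding real_entire_def by blast
  have "(\<lambda>z. F (z - of_real c)) holomorphic_on UNIV"
    by (rule holomorphic_on_compose_gen[OF _ F(1), unfolded o_def]) (auto intro!: holomorphic_intros)
  moreover have "F (of_real x - of_real c) = of_real (f (x - c))" for x
    using F(2) by (metis of_real_diff)
  ultimately show ?thesis unfolding real_entire_def by blast
qed

lemma higher_deriv_of_real:
  fixes g :: "complex \<Rightarrow> complex"
  assumes "g holomorphic_on UNIV" "\<And>x. g (of_real x) = of_real (f x)"
  shows "(deriv ^^ n) g (of_real x) = of_real ((deriv ^^ n) f x)"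
proof (induction n arbitrary: x)
  case (Suc n)
  let ?G = "(deriv ^^ n) g" and ?f = "(deriv ^^ n) f"
  have hol: "?G holomorphic_on UNIV" by (rule holomorphic_higher_deriv[OF assms(1)]) simp
  have "(?G has_field_derivative deriv ?G (of_real x)) (at (of_real x))"
    by (rule holomorphic_derivI[OF hol]) auto
  from has_vector_derivative_real_field[OF this]
  have d: "((\<lambda>x. of_real (?f x)) has_vector_derivative deriv ?G (of_real x)) (at x)"
    by (simp add: Suc.IH)
  from bounded_linear.has_vector_derivative[OF bounded_linear_Re d]
  have "(?f has_real_derivative Re (deriv ?G (of_real x))) (at x)"
    by (simp add: has_real_derivative_iff_has_vector_derivative)
  then have r: "deriv ?f x = Re (deriv ?G (of_real x))" by (rule DERIV_imp_deriv)
  from bounded_linear.has_vector_derivative[OF bounded_linear_Im d]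
  have "((\<lambda>x. 0) has_real_derivative Im (deriv ?G (of_real x))) (at x)"
    by (simp add: has_real_derivative_iff_has_vector_derivative)
  then have "Im (deriv ?G (of_real x)) = 0" using DERIV_unique[OF _ DERIV_const] by blast
  then show ?case using r by (simp add: complex_eq_iff)
qed (simp add: assms)

lemma real_entire_finite_zeros:
  assumes "real_entire f" "f x0 \<noteq> 0"
  shows "finite {x. a \<le> x \<and> x \<le> b \<and> f x = 0}"
proof -
  obtain F where F: "F holomorphic_on UNIV" "\<forall>x. F (of_real x) = of_real (f x)"
    using assms(1) unfolding real_entire_def by blast
  have "finite (of_real ` {x. a \<le> x \<and> x \<le> b \<and> f x = 0} :: complex set)"
  proof (cases "F constant_on UNIV")
    case True
    then have "f x \<noteq> 0" for x
      using F(2) assms(2) unfolding constant_on_def by (metis UNIV_I of_real_eq_iff)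
    then show ?thesis by simp
  next
    case False
    have "compact (of_real ` {a..b} :: complex set)"
      by (intro compact_continuous_image continuous_intros compact_Icc)
    from holomorphic_compact_finite_zeros[OF F(1) _ _ this _ False]
    have "finite {z \<in> of_real ` {a..b}. F z = 0}" by auto
    then show ?thesis by (rule finite_subset[rotated]) (auto simp: F(2))
  qed
  then show ?thesis by (rule finite_imageD) (simp add: inj_on_def)
qed

text \<open>If all derivatives vanished at \<open>x\<close>, the identity theorem would annihilate
  \<open>f\<close>. So the \<open>LEAST\<close> in \<open>zmult\<close> is attained and equals the
  order of the zero of the extension.\<close>

lemma real_entire_order:
  assumes f: "real_entire f" and nz: "f x0 \<noteq> 0"
  obtains G where "isCont G x" "G x \<noteq> 0" "\<forall>\<^sub>F y in nhds x. f y = (y - x) ^ zmult f x * G y"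
proof -
  obtain F where F: "F holomorphic_on UNIV" "\<And>x. F (of_real x) = of_real (f x)"
    using f unfolding real_entire_def by blast
  have "\<exists>n. (deriv ^^ n) f x \<noteq> 0"
  proof (rule ccontr)
    assume "\<nexists>n. (deriv ^^ n) f x \<noteq> 0"
    then have "(deriv ^^ n) F (of_real x) = 0" for n by (simp add: higher_deriv_of_real[OF F])
    then have "F (of_real x0) = 0"
      using holomorphic_fun_eq_0_on_connected[OF F(1), of "of_real x" "of_real x0"] connected_UNIV by simp
    then show False using nz F(2) by simp
  qed
  then have m: "(deriv ^^ zmult f x) f x \<noteq> 0" unfolding zmult_def by (rule LeastI_ex)
  have lt: "(deriv ^^ i) f x = 0" if "i < zmult f x" for i
    using not_less_Least[of i] that unfolding zmult_def by blast
  show ?thesis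
  proof (cases "zmult f x = 0")
    case True
    have "(f has_real_derivative deriv f x) (at x)"
    proof -
      have "(F has_field_derivative deriv F (of_real x)) (at (of_real x))"
        by (rule holomorphic_derivI[OF F(1)]) auto
      from bounded_linear.has_vector_derivative[OF bounded_linear_Re has_vector_derivative_real_field[OF this]]
      have "(f has_real_derivative Re (deriv F (of_real x))) (at x)"
        by (simp add: F(2) has_real_derivative_iff_has_vector_derivative)
      then show ?thesis by (simp add: DERIV_imp_deriv)
    qed
    then have "isCont f x" by (rule DERIV_isCont)
    then show ?thesis using that[of f] m True by simp
  next
    case False
    have mF: "(deriv ^^ zmult f x) F (of_real x) \<noteq> 0" using m by (simp add: higher_deriv_of_real[OF F])
    obtain G r where G: "0 < r" "G holomorphic_on ball (of_real x) r"
      "\<And>w. w \<in> ball (of_real x) r \<Longrightarrow> F w - F (of_real x) = (w - of_real x) ^ zmult f x * G w"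
      "\<And>w. w \<in> ball (of_real x) r \<Longrightarrow> G w \<noteq> 0"
      by (rule holomorphic_factor_order_of_zero[OF F(1) _ _ _ mF])
         (use False lt in \<open>auto simp: higher_deriv_of_real[OF F]\<close>)
    have fx: "f x = 0" using lt[of 0] False by simp
    have near: "\<forall>\<^sub>F y in nhds x. complex_of_real y \<in> ball (of_real x) r"
      using eventually_nhds_ball[OF G(1), of x]
      by eventually_elim (simp add: dist_of_real)
    have eq: "of_real (f y) = (of_real (y - x)) ^ zmult f x * G (of_real y)"
      if "complex_of_real y \<in> ball (of_real x) r" for y
      using G(3)[OF that] fx by (simp add: F(2))
    show ?thesis
    proof (rule that[of "\<lambda>y. Re (G (of_real y))"])
      have cG: "isCont G (complex_of_real x)"
        using holomorphic_on_imp_continuous_on[OF G(2)] G(1) by (simp add: continuous_on_eq_continuous_at)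
      have cGr: "isCont (\<lambda>y. G (complex_of_real y)) x"
        using cG by (intro isCont_o2[where f = complex_of_real and g = G]) (auto intro!: continuous_intros)
      then show "isCont (\<lambda>y. Re (G (of_real y))) x"
        unfolding isCont_def by (rule tendsto_Re)
      \<comment> \<open>The holomorphic cofactor is real at real \<open>y \<noteq> x\<close> by
        division, hence at \<open>x\<close> by continuity; its real part therefore does not vanish
        at \<open>x\<close>.\<close>
      have im: "Im (G (of_real y)) = 0" if "complex_of_real y \<in> ball (of_real x) r" "y \<noteq> x" for y
      proof -
        have "of_real (f y) = of_real ((y - x) ^ zmult f x) * G (of_real y)"
          using eq[OF that(1)] by (simp only: of_real_power)
        moreover have "complex_of_real ((y - x) ^ zmult f x) \<noteq> 0" using that(2) by simp
        ultimately have "G (of_real y) = of_real (f y / (y - x) ^ zmult f x)"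
          by (metis nonzero_mult_div_cancel_left of_real_divide)
        then show ?thesis by simp
      qed
      have "((\<lambda>y. Im (G (of_real y))) \<longlongrightarrow> Im (G (of_real x))) (at x)"
        using cGr by (intro tendsto_intros) (simp add: isCont_def)
      moreover have "((\<lambda>y. Im (G (of_real y))) \<longlongrightarrow> 0) (at x)"
      proof (rule tendsto_eventually)
        show "\<forall>\<^sub>F y in at x. Im (G (of_real y)) = 0"
          using near unfolding eventually_at_filter by eventually_elim (auto intro: im)
      qed
      ultimately have "Im (G (of_real x)) = 0" by (rule LIM_unique)
      moreover have "G (of_real x) \<noteq> 0" using G(4)[of "of_real x"] G(1) by simp
      ultimately show "Re (G (of_real x)) \<noteq> 0" by (simp add: complex_eq_iff)
      show "\<forall>\<^sub>F y in nhds x. f y = (y - x) ^ zmult f x * Re (G (of_real y))"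
        using near
      proof eventually_elim
        case (elim y)
        have "f y = Re (of_real ((y - x) ^ zmult f x) * G (of_real y))"
          using eq[OF elim] by (metis Re_complex_of_real of_real_power)
        then show ?case by simp
      qed
    qed
  qed
qed

text \<open>Reads a multiplicity off a single limit instead of iterated derivatives; this makes
  products easy to treat.\<close>

lemma zmult_eq_of_tendsto:
  assumes f: "real_entire f" "f x0 \<noteq> 0"
    and lim: "((\<lambda>y. f y / (y - x) ^ j) \<longlongrightarrow> C) (at x)" and C: "C \<noteq> 0"
  shows "zmult f x = j"
proof -
  define m where "m = zmult f x"
  obtain G where G: "isCont G x" "G x \<noteq> 0" "\<forall>\<^sub>F y in nhds x. f y = (y - x) ^ m * G y"
    using real_entire_order[OF f] unfolding m_def by blast
  have Gl: "(G \<longlongrightarrow> G x) (at x)" using G(1) by (simp add: isCont_def)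
  have z: "((\<lambda>y. (y - x) ^ i) \<longlongrightarrow> 0) (at x)" if "i > 0" for i
  proof -
    have "((\<lambda>y. (y - x) ^ i) \<longlongrightarrow> (x - x) ^ i) (at x)" by (intro tendsto_intros)
    moreover have "(x - x) ^ i = 0" using that by simp
    ultimately show ?thesis by metis
  qed
  have ev: "\<forall>\<^sub>F y in at x. y \<noteq> x \<and> f y = (y - x) ^ m * G y"
    using G(3) unfolding eventually_at_filter by eventually_elim auto
  consider "m < j" | "j < m" | "m = j" by linarith
  then show ?thesis
  proof cases
    case 1
    have "((\<lambda>y. (y - x) ^ (j - m) * (f y / (y - x) ^ j)) \<longlongrightarrow> 0 * C) (at x)"
      using z[of "j - m"] lim 1 by (intro tendsto_mult) auto
    moreover have "\<forall>\<^sub>F y in at x. (y - x) ^ (j - m) * (f y / (y - x) ^ j) = G y"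
      using ev
    proof eventually_elim
      case (elim y)
      have "(y - x) ^ j = (y - x) ^ m * (y - x) ^ (j - m)" using 1 by (simp flip: power_add)
      then show ?case using elim by simp
    qed
    ultimately have "(G \<longlongrightarrow> 0) (at x)" by (simp add: tendsto_cong)
    then have "G x = 0" using LIM_unique[OF Gl] by simp
    then show ?thesis using G(2) by simp
  next
    case 2
    have "((\<lambda>y. (y - x) ^ (m - j) * G y) \<longlongrightarrow> 0 * G x) (at x)"
      using z[of "m - j"] Gl 2 by (intro tendsto_mult) auto
    moreover have "\<forall>\<^sub>F y in at x. (y - x) ^ (m - j) * G y = f y / (y - x) ^ j"
      using ev
    proof eventually_elim
      case (elim y)
      have "(y - x) ^ m = (y - x) ^ j * (y - x) ^ (m - j)" using 2 by (simp flip: power_add)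
      then show ?case using elim by simp
    qed
    ultimately have "((\<lambda>y. f y / (y - x) ^ j) \<longlongrightarrow> 0) (at x)" by (simp add: tendsto_cong)
    then have "C = 0" using LIM_unique[OF lim] by simp
    then show ?thesis using C by simp
  qed (simp add: m_def)
qed

lemma zmult_pos:
  assumes f: "real_entire f" "f x0 \<noteq> 0" and "f x = 0"
  shows "zmult f x \<ge> 1"
proof (rule ccontr)
  assume "\<not> zmult f x \<ge> 1"
  then have "zmult f x = 0" by simp
  then obtain G where G: "G x \<noteq> 0" "\<forall>\<^sub>F y in nhds x. f y = (y - x) ^ 0 * G y"
    using real_entire_order[OF f, of x] by metis
  then show False using eventually_nhds_x_imp_x[OF G(2)] assms(3) by simp
qed

lemma zmult_prod:
  assumes f: "real_entire (\<lambda>x. \<kappa> * (\<Prod>i\<in>A. g i x))" and A: "finite A"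
    and nz: "\<kappa> \<noteq> 0" "\<And>i. i \<in> A \<Longrightarrow> g i x0 \<noteq> 0"
    and diff: "\<And>i. i \<in> A \<Longrightarrow> g i differentiable (at x)"
    and simple: "\<And>i. i \<in> A \<Longrightarrow> g i x = 0 \<Longrightarrow> deriv (g i) x \<noteq> 0"
  shows "zmult (\<lambda>x. \<kappa> * (\<Prod>i\<in>A. g i x)) x = card {i\<in>A. g i x = 0}"
proof (rule zmult_eq_of_tendsto[OF f])
  show "\<kappa> * (\<Prod>i\<in>A. g i x0) \<noteq> 0" using nz A by simp
  \<comment> \<open>The limit of the factor \<open>g i\<close>, divided by \<open>y - x\<close> if
    it vanishes at \<open>x\<close>.\<close>
  define c where "c i = (if g i x = 0 then deriv (g i) x else g i x)" for i
  show "\<kappa> * (\<Prod>i\<in>A. c i) \<noteq> 0" using nz A simple by (auto simp: c_def)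
  have lim: "((\<lambda>y. g i y / (if g i x = 0 then y - x else 1)) \<longlongrightarrow> c i) (at x)" if i: "i \<in> A" for i
  proof -
    have d: "(g i has_real_derivative deriv (g i) x) (at x)"
      using diff[OF i] by (simp add: DERIV_deriv_iff_real_differentiable)
    show ?thesis
    proof (cases "g i x = 0")
      case True
      then show ?thesis using d by (simp add: c_def has_field_derivative_iff)
    next
      case False
      then show ?thesis using DERIV_isCont[OF d] by (simp add: c_def isCont_def)
    qed
  qed
  have "((\<lambda>y. \<kappa> * (\<Prod>i\<in>A. g i y / (if g i x = 0 then y - x else 1))) \<longlongrightarrow> \<kappa> * (\<Prod>i\<in>A. c i)) (at x)"
    by (intro tendsto_intros lim)
  also have "(\<lambda>y. \<kappa> * (\<Prod>i\<in>A. g i y / (if g i x = 0 then y - x else 1)))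
      = (\<lambda>y. \<kappa> * (\<Prod>i\<in>A. g i y) / (y - x) ^ card {i\<in>A. g i x = 0})"
    using A by (simp add: prod_dividef prod.If_cases Int_def)
  finally show "((\<lambda>y. \<kappa> * (\<Prod>i\<in>A. g i y) / (y - x) ^ card {i\<in>A. g i x = 0}) \<longlongrightarrow> \<kappa> * (\<Prod>i\<in>A. c i)) (at x)" .
qed

lemma zcount_below_step:
  assumes fin: "\<And>b. finite {y. y < b \<and> D y = 0}" and x: "D x = 0" "x < x'"
  shows "zcount_below D x + zmult D x \<le> zcount_below D x'"
proof -
  have "zcount_below D x + zmult D x = (\<Sum>y\<in>insert x {y. y < x \<and> D y = 0}. zmult D y)"
    using fin by (simp add: zcount_below_def)
  also have "\<dots> \<le> zcount_below D x'"
    unfolding zcount_below_def using x by (intro sum_mono2 fin) auto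
  finally show ?thesis .
qed

text \<open>Different zeros occupy disjoint blocks of positions, so one matching zero determines the
  value of \<open>THE\<close>.\<close>

lemma zseq_eqI:
  assumes fin: "\<And>b. finite {y. y < b \<and> D y = 0}"
    and x: "D x = 0" "zcount_below D x \<le> j" "j < zcount_below D x + zmult D x"
  shows "zseq D j = x"
  unfolding zseq_def
proof (rule the_equality)
  fix x' assume x': "D x' = 0 \<and> zcount_below D x' \<le> j \<and> j < zcount_below D x' + zmult D x'"
  show "x' = x"
  proof (rule linorder_cases[of x x'])
    assume "x < x'"
    then show ?thesis using zcount_below_step[OF fin x(1)] x x' by fastforce
  next
    assume "x' < x"
    then show ?thesis using zcount_below_step[OF fin, of x' x] x x' by fastforce
  qed simp
qed (use x in auto)

lemma least_elem_above:
  fixes S :: "real set"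
  assumes fin: "\<And>b. finite {y\<in>S. y < b}" and P: "x0 \<in> S" "P x0"
  obtains x where "x \<in> S" "P x" "\<And>y. y \<in> S \<Longrightarrow> P y \<Longrightarrow> x \<le> y"
proof -
  let ?A = "{y\<in>S. y < x0 + 1 \<and> P y}"
  have A: "finite ?A" "x0 \<in> ?A" using P by (auto intro: finite_subset[OF _ fin[of "x0 + 1"]])
  then have M: "Min ?A \<in> ?A" by (intro Min_in) blast+
  show ?thesis
  proof (rule that[of "Min ?A"])
    fix y assume y: "y \<in> S" "P y"
    show "Min ?A \<le> y"
    proof (cases "y < x0 + 1")
      case True
      then show ?thesis using A(1) y by (intro Min_le) auto
    next
      case False
      then show ?thesis using M by simp
    qed
  qed (use M in auto)
qed

text \<open>Every position is occupied by some zero, although it is not said which. This serves the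
  claims that hold without a grouping of the zeros, such as those on \<open>Dplus\<close> when
  \<open>sk N k a = 0\<close>.\<close>

lemma zseq_zero:
  assumes fin: "\<And>b. finite {y. y < b \<and> D y = 0}" and unb: "\<And>b. \<exists>y>b. D y = 0"
    and mult: "\<And>x. D x = 0 \<Longrightarrow> zmult D x \<ge> 1"
  shows "D (zseq D j) = 0"
proof -
  have fin': "finite {y \<in> {y. D y = 0}. y < b}" for b
    using fin[of b] by (rule finite_subset[rotated]) auto
  have "\<exists>x. D x = 0 \<and> zcount_below D x \<le> j \<and> j < zcount_below D x + zmult D x"
  proof (induction j)
    case 0
    obtain x0 where "D x0 = 0" using unb by blast
    then obtain x where x: "D x = 0" "\<And>y. D y = 0 \<Longrightarrow> x \<le> y"
      using least_elem_above[OF fin', of x0 "\<lambda>_. True"] by auto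
    then have e: "{y. y < x \<and> D y = 0} = {}" using not_le by blast
    have "zcount_below D x = 0" unfolding zcount_below_def e by simp
    then show ?case using x mult[OF x(1)] by (intro exI[of _ x]) auto
  next
    case (Suc j)
    then obtain x where x: "D x = 0" "zcount_below D x \<le> j" "j < zcount_below D x + zmult D x" by blast
    show ?case
    proof (cases "Suc j < zcount_below D x + zmult D x")
      case True
      then show ?thesis using x by (intro exI[of _ x]) auto
    next
      case False
      then have j: "Suc j = zcount_below D x + zmult D x" using x by simp
      obtain x0 where "x < x0" "D x0 = 0" using unb by blast
      then obtain x' where x': "D x' = 0" "x < x'" "\<And>y. D y = 0 \<Longrightarrow> x < y \<Longrightarrow> x' \<le> y"
        using least_elem_above[OF fin', of x0 "\<lambda>y. x < y"] by auto
      have "{y. y < x' \<and> D y = 0} = insert x {y. y < x \<and> D y = 0}"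
      proof (intro set_eqI iffI)
        fix y assume "y \<in> {y. y < x' \<and> D y = 0}"
        then show "y \<in> insert x {y. y < x \<and> D y = 0}" using x'(3)[of y] by force
      qed (use x x' in auto)
      then have "zcount_below D x' = Suc j" unfolding j using fin by (simp add: zcount_below_def)
      then show ?thesis using x' mult[OF x'(1)] by (intro exI[of _ x']) auto
    qed
  qed
  then obtain x where x: "D x = 0" "zcount_below D x \<le> j" "j < zcount_below D x + zmult D x" by blast
  then show ?thesis using zseq_eqI[OF fin x] by simp
qed

section \<open>Zeros between Dirichlet eigenvalues\<close>

text \<open>A first return to nonnegative values would be a zero approached from below, which
  contradicts a negative slope.\<close>

lemma crossing_down:
  fixes g :: "real \<Rightarrow> real"
  assumes diff: "\<And>x. g differentiable (at x)"
    and neg: "\<And>z. x \<le> z \<Longrightarrow> z \<le> y \<Longrightarrow> g z = 0 \<Longrightarrow> deriv g z < 0"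
    and xy: "x < y" and gx: "g x \<le> 0"
  shows "g y < 0"
proof (rule ccontr)
  assume gy: "\<not> g y < 0"
  have cont: "continuous_on A g" for A
    by (intro differentiable_imp_continuous_on differentiable_at_imp_differentiable_on diff)
  have d: "(g has_real_derivative deriv g z) (at z)" for z
    using diff by (simp add: DERIV_deriv_iff_real_differentiable)
  obtain x' where x': "x \<le> x'" "x' < y" "g x' < 0"
  proof (cases "g x = 0")
    case True
    then have "deriv g x < 0" using neg[of x] xy by simp
    from DERIV_neg_dec_right[OF d this] obtain e where e: "e > 0" "\<And>h. h > 0 \<Longrightarrow> h < e \<Longrightarrow> g (x + h) < g x"
      by blast
    define h where "h = min e (y - x) / 2"
    have h: "h > 0" "h < e" "x + h < y" using e(1) xy by (auto simp: h_def min_def field_simps)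
    show ?thesis by (rule that[of "x + h"]) (use e(2)[OF h(1,2)] h True in auto)
  qed (use gx xy that[of x] in auto)
  define Z where "Z = {z \<in> {x'..y}. g z \<ge> 0}"
  have Zne: "y \<in> Z" using x' gy by (auto simp: Z_def)
  have "closed Z"
    unfolding Z_def using continuous_closed_preimage[OF cont[of "{x'..y}"], of "{0..}"]
    by (simp add: vimage_def Int_def)
  then have z: "Inf Z \<in> Z"
    using Zne by (intro closed_contains_Inf) (auto simp: Z_def bdd_below_def)
  let ?z = "Inf Z"
  have zx: "x' < ?z" "?z \<le> y" "g ?z \<ge> 0" using z x'(3) by (auto simp: Z_def order_less_le)
  have below: "g w < 0" if "x' \<le> w" "w < ?z" for w
  proof (rule ccontr)
    assume "\<not> g w < 0"
    then have "w \<in> Z" using that zx by (auto simp: Z_def)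
    then have "?z \<le> w" by (intro cInf_lower) (auto simp: Z_def bdd_below_def)
    then show False using that by simp
  qed
  have "g ?z = 0"
  proof (rule ccontr)
    assume "g ?z \<noteq> 0"
    then have "g x' \<le> 0 \<and> 0 \<le> g ?z \<and> g ?z > 0" using zx x' by auto
    then obtain w where "x' \<le> w" "w \<le> ?z" "g w = 0"
      using IVT'[of g x' 0 ?z] zx cont by auto
    then show False using below[of w] \<open>g ?z \<noteq> 0\<close> by (cases "w = ?z") auto
  qed
  then have "deriv g ?z < 0" using neg[of ?z] zx x' by auto
  from DERIV_neg_dec_left[OF d this] obtain e where e: "e > 0" "\<And>h. h > 0 \<Longrightarrow> h < e \<Longrightarrow> g ?z < g (?z - h)"
    by blast
  define h where "h = min e (?z - x') / 2"
  have h: "h > 0" "h < e" "x' \<le> ?z - h" using e(1) zx by (auto simp: h_def min_def field_simps)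
  show False using e(2)[OF h(1,2)] below[of "?z - h"] h \<open>g ?z = 0\<close> by auto
qed

text \<open>The tangent of \<open>R\<close> at \<open>y\<close> has slope \<open>R' y\<close> and intercept \<open>R y - y R' y\<close>; the first bound
  is what makes \<open>3 F - R(G)\<close> monotone at its zeros, the second one decides its sign at the
  Dirichlet eigenvalues, where \<open>F\<^sup>2 = 1 + G\<^sup>2\<close>.\<close>
definition admissible :: "(real \<Rightarrow> real) \<Rightarrow> bool" where
  "admissible R \<longleftrightarrow> (\<forall>y. R differentiable (at y) \<and> (R y - y * deriv R y)\<^sup>2 + (deriv R y)\<^sup>2 < 9
     \<and> (R y)\<^sup>2 < 9 + 9 * y\<^sup>2)"

text \<open>\<open>T, D, S, W\<close> stand for \<open>\<theta>(1), \<phi>'(1), \<phi>(1), \<theta>'(1)\<close> as functions of the spectral parameter.\<close>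
locale hill =
  fixes T D S W :: "real \<Rightarrow> real" and X0 :: real
  assumes wronskian: "T x * D x - W x * S x = 1"
    and diffT: "T differentiable (at x)" and diffD: "D differentiable (at x)" and diffS: "S differentiable (at x)"
    and trace_deriv: "\<lbrakk>b1 > 0; b2 > 0; (b1 * T x + b2 * D x)\<^sup>2 < 4 * b1 * b2\<rbrakk>
        \<Longrightarrow> (b1 * deriv T x + b2 * deriv D x) * S x < 0"
    and simple: "S x = 0 \<Longrightarrow> deriv S x * T x > 0"
    and neg: "x < X0 \<Longrightarrow> T x > 0 \<and> W x > 0 \<and> S x > 0 \<and> D x > 0"
    and small: "((\<lambda>x. D x - T x) \<longlongrightarrow> 0) at_top"
    and unbounded: "\<exists>x\<ge>b. S x = 0"
    and entire: "real_entire T" "real_entire D" "real_entire S"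
begin

definition F :: "real \<Rightarrow> real" where "F x = (D x + T x) / 2"
definition G :: "real \<Rightarrow> real" where "G x = (D x - T x) / 2"

lemma entire_FG: "real_entire F" "real_entire G"
proof -
  have "F = (\<lambda>x. (1/2) * (D x + T x))" "G = (\<lambda>x. (1/2) * (D x - T x))" by (auto simp: F_def G_def)
  then show "real_entire F" "real_entire G"
    using real_entire_mult[OF real_entire_const real_entire_add[OF entire(2,1)], of "1/2"]
      real_entire_mult[OF real_entire_const real_entire_diff[OF entire(2,1)], of "1/2"] by simp_all
qed

lemma F_sq: "(F x)\<^sup>2 = 1 + (G x)\<^sup>2 + W x * S x"
proof -
  have "(F x)\<^sup>2 = T x * D x + (G x)\<^sup>2" by (simp add: F_def G_def power2_eq_square field_simps)
  then show ?thesis using wronskian[of x] by simp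
qed

lemma diffF: "F differentiable (at x)" and diffG: "G differentiable (at x)"
proof -
  have "F = (\<lambda>x. (D x + T x) / 2)" "G = (\<lambda>x. (D x - T x) / 2)" by (auto simp: F_def G_def)
  then show "F differentiable (at x)" "G differentiable (at x)"
    using diffD[of x] diffT[of x] by (auto intro!: derivative_intros)
qed

lemma F_left: "x < X0 \<Longrightarrow> F x > 0 \<and> (F x)\<^sup>2 > 1 + (G x)\<^sup>2"
  using neg[of x] F_sq[of x] by (auto simp: F_def)

lemma S_fin: "finite {y \<in> {y. S y = 0}. y < b}"
proof -
  have "finite {y. X0 \<le> y \<and> y \<le> b \<and> S y = 0}"
    by (rule real_entire_finite_zeros[OF entire(3), of "X0 - 1"]) (use neg[of "X0 - 1"] in auto)
  then show ?thesis
  proof (rule finite_subset[rotated])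
    have "X0 \<le> y" if "S y = 0" for y using neg[of y] that by (cases "y < X0") auto
    then show "{y \<in> {y. S y = 0}. y < b} \<subseteq> {y. X0 \<le> y \<and> y \<le> b \<and> S y = 0}" by auto
  qed
qed

primrec mu :: "nat \<Rightarrow> real" where
  "mu 0 = (SOME x. S x = 0 \<and> (\<forall>y. S y = 0 \<longrightarrow> x \<le> y))"
| "mu (Suc n) = (SOME x. S x = 0 \<and> mu n < x \<and> (\<forall>y. S y = 0 \<longrightarrow> mu n < y \<longrightarrow> x \<le> y))"

lemma mu_0: "S (mu 0) = 0" "S y = 0 \<Longrightarrow> mu 0 \<le> y"
proof -
  obtain x0 where "S x0 = 0" using unbounded by blast
  then obtain x where "S x = 0" "\<And>y. S y = 0 \<Longrightarrow> x \<le> y"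
    using least_elem_above[OF S_fin, of x0 "\<lambda>_. True"] by auto
  then have "\<exists>x. S x = 0 \<and> (\<forall>y. S y = 0 \<longrightarrow> x \<le> y)" by blast
  from someI_ex[OF this] show "S (mu 0) = 0" "S y = 0 \<Longrightarrow> mu 0 \<le> y" by auto
qed

lemma mu_Suc: "S (mu (Suc n)) = 0" "mu n < mu (Suc n)" "S y = 0 \<Longrightarrow> mu n < y \<Longrightarrow> mu (Suc n) \<le> y"
proof -
  obtain x0 where x0: "x0 \<ge> mu n + 1" "S x0 = 0" using unbounded by blast
  then obtain x where "S x = 0" "mu n < x" "\<And>y. S y = 0 \<Longrightarrow> mu n < y \<Longrightarrow> x \<le> y"
    using least_elem_above[OF S_fin, of x0 "\<lambda>y. mu n < y"] by auto
  then have "\<exists>x. S x = 0 \<and> mu n < x \<and> (\<forall>y. S y = 0 \<longrightarrow> mu n < y \<longrightarrow> x \<le> y)" by blast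
  from someI_ex[OF this]
  show "S (mu (Suc n)) = 0" "mu n < mu (Suc n)" "S y = 0 \<Longrightarrow> mu n < y \<Longrightarrow> mu (Suc n) \<le> y" by auto
qed

lemma S_mu: "S (mu n) = 0"
  using mu_0(1) mu_Suc(1) by (cases n) auto

lemma mu_strict: "strict_mono mu"
  by (rule strict_mono_Suc_iff[THEN iffD2]) (use mu_Suc(2) in blast)

lemma mu_unbounded: "\<exists>n. b < mu n"
proof (rule ccontr)
  assume "\<nexists>n. b < mu n"
  then have "range mu \<subseteq> {y \<in> {y. S y = 0}. y < b + 1}"
    using S_mu by (auto simp: not_less) (smt (verit))
  then have "finite (range mu)" using S_fin finite_subset by blast
  then show False using strict_mono_imp_inj_on[OF mu_strict] finite_imageD by blast
qed

text \<open>\<open>inI n\<close> is the open interval between consecutive Dirichlet eigenvalues \<open>mu (n - 1)\<close> and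
  \<open>mu n\<close>, with left end \<open>- \<infinity>\<close> for \<open>n = 0\<close>.\<close>
definition inI :: "nat \<Rightarrow> real \<Rightarrow> bool" where
  "inI n x \<longleftrightarrow> x < mu n \<and> (\<forall>m. n = Suc m \<longrightarrow> mu m < x)"

lemma inI_S: "inI n x \<Longrightarrow> S x \<noteq> 0"
  using mu_0(2)[of x] mu_Suc(3)[of x] by (cases n) (force simp: inI_def)+

lemma ex_inI: "S x \<noteq> 0 \<Longrightarrow> \<exists>n. inI n x"
proof -
  assume S: "S x \<noteq> 0"
  define n where "n = (LEAST n. x < mu n)"
  have n: "x < mu n" unfolding n_def using LeastI_ex[OF mu_unbounded] .
  have "mu m < x" if "n = Suc m" for m
  proof -
    have "\<not> x < mu m" using not_less_Least[of m "\<lambda>n. x < mu n"] that by (simp add: n_def)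
    moreover have "x \<noteq> mu m" using S S_mu by blast
    ultimately show ?thesis by simp
  qed
  then show ?thesis using n by (auto simp: inI_def)
qed

lemma inI_between: "inI n x \<Longrightarrow> inI n y \<Longrightarrow> x \<le> z \<Longrightarrow> z \<le> y \<Longrightarrow> inI n z"
  by (force simp: inI_def)

lemma inI_less: "inI m x \<Longrightarrow> inI n y \<Longrightarrow> m < n \<Longrightarrow> x < y"
proof -
  assume a: "inI m x" "inI n y" "m < n"
  then obtain k where k: "n = Suc k" "m \<le> k" by (cases n) auto
  have "x < mu m" using a by (simp add: inI_def)
  also have "mu m \<le> mu k" using k strict_mono_mono[OF mu_strict] by (simp add: mono_def)
  also have "\<dots> < y" using a k by (simp add: inI_def)
  finally show ?thesis .
qed

text \<open>The sign of \<open>S\<close> on interval \<open>n\<close> (\<open>S_sign\<close>).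
  \<open>F\<close> has this sign at the left end (\<open>left_end\<close>) and the opposite one at
  \<open>mu n\<close> (\<open>F_mu\<close>).\<close>

abbreviation eps :: "nat \<Rightarrow> real" where "eps n \<equiv> (-1) ^ n"

lemma eps_sq: "eps n * eps n = 1"
  by (simp flip: power_mult_distrib)

lemma eps_cases: "eps n = 1 \<or> eps n = -1"
  by (cases "even n") auto

lemma S_cont: "continuous_on A S"
  by (intro differentiable_imp_continuous_on differentiable_at_imp_differentiable_on diffS)

lemma S_same_sign:
  assumes "inI n x" "inI n y" "c * S x > 0"
  shows "c * S y > 0"
proof (rule ccontr)
  assume n: "\<not> c * S y > 0"
  have c: "continuous_on A (\<lambda>x. c * S x)" for A by (intro continuous_intros S_cont)
  have "\<exists>z. inI n z \<and> c * S z = 0"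
  proof (cases "x \<le> y")
    case True
    then obtain z where "x \<le> z" "z \<le> y" "c * S z = 0"
      using IVT2'[of "\<lambda>x. c * S x" y 0 x] n assms(3) c by auto
    then show ?thesis using inI_between assms by blast
  next
    case False
    then obtain z where "y \<le> z" "z \<le> x" "c * S z = 0"
      using IVT'[of "\<lambda>x. c * S x" y 0 x] n assms(3) c by auto
    then show ?thesis using inI_between assms by blast
  qed
  then show False using inI_S assms(3) by auto
qed

lemma S_deriv: "(S has_real_derivative deriv S x) (at x)"
  using diffS by (simp add: DERIV_deriv_iff_real_differentiable)

lemma deriv_S_mu_sign:
  assumes "\<And>x. inI n x \<Longrightarrow> eps n * S x > 0"
  shows "eps n * deriv S (mu n) < 0"
proof (rule ccontr)
  assume "\<not> eps n * deriv S (mu n) < 0"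
  moreover have "deriv S (mu n) \<noteq> 0" using simple[OF S_mu[of n]] by auto
  ultimately have p: "eps n * deriv S (mu n) > 0" using eps_cases[of n] by auto
  have "((\<lambda>x. eps n * S x) has_real_derivative eps n * deriv S (mu n)) (at (mu n))"
    by (rule derivative_eq_intros S_deriv refl)+ simp
  from DERIV_pos_inc_left[OF this p] obtain d where d: "d > 0"
    "\<And>h. h > 0 \<Longrightarrow> h < d \<Longrightarrow> eps n * S (mu n - h) < eps n * S (mu n)" by blast
  obtain l where l: "l < mu n" "\<And>x. l < x \<Longrightarrow> x < mu n \<Longrightarrow> inI n x"
    using mu_Suc(2) by (cases n) (auto simp: inI_def intro: that[of "mu n - 1"])
  define h where "h = min d (mu n - l) / 2"
  have h: "h > 0" "h < d" "l < mu n - h" using d(1) l(1) by (auto simp: h_def min_def field_simps)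
  show False using d(2)[OF h(1,2)] assms[OF l(2)[of "mu n - h"]] h S_mu[of n] by auto
qed

text \<open>\<open>S\<close> is positive far to the left and changes sign at each Dirichlet
  eigenvalue, because these are simple zeros.\<close>

lemma S_sign: "inI n x \<Longrightarrow> eps n * S x > 0"
proof (induction n arbitrary: x)
  case 0
  define a where "a = min (X0 - 1) (mu 0 - 1)"
  have "inI 0 a" "S a > 0" using neg[of a] by (auto simp: inI_def a_def)
  then show ?case using S_same_sign[of 0 a x 1] 0 by simp
next
  case (Suc n)
  have n: "eps n * deriv S (mu n) < 0" by (rule deriv_S_mu_sign[OF Suc.IH])
  have "((\<lambda>x. eps n * S x) has_real_derivative eps n * deriv S (mu n)) (at (mu n))"
    by (rule derivative_eq_intros S_deriv refl)+ simp
  from DERIV_neg_dec_right[OF this n] obtain d where d: "d > 0"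
    "\<And>h. h > 0 \<Longrightarrow> h < d \<Longrightarrow> eps n * S (mu n + h) < eps n * S (mu n)" by blast
  define h where "h = min d (mu (Suc n) - mu n) / 2"
  have h: "h > 0" "h < d" "mu n + h < mu (Suc n)" using d(1) mu_Suc(2)[of n] by (auto simp: h_def min_def field_simps)
  have "inI (Suc n) (mu n + h)" using h by (auto simp: inI_def simp del: mu.simps)
  moreover have "eps (Suc n) * S (mu n + h) > 0" using d(2)[OF h(1,2)] S_mu[of n] by simp
  ultimately show ?case using S_same_sign Suc.prems by blast
qed

text \<open>At a zero of \<open>S\<close> the Wronskian reduces to \<open>T * D = 1\<close>, so
  \<open>T\<close>, \<open>D\<close> and \<open>F\<close> share one sign, which
  \<open>simple\<close> ties to the alternating slope of \<open>S\<close>.\<close>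

lemma F_mu: "- eps n * F (mu n) > 0" "(F (mu n))\<^sup>2 = 1 + (G (mu n))\<^sup>2"
proof -
  have "eps n * deriv S (mu n) < 0" by (rule deriv_S_mu_sign[OF S_sign])
  moreover have "deriv S (mu n) * T (mu n) > 0" by (rule simple[OF S_mu])
  ultimately have T: "- eps n * T (mu n) > 0"
    using eps_cases[of n] by (auto simp: zero_less_mult_iff mult_less_0_iff)
  have "T (mu n) * D (mu n) = 1" using wronskian[of "mu n"] S_mu by simp
  then have "T (mu n) * D (mu n) > 0" by simp
  then have "- eps n * D (mu n) > 0"
    using T eps_cases[of n] by (auto simp: zero_less_mult_iff mult_less_0_iff)
  then show "- eps n * F (mu n) > 0" using T by (simp add: F_def field_simps)
  show "(F (mu n))\<^sup>2 = 1 + (G (mu n))\<^sup>2" using F_sq[of "mu n"] S_mu by simp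
qed

text \<open>Interval 0 has no Dirichlet eigenvalue to its left; a point below \<open>X0\<close>
  takes its place, so that all intervals can be treated alike.\<close>

lemma left_end:
  obtains a where "a < mu n" "\<And>z. a < z \<Longrightarrow> z < mu n \<Longrightarrow> inI n z" "eps n * F a > 0" "(F a)\<^sup>2 \<ge> 1 + (G a)\<^sup>2"
proof (cases n)
  case 0
  define a where "a = min (X0 - 1) (mu 0 - 1)"
  have a: "a < X0" "a < mu 0" by (auto simp: a_def simp del: mu.simps)
  show ?thesis by (rule that[of a]) (use 0 a(2) F_left[OF a(1)] in \<open>auto simp: inI_def simp del: mu.simps\<close>)
next
  case (Suc m)
  show ?thesis by (rule that[of "mu m"]) (use Suc F_mu[of m] mu_Suc(2)[of m] in \<open>auto simp: inI_def simp del: mu.simps\<close>)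
qed

text \<open>A zero is a point where the spectral curve \<open>(3 * F x, G x)\<close> meets the graph
  of \<open>R\<close> over the \<open>G\<close> axis. The factors of both characteristic functions
  have this form.\<close>

definition gR :: "(real \<Rightarrow> real) \<Rightarrow> real \<Rightarrow> real" where
  "gR R x = 3 * F x - R (G x)"

text \<open>The growth bound lets \<open>3 * F\<close> decide the sign at both ends of the interval.
  \<open>R\<close> is only assumed continuous because the curve used in \<open>Dp_zero\<close> has a
  kink when \<open>c = 0\<close>.\<close>

lemma ex_zero_of_bound:
  assumes cont: "continuous_on UNIV R" and bd: "\<And>y. (R y)\<^sup>2 < 9 + 9 * y\<^sup>2"
  shows "\<exists>x. inI n x \<and> gR R x = 0"
proof -
  have dom: "e * gR R x > 0" if "e = 1 \<or> e = -1" "e * F x > 0" "(F x)\<^sup>2 \<ge> 1 + (G x)\<^sup>2" for e x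
  proof -
    have "(R (G x))\<^sup>2 < (3 * F x)\<^sup>2" using bd[of "G x"] that(3) by (simp add: power_mult_distrib)
    then have "\<bar>R (G x)\<bar> < \<bar>3 * F x\<bar>" by (metis abs_le_square_iff not_le)
    then show ?thesis using that by (auto simp: gR_def)
  qed
  obtain a where a: "a < mu n" "\<And>z. a < z \<Longrightarrow> z < mu n \<Longrightarrow> inI n z" "eps n * F a > 0" "(F a)\<^sup>2 \<ge> 1 + (G a)\<^sup>2"
    by (rule left_end[of n]) blast
  have ga: "eps n * gR R a > 0" by (rule dom) (use eps_cases a in auto)
  have gm: "- eps n * gR R (mu n) > 0" by (rule dom) (use eps_cases[of n] F_mu[of n] in auto)
  have c: "continuous_on A (\<lambda>x. eps n * gR R x)" for A
  proof -
    have "continuous_on A F" "continuous_on A G"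
      by (intro differentiable_imp_continuous_on differentiable_at_imp_differentiable_on diffF diffG)+
    then show ?thesis unfolding gR_def
      by (intro continuous_intros continuous_on_compose2[OF cont]) auto
  qed
  obtain x where x: "a \<le> x" "x \<le> mu n" "eps n * gR R x = 0"
    using IVT2'[of "\<lambda>x. eps n * gR R x" "mu n" 0 a] ga gm a(1) c by auto
  have "x \<noteq> a" "x \<noteq> mu n" using x ga gm by auto
  then show ?thesis using x a(2)[of x] eps_sq[of n] by auto
qed

lemma gR_differentiable:
  assumes "admissible R"
  shows "gR R differentiable (at x)"
proof -
  have "(\<lambda>x. R (G x)) differentiable (at x)"
    using differentiable_chain_at[OF diffG, of R x] assms by (simp add: admissible_def o_def)
  then show ?thesis unfolding gR_def[abs_def] using diffF by (intro derivative_intros) auto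
qed

text \<open>With \<open>r\<close> the slope of the tangent to \<open>R\<close> at
  \<open>G x\<close>, the derivative is that of the weighted trace with weights
  \<open>(3 + r) / 2\<close> and \<open>(3 - r) / 2\<close>. At a zero this trace equals the
  intercept of the tangent, and four times the product of the weights is
  \<open>9 - r\<^sup>2\<close>; \<open>admissible\<close> thus supplies exactly the bound in
  \<open>trace_deriv\<close>.\<close>

lemma gR_deriv:
  assumes R: "admissible R" and x: "gR R x = 0" "inI n x"
  shows "eps n * deriv (gR R) x < 0"
proof -
  define r where "r = deriv R (G x)"
  have dR: "(R has_real_derivative r) (at (G x))"
    using R by (simp add: admissible_def r_def DERIV_deriv_iff_real_differentiable)
  have dT: "(T has_real_derivative deriv T x) (at x)" and dD: "(D has_real_derivative deriv D x) (at x)"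
    using diffT diffD by (simp_all add: DERIV_deriv_iff_real_differentiable)
  have dG: "(G has_real_derivative (deriv D x - deriv T x) / 2) (at x)"
    unfolding G_def[abs_def] by (rule derivative_eq_intros dT dD refl | simp)+
  have dF: "(F has_real_derivative (deriv D x + deriv T x) / 2) (at x)"
    unfolding F_def[abs_def] by (rule derivative_eq_intros dT dD refl | simp)+
  have "(gR R has_real_derivative 3 * ((deriv D x + deriv T x) / 2) - r * ((deriv D x - deriv T x) / 2)) (at x)"
    unfolding gR_def[abs_def] by (rule derivative_eq_intros dF DERIV_chain2[OF dR dG] refl)+ simp
  then have dg: "deriv (gR R) x = (3 + r) / 2 * deriv T x + (3 - r) / 2 * deriv D x"
    by (simp add: DERIV_imp_deriv field_simps)
  have b: "(R (G x) - G x * r)\<^sup>2 + r\<^sup>2 < 9" using R by (simp add: admissible_def r_def)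
  moreover have "0 \<le> (R (G x) - G x * r)\<^sup>2" by simp
  ultimately have "r\<^sup>2 < 9" by linarith
  then have "r\<^sup>2 < 3\<^sup>2" by simp
  then have "\<bar>r\<bar> < 3" using abs_le_square_iff[of 3 r] by (simp add: not_le[symmetric])
  then have r: "(3 + r) / 2 > 0" "(3 - r) / 2 > 0" by auto
  have "(3 + r) / 2 * T x + (3 - r) / 2 * D x = 3 * F x - r * G x" by (simp add: F_def G_def field_simps)
  also have "\<dots> = R (G x) - G x * r" using x(1) by (simp add: gR_def)
  finally have e: "(3 + r) / 2 * T x + (3 - r) / 2 * D x = R (G x) - G x * r" .
  have "4 * ((3 + r) / 2) * ((3 - r) / 2) = 9 - r\<^sup>2" by (simp add: power2_eq_square field_simps)
  then have "((3 + r) / 2 * T x + (3 - r) / 2 * D x)\<^sup>2 < 4 * ((3 + r) / 2) * ((3 - r) / 2)"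
    unfolding e using b by linarith
  from trace_deriv[OF r this] have "deriv (gR R) x * S x < 0" unfolding dg .
  then show ?thesis using S_sign[OF x(2)] eps_cases[of n] by (auto simp: zero_less_mult_iff mult_less_0_iff)
qed

lemma gR_crossing:
  assumes R: "admissible R" and x: "inI n x" "inI n y" "x < y" and g: "eps n * gR R x \<le> 0"
  shows "eps n * gR R y < 0"
proof (rule crossing_down[where g = "\<lambda>x. eps n * gR R x"])
  show "(\<lambda>x. eps n * gR R x) differentiable at z" for z
    by (intro derivative_intros gR_differentiable R)
  fix z assume z: "x \<le> z" "z \<le> y" "eps n * gR R z = 0"
  then have "gR R z = 0" by simp
  from gR_deriv[OF R this inI_between[OF x(1,2) z(1,2)]]
  have "eps n * deriv (gR R) z < 0" .
  moreover have "((\<lambda>x. eps n * gR R x) has_real_derivative eps n * deriv (gR R) z) (at z)"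
    using gR_differentiable[OF R, of z]
    by (auto intro!: derivative_eq_intros simp: DERIV_deriv_iff_real_differentiable)
  ultimately show "deriv (\<lambda>x. eps n * gR R x) z < 0" by (simp add: DERIV_imp_deriv)
qed (use x g in auto)

definition zt :: "(real \<Rightarrow> real) \<Rightarrow> nat \<Rightarrow> real" where
  "zt R n = (SOME x. inI n x \<and> gR R x = 0)"

lemma zt:
  assumes R: "admissible R"
  shows "inI n (zt R n)" "gR R (zt R n) = 0"
proof -
  have "continuous_on UNIV R"
    using R by (intro differentiable_imp_continuous_on differentiable_at_imp_differentiable_on) (simp add: admissible_def)
  then have "\<exists>x. inI n x \<and> gR R x = 0" using ex_zero_of_bound R by (simp add: admissible_def)
  from someI_ex[OF this] show "inI n (zt R n)" "gR R (zt R n) = 0" by (auto simp: zt_def)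
qed

text \<open>Turns the order of zeros into inequalities: two zeros are compared by evaluating one
  factor at the zero of the other.\<close>

lemma zt_sign:
  assumes R: "admissible R" and x: "inI n x"
  shows "x < zt R n \<longleftrightarrow> eps n * gR R x > 0" "zt R n < x \<longleftrightarrow> eps n * gR R x < 0"
    "zt R n = x \<longleftrightarrow> gR R x = 0"
proof -
  have 1: "eps n * gR R x < 0" if "zt R n < x"
    using gR_crossing[OF R zt(1)[OF R] x that] zt(2)[OF R] by simp
  have 2: "eps n * gR R x > 0" if "x < zt R n"
    using gR_crossing[OF R x zt(1)[OF R] that] zt(2)[OF R] by force
  have 3: "eps n * gR R x = 0" if "x = zt R n"
    using zt(2)[OF R] that by simp
  have e: "eps n * gR R x = 0 \<longleftrightarrow> gR R x = 0" by simp
  show "x < zt R n \<longleftrightarrow> eps n * gR R x > 0" using 1 2 3 by (metis less_asym linorder_cases less_irrefl)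
  show "zt R n < x \<longleftrightarrow> eps n * gR R x < 0" using 1 2 3 by (metis less_asym linorder_cases less_irrefl)
  show "zt R n = x \<longleftrightarrow> gR R x = 0" using 1 2 3 e by (metis linorder_cases less_irrefl)
qed

lemma gR_zero_inI:
  assumes R: "admissible R" and x: "gR R x = 0"
  shows "\<exists>n. inI n x"
proof (rule ex_inI, rule notI)
  assume "S x = 0"
  then have "(F x)\<^sup>2 = 1 + (G x)\<^sup>2" using F_sq[of x] by simp
  moreover have "(3 * F x)\<^sup>2 = (R (G x))\<^sup>2" using x by (simp add: gR_def)
  moreover have "(R (G x))\<^sup>2 < 9 + 9 * (G x)\<^sup>2" using R by (simp add: admissible_def)
  ultimately show False by (simp add: power_mult_distrib)
qed

lemma card_zeros_below:
  assumes R: "admissible R" and x: "inI n x"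
  shows "card {y. y < x \<and> gR R y = 0} = n + (if zt R n < x then 1 else 0)"
proof -
  have mono: "zt R m < zt R k" if "m < k" for m k by (rule inI_less[OF zt(1)[OF R] zt(1)[OF R] that])
  have inj: "inj_on (zt R) A" for A
    by (rule linorder_inj_onI) (use mono in \<open>force+\<close>)
  have iff: "zt R m < x \<longleftrightarrow> m < n \<or> (m = n \<and> zt R n < x)" for m
  proof (cases m n rule: linorder_cases)
    case less
    then show ?thesis using inI_less[OF zt(1)[OF R] x] by auto
  next
    case greater
    then show ?thesis using inI_less[OF x zt(1)[OF R], of m] by auto
  qed auto
  have "{y. y < x \<and> gR R y = 0} = zt R ` {m. zt R m < x}"
  proof (intro set_eqI iffI)
    fix y assume y: "y \<in> {y. y < x \<and> gR R y = 0}"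
    then obtain m where "inI m y" using gR_zero_inI[OF R] by blast
    then have "zt R m = y" using zt_sign(3)[OF R] y by auto
    then show "y \<in> zt R ` {m. zt R m < x}" using y by auto
  qed (use zt(2)[OF R] in auto)
  then have "card {y. y < x \<and> gR R y = 0} = card {m. zt R m < x}" using card_image[OF inj] by simp
  also have "{m. zt R m < x} = {m. m < n \<or> (m = n \<and> zt R n < x)}"
    by (rule Collect_cong) (rule iff)
  also have "\<dots> = (if zt R n < x then {..n} else {..<n})" by auto
  finally show ?thesis by simp
qed

lemma gR_nonzero_left:
  assumes R: "\<And>i. i \<in> A \<Longrightarrow> admissible (R i)" and "x < X0" and i: "i \<in> A"
  shows "gR (R i) x \<noteq> 0"
proof
  assume "gR (R i) x = 0"
  then have "(3 * F x)\<^sup>2 = (R i (G x))\<^sup>2" by (simp add: gR_def)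
  then have "9 * (F x)\<^sup>2 = (R i (G x))\<^sup>2" by (simp add: power_mult_distrib)
  moreover have "(R i (G x))\<^sup>2 < 9 + 9 * (G x)\<^sup>2" using R[OF i] by (simp add: admissible_def)
  ultimately show False using F_left[OF assms(2)] by linarith
qed

text \<open>Each factor has one simple zero in each of the \<open>n\<close> earlier intervals, which
  uses up \<open>card A * n\<close> positions; \<open>r\<close> counts from 0 within the group.
  Coinciding zeros occupy consecutive positions through their multiplicity.\<close>

lemma zseq_product:
  assumes A: "finite A" and R: "\<And>i. i \<in> A \<Longrightarrow> admissible (R i)" and \<kappa>: "\<kappa> \<noteq> 0"
    and P: "P = (\<lambda>x. \<kappa> * (\<Prod>i\<in>A. gR (R i) x))" "real_entire P"
    and x: "inI n x" and r: "card {i\<in>A. zt (R i) n < x} \<le> r" "r < card {i\<in>A. zt (R i) n \<le> x}"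
  shows "zseq P (card A * n + r) = x"
proof -
  have low: "P y \<noteq> 0" if "y < X0" for y
    unfolding P(1) using gR_nonzero_left[of A R y, OF R that] A \<kappa> by auto
  have fin: "finite {y. y < b \<and> P y = 0}" for b
  proof (rule finite_subset)
    show "finite {y. X0 \<le> y \<and> y \<le> b \<and> P y = 0}"
      by (rule real_entire_finite_zeros[OF P(2) low[of "X0 - 1"]]) simp
    show "{y. y < b \<and> P y = 0} \<subseteq> {y. X0 \<le> y \<and> y \<le> b \<and> P y = 0}" using low by (auto simp: not_le[symmetric])
  qed
  have P0: "P y = 0 \<longleftrightarrow> (\<exists>i\<in>A. gR (R i) y = 0)" for y using A \<kappa> by (auto simp: P(1))
  have zm: "zmult P y = card {i\<in>A. gR (R i) y = 0}" for y
    unfolding P(1)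
  proof (rule zmult_prod[where ?x0.0 = "X0 - 1"])
    show "real_entire (\<lambda>x. \<kappa> * (\<Prod>i\<in>A. gR (R i) x))" using P by simp
    fix i assume i: "i \<in> A"
    show "gR (R i) (X0 - 1) \<noteq> 0" using gR_nonzero_left[of A R "X0 - 1" i, OF R _ i] by simp
    show "gR (R i) differentiable (at y)" by (rule gR_differentiable[OF R[OF i]])
    assume z: "gR (R i) y = 0"
    then obtain m where "inI m y" using gR_zero_inI[OF R[OF i]] by blast
    from gR_deriv[OF R[OF i] z this] show "deriv (gR (R i)) y \<noteq> 0" by auto
  qed (use A \<kappa> in auto)
  have "zcount_below P x = (\<Sum>y\<in>{y. y < x \<and> P y = 0}. \<Sum>i\<in>A. if gR (R i) y = 0 then 1 else 0)"
    unfolding zcount_below_def zm using A by (simp add: sum.If_cases Int_def)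
  also have "\<dots> = (\<Sum>i\<in>A. \<Sum>y\<in>{y. y < x \<and> P y = 0}. if gR (R i) y = 0 then 1 else 0)"
    by (rule sum.swap)
  also have "\<dots> = (\<Sum>i\<in>A. n + (if zt (R i) n < x then 1 else 0))"
  proof (rule sum.cong[OF refl])
    fix i assume i: "i \<in> A"
    have "{y. y < x \<and> P y = 0} \<inter> {y. gR (R i) y = 0} = {y. y < x \<and> gR (R i) y = 0}" using i P0 by auto
    then show "(\<Sum>y\<in>{y. y < x \<and> P y = 0}. if gR (R i) y = 0 then 1 else 0) = n + (if zt (R i) n < x then 1 else 0)"
      using card_zeros_below[OF R[OF i] x] fin by (simp add: sum.If_cases)
  qed
  also have "\<dots> = card A * n + card {i\<in>A. zt (R i) n < x}"
    using A by (simp add: sum.distrib sum.If_cases Int_def)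
  finally have zc: "zcount_below P x = card A * n + card {i\<in>A. zt (R i) n < x}" .
  have "{i\<in>A. gR (R i) x = 0} = {i\<in>A. zt (R i) n = x}"
    using zt_sign(3)[OF R x] by auto
  moreover have "card {i\<in>A. zt (R i) n \<le> x} = card {i\<in>A. zt (R i) n < x} + card {i\<in>A. zt (R i) n = x}"
    using A by (subst card_Un_disjoint[symmetric]) (auto intro!: arg_cong[of _ _ card])
  ultimately have zm': "zcount_below P x + zmult P x = card A * n + card {i\<in>A. zt (R i) n \<le> x}"
    by (simp add: zm zc)
  have "card {i\<in>A. zt (R i) n = x} > 0" using r \<open>card {i\<in>A. zt (R i) n \<le> x} = _\<close> by linarith
  then have "{i\<in>A. gR (R i) x = 0} \<noteq> {}"
    using \<open>{i\<in>A. gR (R i) x = 0} = _\<close> by (metis card.empty less_irrefl)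
  then have Px: "P x = 0" unfolding P0 by blast
  show ?thesis
  proof (rule zseq_eqI[OF fin Px])
    show "zcount_below P x \<le> card A * n + r" using zc r(1) by linarith
    show "card A * n + r < zcount_below P x + zmult P x" using zm' r(2) by linarith
  qed
qed

lemma G_small:
  assumes "e > 0"
  obtains n0 where "\<And>n x. n \<ge> n0 \<Longrightarrow> inI n x \<Longrightarrow> \<bar>G x\<bar> < e"
proof -
  have "\<forall>\<^sub>F x in at_top. dist (D x - T x) 0 < e" using small assms by (rule tendstoD)
  then obtain b where b: "\<And>x. x \<ge> b \<Longrightarrow> \<bar>D x - T x\<bar> < e" by (auto simp: eventually_at_top_linorder)
  obtain m where m: "b < mu m" using mu_unbounded by blast
  show ?thesis
  proof (rule that[of "Suc m"])
    fix n x assume "Suc m \<le> n" "inI n x"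
    then obtain k where k: "n = Suc k" "m \<le> k" "mu k < x" by (cases n) (auto simp: inI_def)
    then have "mu m \<le> mu k" using strict_mono_mono[OF mu_strict] by (simp add: mono_def)
    then have "\<bar>D x - T x\<bar> < e" using b[of x] m k by simp
    moreover have "\<bar>G x\<bar> \<le> \<bar>D x - T x\<bar>" by (simp add: G_def)
    ultimately show "\<bar>G x\<bar> < e" by linarith
  qed
qed

lemma zseq_is_zero:
  assumes P: "real_entire P" and low: "\<And>y. y < X0 \<Longrightarrow> P y \<noteq> 0" and ex: "\<And>n. \<exists>x. inI n x \<and> P x = 0"
  shows "P (zseq P j) = 0"
proof (rule zseq_zero)
  show "finite {y. y < b \<and> P y = 0}" for b
  proof (rule finite_subset)
    show "finite {y. X0 \<le> y \<and> y \<le> b \<and> P y = 0}"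
      by (rule real_entire_finite_zeros[OF P low[of "X0 - 1"]]) simp
    show "{y. y < b \<and> P y = 0} \<subseteq> {y. X0 \<le> y \<and> y \<le> b \<and> P y = 0}" using low by (auto simp: not_le[symmetric])
  qed
  show "\<exists>y>b. P y = 0" for b
  proof -
    obtain n where n: "b < mu n" using mu_unbounded by blast
    obtain x where x: "inI (Suc n) x" "P x = 0" using ex by blast
    then have "mu n < x" by (simp add: inI_def)
    then show ?thesis using n x by (intro exI[of _ x]) auto
  qed
  show "zmult P x \<ge> 1" if "P x = 0" for x
    by (rule zmult_pos[OF P low[of "X0 - 1"] that]) simp
qed

end

section \<open>Labels and resonances\<close>

lemma card_Collect_less_4:
  "card {i\<in>{..<4::nat}. P i} = of_bool (P 0) + of_bool (P 1) + of_bool (P 2) + of_bool (P 3)"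
proof -
  have "card {i\<in>{..<4::nat}. P i} = (\<Sum>i<4. of_bool (P i))" by (simp add: Int_def)
  also have "\<dots> = of_bool (P 0) + of_bool (P 1) + of_bool (P 2) + of_bool (P 3)"
    by (simp add: numeral_eq_Suc)
  finally show ?thesis .
qed

lemma prod_less_4: "(\<Prod>i\<in>{..<4::nat}. f i) = f 0 * f 1 * f 2 * (f 3 :: real)"
  by (simp add: numeral_eq_Suc)

text \<open>For \<open>s\<close> and \<open>t\<close> equal to 1 or -1 these are the lines that
  carry the sides of the diamond; \<open>s = t = 0\<close> gives the zeros of
  \<open>F\<close>.\<close>

definition lin :: "real \<Rightarrow> real \<Rightarrow> real \<Rightarrow> real" where
  "lin s t = (\<lambda>y. s + t * y)"

lemma admissible_lin:
  assumes "\<bar>s\<bar> \<le> 1" "\<bar>t\<bar> \<le> 1"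
  shows "admissible (lin s t)"
  unfolding admissible_def
proof (intro allI conjI)
  fix y :: real
  have d: "(lin s t has_real_derivative t) (at y)"
    unfolding lin_def by (auto intro!: derivative_eq_intros)
  then show "lin s t differentiable at y" by (auto simp: real_differentiable_def)
  have s2: "s\<^sup>2 \<le> 1" "t\<^sup>2 \<le> 1" using assms by (simp_all add: abs_square_le_1)
  then show "(lin s t y - y * deriv (lin s t) y)\<^sup>2 + (deriv (lin s t) y)\<^sup>2 < 9"
    using d by (simp add: DERIV_imp_deriv lin_def)
  have "(s + t * y)\<^sup>2 \<le> 2 * s\<^sup>2 + 2 * (t * y)\<^sup>2"
    using sum_squares_bound[of s "t * y"] by (simp add: power2_sum)
  also have "(t * y)\<^sup>2 \<le> 1 * y\<^sup>2" unfolding power_mult_distrib using s2 by (intro mult_right_mono) auto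
  finally have "(s + t * y)\<^sup>2 \<le> 2 * s\<^sup>2 + 2 * (1 * y\<^sup>2)" by simp
  then show "(lin s t y)\<^sup>2 < 9 + 9 * y\<^sup>2" unfolding lin_def using s2 zero_le_power2[of y] by linarith
qed

text \<open>For \<open>w = sqrt (h y)\<close> the tangent has slope \<open>k y / w\<close> and
  intercept \<open>(h y - y * k y) / w\<close>, up to the sign \<open>e\<close>. Multiplying the
  tangent bound by \<open>h y\<close> removes the root.\<close>

lemma admissible_sqrt:
  assumes e: "e = 1 \<or> e = -1" and h: "\<And>y. h y > 0" "\<And>y. (h has_real_derivative 2 * k y) (at y)"
    and tan: "\<And>y. (h y - y * k y)\<^sup>2 + (k y)\<^sup>2 < 9 * h y" and up: "\<And>y. h y < 9 + 9 * y\<^sup>2"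
  shows "admissible (\<lambda>y. e * sqrt (h y))"
  unfolding admissible_def
proof (intro allI conjI)
  fix y :: real
  define w where "w = sqrt (h y)"
  have w: "w > 0" "h y = w\<^sup>2" using h(1)[of y] by (simp_all add: w_def)
  have d: "((\<lambda>y. e * sqrt (h y)) has_real_derivative e * (k y / sqrt (h y))) (at y)"
  proof -
    have "((\<lambda>y. sqrt (h y)) has_real_derivative inverse (sqrt (h y)) / 2 * (2 * k y)) (at y)"
      by (rule DERIV_chain2[where f = sqrt and g = h, OF DERIV_real_sqrt[OF h(1)[of y]] h(2)[of y]])
    moreover have "inverse (sqrt (h y)) / 2 * (2 * k y) = k y / sqrt (h y)"
      using w(1) unfolding w_def[symmetric] by (simp add: field_simps)
    ultimately have "((\<lambda>y. sqrt (h y)) has_real_derivative k y / sqrt (h y)) (at y)" by metis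
    then show ?thesis by (rule DERIV_cmult)
  qed
  then show "(\<lambda>y. e * sqrt (h y)) differentiable at y" unfolding real_differentiable_def by blast
  have dd: "deriv (\<lambda>y. e * sqrt (h y)) y = e * (k y / sqrt (h y))" using d by (rule DERIV_imp_deriv)
  have eq: "e * w - y * (e * (k y / w)) = e * ((w\<^sup>2 - y * k y) / w)"
    using w(1) by (simp add: diff_divide_distrib power2_eq_square algebra_simps)
  have esq: "(e * r)\<^sup>2 = r\<^sup>2" for r using e by auto
  have "(e * sqrt (h y) - y * deriv (\<lambda>y. e * sqrt (h y)) y)\<^sup>2 + (deriv (\<lambda>y. e * sqrt (h y)) y)\<^sup>2
      = ((h y - y * k y) / w)\<^sup>2 + (k y / w)\<^sup>2"
    unfolding dd w_def[symmetric] eq esq by (simp only: w(2))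
  also have "\<dots> = ((h y - y * k y)\<^sup>2 + (k y)\<^sup>2) / h y"
    by (simp add: power_divide add_divide_distrib w(2))
  also have "\<dots> < 9" using tan[of y] h(1)[of y] by (simp add: divide_less_eq mult.commute)
  finally show "(e * sqrt (h y) - y * deriv (\<lambda>y. e * sqrt (h y)) y)\<^sup>2 + (deriv (\<lambda>y. e * sqrt (h y)) y)\<^sup>2 < 9" .
  show "(e * sqrt (h y))\<^sup>2 < 9 + 9 * y\<^sup>2"
    using up[of y] h(1)[of y] e by auto
qed

text \<open>The tangent bound for \<open>Rp\<close>, multiplied by \<open>t\<^sup>2\<close>, with
  \<open>t = \<sigma> * rfun c y\<close> and \<open>m = 4 * c\<^sup>2\<close>. It is sharp: for
  \<open>m = 4\<close> the quartic vanishes at \<open>t = 2\<close>, that is at \<open>y = 0\<close>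
  when \<open>c\<^sup>2 = 1\<close>.\<close>

lemma tangent_quartic_pos:
  fixes t m :: real
  assumes m: "0 < m" "m < 4" "m \<le> t\<^sup>2"
  shows "7 * t^4 + 6 * t^3 + (19 - 10 * m) * t\<^sup>2 - 8 * m * t + m - m\<^sup>2 > 0"
proof -
  have q: "7 * t\<^sup>2 + 6 * t + 19 > 0"
  proof -
    have "7 * t\<^sup>2 + 6 * t + 19 = 4 * t\<^sup>2 + 3 * (t + 1)\<^sup>2 + 16" by (simp add: power2_eq_square algebra_simps)
    then show ?thesis using zero_le_power2[of t] zero_le_power2[of "t + 1"] by linarith
  qed
  show ?thesis
  proof (cases "t\<^sup>2 \<le> 4")
    case True
    then have "t\<^sup>2 \<le> 2\<^sup>2" by simp
    then have t2: "\<bar>t\<bar> \<le> 2" using abs_le_square_iff[of t 2] by simp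
    have f: "10 - t - 2 * t\<^sup>2 = (2 - t) * (2 * t + 5)" by (simp add: power2_eq_square algebra_simps)
    have f0: "10 - t - 2 * t\<^sup>2 \<ge> 0" unfolding f using t2 by (intro mult_nonneg_nonneg) auto
    \<comment> \<open>Regrouped around \<open>m = t\<^sup>2\<close>, which corresponds to
      \<open>y = 0\<close>.\<close>
    have eq: "7 * t^4 + 6 * t^3 + (19 - 10 * m) * t\<^sup>2 - 8 * m * t + m - m\<^sup>2
        = (t\<^sup>2 - m) * (7 * t\<^sup>2 + 6 * t + 19) + 2 * m * (10 - t - 2 * t\<^sup>2) + m * (t\<^sup>2 - m)"
      by algebra
    show ?thesis
    proof (cases "t\<^sup>2 = m")
      case True
      then have "t \<noteq> 2" using m(2) by auto
      then have "10 - t - 2 * t\<^sup>2 > 0" unfolding f using t2 by (intro mult_pos_pos) auto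
      then show ?thesis unfolding eq using True m(1) by simp
    next
      case False
      then have "t\<^sup>2 - m > 0" using m(3) by simp
      then have "(t\<^sup>2 - m) * (7 * t\<^sup>2 + 6 * t + 19) > 0" "m * (t\<^sup>2 - m) > 0"
        using q m(1) by (intro mult_pos_pos; simp)+
      moreover have "2 * m * (10 - t - 2 * t\<^sup>2) \<ge> 0" using f0 m(1) by (intro mult_nonneg_nonneg) auto
      ultimately show ?thesis unfolding eq by linarith
    qed
  next
    case False
    then have "\<not> \<bar>t\<bar> \<le> 2" using abs_le_square_iff[of t 2] by simp
    then have tt: "t > 2 \<or> t < -2" by auto
    have p4: "(t - 2) * (7 * t^3 + 20 * t\<^sup>2 + 19 * t + 6) \<ge> 0"
      using tt
    proof
      assume "t > 2"
      then show ?thesis by (intro mult_nonneg_nonneg add_nonneg_nonneg) auto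
    next
      assume t: "t < -2"
      have e: "7 * t^3 + 20 * t\<^sup>2 + 19 * t + 6 = - ((- t - 2) * (7 * t\<^sup>2 + 6 * t + 7) + 8)"
        by (simp add: power2_eq_square power3_eq_cube algebra_simps)
      have "7 * t\<^sup>2 + 6 * t + 7 = 4 * t\<^sup>2 + 3 * (t + 1)\<^sup>2 + 4" by (simp add: power2_eq_square algebra_simps)
      moreover have "4 * t\<^sup>2 + 3 * (t + 1)\<^sup>2 + 4 \<ge> 0" by (intro add_nonneg_nonneg) auto
      ultimately have "7 * t\<^sup>2 + 6 * t + 7 \<ge> 0" by linarith
      then have "(- t - 2) * (7 * t\<^sup>2 + 6 * t + 7) \<ge> 0" using t by (intro mult_nonneg_nonneg) linarith+
      then have "7 * t^3 + 20 * t\<^sup>2 + 19 * t + 6 \<le> 0" unfolding e by linarith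
      then show ?thesis using t by (intro mult_nonpos_nonpos) auto
    qed
    \<comment> \<open>The quartic is a concave quadratic in \<open>m\<close>: its linear
      interpolation between \<open>m = 0\<close> and \<open>m = 4\<close> plus the remainder
      \<open>m * (4 - m)\<close>.\<close>
    have e: "4 * (7 * t^4 + 6 * t^3 + (19 - 10 * m) * t\<^sup>2 - 8 * m * t + m - m\<^sup>2)
       = (4 - m) * (t\<^sup>2 * (7 * t\<^sup>2 + 6 * t + 19)) + m * ((t - 2) * (7 * t^3 + 20 * t\<^sup>2 + 19 * t + 6)) + 4 * (m * (4 - m))"
      by algebra
    have 1: "(4 - m) * (t\<^sup>2 * (7 * t\<^sup>2 + 6 * t + 19)) > 0"
      using q m(2) tt by (intro mult_pos_pos[of "4 - m"] mult_pos_pos[of "t\<^sup>2"]) auto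
    have 2: "m * ((t - 2) * (7 * t^3 + 20 * t\<^sup>2 + 19 * t + 6)) \<ge> 0"
      using p4 m(1) by (intro mult_nonneg_nonneg[of m]) auto
    have 3: "4 * (m * (4 - m)) > 0" using m by simp
    have "4 * (7 * t^4 + 6 * t^3 + (19 - 10 * m) * t\<^sup>2 - 8 * m * t + m - m\<^sup>2) > 0"
      unfolding e by (intro add_pos_pos add_pos_nonneg 1 2 3)
    then show ?thesis by simp
  qed
qed

text \<open>For \<open>c = 0\<close> the square root \<open>\<bar>y\<bar>\<close> is replaced by \<open>y\<close>, which keeps the factors of \<open>D_k^+\<close> smooth.\<close>
definition rfun :: "real \<Rightarrow> real \<Rightarrow> real" where
  "rfun c y = (if c = 0 then y else sqrt (y\<^sup>2 + 4 * c\<^sup>2))"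

definition Rp :: "real \<Rightarrow> real \<Rightarrow> real \<Rightarrow> real \<Rightarrow> real" where
  "Rp c e \<sigma> = (\<lambda>y. e * sqrt (5 + y\<^sup>2 + 2 * \<sigma> * rfun c y))"

lemma rfun_sq: "(rfun c y)\<^sup>2 = y\<^sup>2 + 4 * c\<^sup>2"
  by (simp add: rfun_def)

lemma rfun_bound: "\<bar>rfun c y\<bar> \<le> \<bar>y\<bar> + 2 * \<bar>c\<bar>"
proof -
  have "(rfun c y)\<^sup>2 \<le> (\<bar>y\<bar> + 2 * \<bar>c\<bar>)\<^sup>2"
    unfolding rfun_sq by (simp add: power2_sum power_mult_distrib)
  then show ?thesis using abs_le_square_iff[of "rfun c y" "\<bar>y\<bar> + 2 * \<bar>c\<bar>"] by simp
qed

lemma Rp_radicand: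
  assumes "\<sigma> = 1 \<or> \<sigma> = -1"
  shows "5 + y\<^sup>2 + 2 * \<sigma> * rfun c y = 4 * (1 - c\<^sup>2) + (1 + \<sigma> * rfun c y)\<^sup>2"
proof -
  have "\<sigma> * \<sigma> = 1" using assms by auto
  then have "(1 + \<sigma> * rfun c y)\<^sup>2 = 1 + 2 * \<sigma> * rfun c y + (rfun c y)\<^sup>2"
    by (simp add: power2_sum power_mult_distrib power2_eq_square[of \<sigma>])
  then show ?thesis by (simp add: rfun_sq)
qed

lemma Rp_radicand_less:
  assumes "\<sigma> = 1 \<or> \<sigma> = -1" and c: "c\<^sup>2 < 1"
  shows "5 + y\<^sup>2 + 2 * \<sigma> * rfun c y < 9 + 9 * y\<^sup>2"
proof -
  have "(rfun c y)\<^sup>2 < (2 + 4 * y\<^sup>2)\<^sup>2"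
  proof -
    have "(2 + 4 * y\<^sup>2)\<^sup>2 = 4 + 16 * y\<^sup>2 + 16 * (y\<^sup>2)\<^sup>2" by (simp add: power2_sum power_mult_distrib)
    then show ?thesis unfolding rfun_sq using c zero_le_power2[of y] zero_le_power2[of "y\<^sup>2"] by linarith
  qed
  then have "\<bar>rfun c y\<bar> < \<bar>2 + 4 * y\<^sup>2\<bar>" using abs_le_square_iff[of "2 + 4 * y\<^sup>2" "rfun c y"] by (simp add: not_le[symmetric])
  then have "\<bar>rfun c y\<bar> < 2 + 4 * y\<^sup>2" using zero_le_power2[of y] by simp
  moreover have "\<sigma> * rfun c y \<le> \<bar>rfun c y\<bar>" using assms(1) by auto
  ultimately show ?thesis by simp
qed

lemma admissible_Rp:
  assumes e: "e = 1 \<or> e = -1" and s: "\<sigma> = 1 \<or> \<sigma> = -1" and c: "c\<^sup>2 < 1"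
  shows "admissible (Rp c e \<sigma>)"
proof -
  have ss: "\<sigma> * \<sigma> = 1" using s by auto
  define k where "k y = (if c = 0 then y + \<sigma> else y + \<sigma> * y / rfun c y)" for y
  show ?thesis unfolding Rp_def
  proof (rule admissible_sqrt[OF e, where k = k])
    fix y :: real
    show "5 + y\<^sup>2 + 2 * \<sigma> * rfun c y > 0"
      unfolding Rp_radicand[OF s] using c by (intro add_pos_nonneg) auto
    show "5 + y\<^sup>2 + 2 * \<sigma> * rfun c y < 9 + 9 * y\<^sup>2"
      by (rule Rp_radicand_less[OF s c])
    show "((\<lambda>y. 5 + y\<^sup>2 + 2 * \<sigma> * rfun c y) has_real_derivative 2 * k y) (at y)"
    proof (cases "c = 0")
      case True
      then show ?thesis unfolding rfun_def k_def by (auto intro!: derivative_eq_intros)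
    next
      case False
      then have "y\<^sup>2 + 4 * c\<^sup>2 > 0" by (intro add_nonneg_pos) auto
      then show ?thesis using False unfolding rfun_def k_def
        by (auto intro!: derivative_eq_intros simp: field_simps)
    qed
    show "(5 + y\<^sup>2 + 2 * \<sigma> * rfun c y - y * k y)\<^sup>2 + (k y)\<^sup>2 < 9 * (5 + y\<^sup>2 + 2 * \<sigma> * rfun c y)"
    proof (cases "c = 0")
      case True
      have "9 * (5 + y\<^sup>2 + 2 * \<sigma> * y) - ((5 + y\<^sup>2 + 2 * \<sigma> * y - y * (y + \<sigma>))\<^sup>2 + (y + \<sigma>)\<^sup>2)
          = 45 + 8 * y\<^sup>2 + 16 * \<sigma> * y - \<sigma> * \<sigma> - (5 + \<sigma> * y)\<^sup>2"
        by (simp add: power2_eq_square algebra_simps)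
      also have "\<dots> = 44 + 8 * y\<^sup>2 + 16 * \<sigma> * y - (5 + \<sigma> * y)\<^sup>2" using ss by simp
      also have "\<dots> = 4 * y\<^sup>2 + 16 + 3 * (\<sigma> * y + 1)\<^sup>2 + 4 * (y\<^sup>2 - (\<sigma> * y)\<^sup>2)"
        by (simp add: power2_eq_square algebra_simps)
      also have "(\<sigma> * y)\<^sup>2 = y\<^sup>2" using ss by (simp add: power_mult_distrib power2_eq_square[of \<sigma>])
      also have "4 * y\<^sup>2 + 16 + 3 * (\<sigma> * y + 1)\<^sup>2 + 4 * (y\<^sup>2 - y\<^sup>2) > 0"
        by (intro add_pos_nonneg add_nonneg_pos) auto
      finally show ?thesis using True by (simp add: k_def rfun_def)
    next
      case False
      \<comment> \<open>In the variable \<open>t\<close> the inequality becomes rational because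
        \<open>y\<^sup>2 = t\<^sup>2 - m\<close>, and both signs of the root are treated at
        once.\<close>
      define t where "t = \<sigma> * rfun c y"
      define m where "m = 4 * c\<^sup>2"
      have t2: "t\<^sup>2 = y\<^sup>2 + m" using ss by (simp add: t_def m_def power_mult_distrib power2_eq_square[of \<sigma>] rfun_sq)
      have m: "0 < m" "m < 4" "m \<le> t\<^sup>2" using False c t2 by (auto simp: m_def)
      have t0: "t \<noteq> 0" using m by auto
      have r0: "rfun c y \<noteq> 0" using t0 by (auto simp: t_def)
      have k: "k y = y + y / t"
      proof -
        have "\<sigma> * y / rfun c y = \<sigma> * \<sigma> * y / t" using s r0 by (auto simp: t_def)
        then show ?thesis using False ss by (simp add: k_def)
      qed
      have y2: "y\<^sup>2 = t\<^sup>2 - m" using t2 by simp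
      define A where "A = 5 + t + m / t"
      have A: "5 + y\<^sup>2 + 2 * t - y * (y + y / t) = A"
      proof -
        have "y * (y + y / t) = y\<^sup>2 + y\<^sup>2 / t" by (simp add: power2_eq_square algebra_simps)
        then have "5 + y\<^sup>2 + 2 * t - y * (y + y / t) = 5 + 2 * t - (t\<^sup>2 - m) / t" by (simp add: y2)
        also have "\<dots> = A" using t0 by (simp add: A_def field_simps power2_eq_square)
        finally show ?thesis .
      qed
      have B: "(y + y / t)\<^sup>2 = (t\<^sup>2 - m) * (1 + 1 / t)\<^sup>2"
      proof -
        have "y + y / t = y * (1 + 1 / t)" by (simp add: algebra_simps)
        then show ?thesis by (simp add: power_mult_distrib y2)
      qed
      have gen: "t\<^sup>2 * (9 * X - (A\<^sup>2 + B * C\<^sup>2)) = 9 * t\<^sup>2 * X - ((t * A)\<^sup>2 + B * (t * C)\<^sup>2)" for X B C :: real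
        by algebra
      have "t\<^sup>2 * (9 * (5 + (t\<^sup>2 - m) + 2 * t) - (A\<^sup>2 + (t\<^sup>2 - m) * (1 + 1 / t)\<^sup>2))
          = 9 * t\<^sup>2 * (5 + (t\<^sup>2 - m) + 2 * t) - ((t * A)\<^sup>2 + (t\<^sup>2 - m) * (t * (1 + 1 / t))\<^sup>2)"
        by (rule gen)
      also have "t * A = 5 * t + t\<^sup>2 + m" using t0 by (simp add: A_def power2_eq_square distrib_left)
      also have "t * (1 + 1 / t) = t + 1" using t0 by (simp add: distrib_left)
      also have "9 * t\<^sup>2 * (5 + (t\<^sup>2 - m) + 2 * t) - ((5 * t + t\<^sup>2 + m)\<^sup>2 + (t\<^sup>2 - m) * (t + 1)\<^sup>2)
          = 7 * t^4 + 6 * t^3 + (19 - 10 * m) * t\<^sup>2 - 8 * m * t + m - m\<^sup>2"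
        by algebra
      also have "\<dots> > 0" by (rule tangent_quartic_pos[OF m])
      finally have "9 * (5 + (t\<^sup>2 - m) + 2 * t) - (A\<^sup>2 + (t\<^sup>2 - m) * (1 + 1 / t)\<^sup>2) > 0"
        using t0 by (simp add: zero_less_mult_iff)
      then have "A\<^sup>2 + (y + y / t)\<^sup>2 < 9 * (5 + y\<^sup>2 + 2 * t)" unfolding B y2 by simp
      then show ?thesis unfolding k using A by (simp add: t_def mult.assoc)
    qed
  qed
qed

lemma Rp_sq:
  assumes "e = 1 \<or> e = -1" "\<sigma> = 1 \<or> \<sigma> = -1" "c\<^sup>2 \<le> 1"
  shows "(Rp c e \<sigma> y)\<^sup>2 = 5 + y\<^sup>2 + 2 * \<sigma> * rfun c y"
proof -
  have "5 + y\<^sup>2 + 2 * \<sigma> * rfun c y \<ge> 0"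
    unfolding Rp_radicand[OF assms(2)] using assms(3) by (intro add_nonneg_nonneg) auto
  then show ?thesis using assms(1) by (auto simp: Rp_def power_mult_distrib)
qed

text \<open>Estimating \<open>rfun\<close> by \<open>\<bar>y\<bar> + 2 * \<bar>c\<bar>\<close>
  reduces the claim to \<open>4 * \<bar>y\<bar> < 4 - 4 * \<bar>c\<bar>\<close>, the origin of the
  threshold. For small \<open>G\<close> the level curves of \<open>Dp\<close> thus lie beyond all
  the lines that carry the sides of the diamond.\<close>

lemma Rp_large:
  assumes s: "\<sigma> = 1 \<or> \<sigma> = -1" and y: "\<bar>y\<bar> < 1 - \<bar>c\<bar>"
  shows "sqrt (5 + y\<^sup>2 + 2 * \<sigma> * rfun c y) > 1 + \<bar>y\<bar>"
proof (rule real_less_rsqrt)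
  have "\<sigma> * rfun c y \<ge> - \<bar>rfun c y\<bar>" using s by auto
  then have "\<sigma> * rfun c y \<ge> - (\<bar>y\<bar> + 2 * \<bar>c\<bar>)" using rfun_bound[of c y] by (meson neg_le_iff_le order_trans)
  then have "2 * \<sigma> * rfun c y \<ge> - 2 * (\<bar>y\<bar> + 2 * \<bar>c\<bar>)" by (simp add: mult.assoc)
  then show "(1 + \<bar>y\<bar>)\<^sup>2 < 5 + y\<^sup>2 + 2 * \<sigma> * rfun c y" using y by (simp add: power2_sum)
qed

section \<open>Labels of the antiperiodic eigenvalues\<close>

context hill
begin

text \<open>The sign \<open>eps n\<close> is built in so that \<open>al t n\<close> precedes
  \<open>be t n\<close> in every group: \<open>eps n * (3 * F x - t * G x)\<close> falls through 1
  at \<open>al t n\<close> and through -1 at \<open>be t n\<close>.\<close>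

definition al :: "real \<Rightarrow> nat \<Rightarrow> real" where "al t n = zt (lin (eps n) t) n"
definition be :: "real \<Rightarrow> nat \<Rightarrow> real" where "be t n = zt (lin (- eps n) t) n"

lemma admissible_eps: "\<bar>t\<bar> \<le> 1 \<Longrightarrow> admissible (lin (eps n) t)" "\<bar>t\<bar> \<le> 1 \<Longrightarrow> admissible (lin (- eps n) t)"
  by (rule admissible_lin; simp)+

lemma al_be_inI: "\<bar>t\<bar> \<le> 1 \<Longrightarrow> inI n (al t n)" "\<bar>t\<bar> \<le> 1 \<Longrightarrow> inI n (be t n)"
  using zt(1)[OF admissible_eps(1)] zt(1)[OF admissible_eps(2)] by (simp_all add: al_def be_def)

lemma al_sign:
  assumes "\<bar>t\<bar> \<le> 1" "inI n x"
  shows "x < al t n \<longleftrightarrow> eps n * (3 * F x - t * G x) > 1" "al t n < x \<longleftrightarrow> eps n * (3 * F x - t * G x) < 1"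
proof -
  have "eps n * gR (lin (eps n) t) x = eps n * (3 * F x - t * G x) - eps n * eps n"
    by (simp add: gR_def lin_def algebra_simps)
  then have "eps n * gR (lin (eps n) t) x = eps n * (3 * F x - t * G x) - 1" by (simp only: eps_sq)
  then show "x < al t n \<longleftrightarrow> eps n * (3 * F x - t * G x) > 1" "al t n < x \<longleftrightarrow> eps n * (3 * F x - t * G x) < 1"
    using zt_sign[OF admissible_eps(1)[OF assms(1)] assms(2)] by (simp_all add: al_def)
qed

lemma be_sign:
  assumes "\<bar>t\<bar> \<le> 1" "inI n x"
  shows "x < be t n \<longleftrightarrow> eps n * (3 * F x - t * G x) > -1" "be t n < x \<longleftrightarrow> eps n * (3 * F x - t * G x) < -1"
proof -
  have "eps n * gR (lin (- eps n) t) x = eps n * (3 * F x - t * G x) + eps n * eps n"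
    by (simp add: gR_def lin_def algebra_simps)
  then have "eps n * gR (lin (- eps n) t) x = eps n * (3 * F x - t * G x) + 1" by (simp only: eps_sq)
  then show "x < be t n \<longleftrightarrow> eps n * (3 * F x - t * G x) > -1" "be t n < x \<longleftrightarrow> eps n * (3 * F x - t * G x) < -1"
    using zt_sign[OF admissible_eps(2)[OF assms(1)] assms(2)] by (auto simp add: be_def)
qed

lemma al_less_be: "\<bar>t\<bar> \<le> 1 \<Longrightarrow> al t n < be t n"
  using al_sign(1)[of t n "al t n"] al_sign(2)[of t n "al t n"] al_be_inI(1)[of t n] be_sign(1)[of t n "al t n"]
  by fastforce

definition Dm :: "real \<Rightarrow> real" where
  "Dm x = (9 * (F x)\<^sup>2 - (1 + G x)\<^sup>2) * (9 * (F x)\<^sup>2 - (1 - G x)\<^sup>2)"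

lemma entire_Dm: "real_entire Dm"
  unfolding Dm_def[abs_def]
  by (intro real_entire_mult real_entire_diff real_entire_power real_entire_add real_entire_const entire_FG)

text \<open>\<open>lam1 n\<close> and \<open>lam2 n\<close> are \<open>\<lambda>\<^sup>-\<close> and \<open>\<lambda>\<^sup>+\<close> with indices \<open>\<nu> = 1\<close>, \<open>p = 2 n + 1\<close>: groups are
  numbered from 0 here.\<close>
definition lam1 :: "nat \<Rightarrow> real" where "lam1 n = min (max (al 1 n) (al (-1) n)) (min (be 1 n) (be (-1) n))"
definition lam2 :: "nat \<Rightarrow> real" where "lam2 n = max (max (al 1 n) (al (-1) n)) (min (be 1 n) (be (-1) n))"

text \<open>Since \<open>al t n < be t n\<close>, the smaller \<open>al\<close> comes first and the
  larger \<open>be\<close> last. The two remaining zeros can stand in either order when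
  \<open>G\<close> is large, hence the \<open>min\<close> and \<open>max\<close> in
  \<open>lam1\<close> and \<open>lam2\<close>.\<close>

lemma Dm_zseq:
  "zseq Dm (4 * n) = min (al 1 n) (al (-1) n)"
  "zseq Dm (4 * n + 1) = lam1 n"
  "zseq Dm (4 * n + 2) = lam2 n"
  "zseq Dm (4 * n + 3) = max (be 1 n) (be (-1) n)"
proof -
  define R :: "nat \<Rightarrow> real \<Rightarrow> real"
    where "R i = lin (if i < 2 then 1 else -1) (if even i then 1 else -1)" for i
  have adm: "admissible (R i)" for i unfolding R_def by (rule admissible_lin) auto
  have P: "Dm = (\<lambda>x. 1 * (\<Prod>i\<in>{..<4::nat}. gR (R i) x))"
    unfolding prod_less_4 by (auto simp: R_def gR_def lin_def Dm_def power2_eq_square algebra_simps)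
  have set: "{zt (R 0) n, zt (R 1) n, zt (R 2) n, zt (R 3) n} = {al 1 n, al (-1) n, be 1 n, be (-1) n}"
    using eps_cases[of n] by (auto simp: R_def al_def be_def)
  \<comment> \<open>The factors \<open>R i\<close> have fixed signs, whereas \<open>al\<close> and
    \<open>be\<close> carry \<open>eps n\<close>. For odd \<open>n\<close> the two pairs are
    exchanged, which leaves the counts unchanged.\<close>
  have cnt: "of_bool (Q (zt (R 0) n)) + of_bool (Q (zt (R 1) n)) + of_bool (Q (zt (R 2) n)) + of_bool (Q (zt (R 3) n))
     = (of_bool (Q (al 1 n)) + of_bool (Q (al (-1) n)) + of_bool (Q (be 1 n)) + of_bool (Q (be (-1) n)) :: nat)" for Q
    using eps_cases[of n] by (auto simp: R_def al_def be_def)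
  have main: "zseq Dm (4 * n + r) = x" if x: "inI n x"
    and r: "of_bool (al 1 n < x) + of_bool (al (-1) n < x) + of_bool (be 1 n < x) + of_bool (be (-1) n < x) \<le> r"
      "r < of_bool (al 1 n \<le> x) + of_bool (al (-1) n \<le> x) + of_bool (be 1 n \<le> x) + of_bool (be (-1) n \<le> x)" for x r
  proof -
    have "zseq Dm (card {..<4::nat} * n + r) = x"
    proof (rule zseq_product[OF _ adm _ P entire_Dm x])
      show "card {i \<in> {..<4}. zt (R i) n < x} \<le> r"
        unfolding card_Collect_less_4 using cnt[of "\<lambda>y. y < x"] r(1) by simp
      show "r < card {i \<in> {..<4}. zt (R i) n \<le> x}"
        unfolding card_Collect_less_4 using cnt[of "\<lambda>y. y \<le> x"] r(2) by simp
    qed auto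
    then show ?thesis by simp
  qed
  note lt = al_less_be[of 1 n] al_less_be[of "-1" n]
  note I = al_be_inI[of 1 n] al_be_inI[of "-1" n]
  show "zseq Dm (4 * n) = min (al 1 n) (al (-1) n)"
    using main[of "min (al 1 n) (al (-1) n)" 0] lt I by (auto simp: min_def)
  show "zseq Dm (4 * n + 1) = lam1 n"
    by (rule main) (use lt I in \<open>auto simp: lam1_def min_def max_def\<close>)
  show "zseq Dm (4 * n + 2) = lam2 n"
    by (rule main) (use lt I in \<open>auto simp: lam2_def min_def max_def\<close>)
  show "zseq Dm (4 * n + 3) = max (be 1 n) (be (-1) n)"
    by (rule main) (use lt I in \<open>auto simp: max_def\<close>)
qed

lemma lam_inI: "inI n (lam1 n)" "inI n (lam2 n)" and lam_le: "lam1 n \<le> lam2 n"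
  using al_be_inI[of 1 n] al_be_inI[of "-1" n] by (auto simp: lam1_def lam2_def min_def max_def)

lemma Dm_zero: "Dm (zseq Dm j) = 0"
proof (rule zseq_is_zero[OF entire_Dm])
  fix y assume "y < X0"
  then have f: "(F y)\<^sup>2 > 1 + (G y)\<^sup>2" using F_left by blast
  have "(1 + G y)\<^sup>2 \<le> 2 + 2 * (G y)\<^sup>2" "(1 - G y)\<^sup>2 \<le> 2 + 2 * (G y)\<^sup>2"
    using sum_squares_bound[of 1 "G y"] sum_squares_bound[of 1 "- G y"] by (simp_all add: power2_sum power2_diff)
  then have "9 * (F y)\<^sup>2 - (1 + G y)\<^sup>2 > 0" "9 * (F y)\<^sup>2 - (1 - G y)\<^sup>2 > 0"
    using f zero_le_power2[of "G y"] by (simp_all; linarith)+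
  then show "Dm y \<noteq> 0" by (simp add: Dm_def)
next
  fix n
  have a: "admissible (lin 1 1)" by (rule admissible_lin) auto
  have "3 * F (zt (lin 1 1) n) = 1 + G (zt (lin 1 1) n)" using zt(2)[OF a, of n] by (simp add: gR_def lin_def)
  then have "(3 * F (zt (lin 1 1) n))\<^sup>2 = (1 + G (zt (lin 1 1) n))\<^sup>2" by simp
  then have "Dm (zt (lin 1 1) n) = 0" by (simp add: Dm_def power_mult_distrib)
  then show "\<exists>x. inI n x \<and> Dm x = 0" using zt(1)[OF a] by blast
qed

definition zF :: "nat \<Rightarrow> real" where "zF n = zt (lin 0 0) n"

lemma zF: "inI n (zF n)" "F (zF n) = 0" "inI n x \<Longrightarrow> F x = 0 \<Longrightarrow> x = zF n"
  and card_zF: "card {y. y < zF n \<and> F y = 0} = n"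
proof -
  have a: "admissible (lin 0 0)" by (rule admissible_lin) auto
  have g: "gR (lin 0 0) = (\<lambda>x. 3 * F x)" by (auto simp: gR_def lin_def)
  show I: "inI n (zF n)" and "F (zF n) = 0" using zt[OF a, of n] by (simp_all add: zF_def g)
  show "inI n x \<Longrightarrow> F x = 0 \<Longrightarrow> x = zF n" using zt_sign(3)[OF a, of n x] by (simp add: zF_def g)
  show "card {y. y < zF n \<and> F y = 0} = n"
    using card_zeros_below[OF a I] by (simp add: g zF_def)
qed

lemma F_zero_ex: "F x = 0 \<Longrightarrow> \<exists>n. x = zF n"
proof -
  assume F0: "F x = 0"
  have a: "admissible (lin 0 0)" by (rule admissible_lin) auto
  have "gR (lin 0 0) x = 0" using F0 by (simp add: gR_def lin_def)
  from gR_zero_inI[OF a this] obtain n where "inI n x" by blast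
  then show ?thesis using zF(3) F0 by blast
qed

lemma F_zero_THE: "(THE x. F x = 0 \<and> card {y. y < x \<and> F y = 0} = n) = zF n"
proof (rule the_equality)
  show "F (zF n) = 0 \<and> card {y. y < zF n \<and> F y = 0} = n" using zF(2) card_zF by simp
  fix x assume x: "F x = 0 \<and> card {y. y < x \<and> F y = 0} = n"
  then obtain m where "x = zF m" using F_zero_ex by blast
  then show "x = zF n" using x card_zF by simp
qed

section \<open>The resonance ellipse\<close>

definition rho :: "real \<Rightarrow> real \<Rightarrow> real" where
  "rho c2 x = (9 * (F x)\<^sup>2 - (1 - c2)) * c2 + (1 - c2) * (G x)\<^sup>2"

lemma entire_rho: "real_entire (rho c2)"
  unfolding rho_def[abs_def]
  by (intro real_entire_mult real_entire_diff real_entire_power real_entire_add real_entire_const entire_FG)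

text \<open>If some \<open>be t n\<close> preceded \<open>al (- t) n\<close>, these would be
  \<open>lam1 n\<close> and \<open>lam2 n\<close>; comparing the conditions of the two factors at
  each of them would give \<open>\<bar>G\<bar> > 1\<close> at both.\<close>

lemma ordered_of_small:
  assumes "\<bar>G (lam1 n)\<bar> < 1 \<or> \<bar>G (lam2 n)\<bar> < 1"
  shows "max (al 1 n) (al (-1) n) \<le> min (be 1 n) (be (-1) n)"
proof (rule ccontr)
  assume n: "\<not> ?thesis"
  note lt = al_less_be[of 1 n] al_less_be[of "-1" n]
  have "\<exists>t. (t = 1 \<or> t = -1) \<and> be t n < al (- t) n \<and> lam1 n = be t n \<and> lam2 n = al (- t) n"
  proof (cases "be 1 n < al (-1) n")
    case True
    then show ?thesis using lt by (intro exI[of _ 1]) (auto simp: lam1_def lam2_def min_def max_def)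
  next
    case False
    then have "be (-1) n < al 1 n" using n lt by (auto simp: min_def max_def split: if_splits)
    then show ?thesis using lt by (intro exI[of _ "-1"]) (auto simp: lam1_def lam2_def min_def max_def)
  qed
  then obtain t where t: "t = 1 \<or> t = -1" "be t n < al (- t) n" "lam1 n = be t n" "lam2 n = al (- t) n" by blast
  have t1: "\<bar>t\<bar> \<le> 1" "\<bar>- t\<bar> \<le> 1" using t(1) by auto
  have I: "inI n (be t n)" "inI n (al (- t) n)" using al_be_inI t1 by auto
  let ?x = "be t n" and ?y = "al (- t) n"
  have "eps n * (3 * F ?x - t * G ?x) = -1" using be_sign[OF t1(1) I(1)] by auto
  moreover have "eps n * (3 * F ?x - (- t) * G ?x) > 1" using al_sign(1)[OF t1(2) I(1)] t(2) by blast
  ultimately have 1: "eps n * (t * G ?x) > 1" by (simp add: algebra_simps)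
  have "eps n * (3 * F ?y - (- t) * G ?y) = 1" using al_sign[OF t1(2) I(2)] by auto
  moreover have "eps n * (3 * F ?y - t * G ?y) < -1" using be_sign(2)[OF t1(1) I(2)] t(2) by blast
  ultimately have 2: "eps n * (t * G ?y) > 1" by (simp add: algebra_simps)
  have e: "\<bar>eps n * (t * g)\<bar> = \<bar>g\<bar>" for g using t(1) by (auto simp: abs_mult)
  have "\<bar>G ?x\<bar> > 1" "\<bar>G ?y\<bar> > 1"
    using 1 2 abs_ge_self[of "eps n * (t * G ?x)"] abs_ge_self[of "eps n * (t * G ?y)"] unfolding e by linarith+
  then show False using assms t(3,4) by auto
qed

lemma in_diamond:
  assumes o: "max (al 1 n) (al (-1) n) \<le> min (be 1 n) (be (-1) n)" and x: "lam1 n \<le> x" "x \<le> lam2 n"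
  shows "\<bar>3 * F x\<bar> + \<bar>G x\<bar> \<le> 1"
proof -
  have l: "lam1 n = max (al 1 n) (al (-1) n)" "lam2 n = min (be 1 n) (be (-1) n)"
    using o by (auto simp: lam1_def lam2_def min_def max_def)
  have I: "inI n x" by (rule inI_between[OF lam_inI x])
  have "\<not> x < al 1 n" "\<not> x < al (-1) n" "\<not> be 1 n < x" "\<not> be (-1) n < x" using x l by auto
  then have "\<bar>eps n * (3 * F x - G x)\<bar> \<le> 1" "\<bar>eps n * (3 * F x + G x)\<bar> \<le> 1"
    using al_sign(1)[OF _ I, of 1] al_sign(1)[OF _ I, of "-1"] be_sign(2)[OF _ I, of 1] be_sign(2)[OF _ I, of "-1"]
    by (auto simp: abs_le_iff not_less)
  then have "\<bar>3 * F x - G x\<bar> \<le> 1" "\<bar>3 * F x + G x\<bar> \<le> 1" by (simp_all add: abs_mult)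
  then show ?thesis by linarith
qed

lemma diamond_ends:
  assumes o: "max (al 1 n) (al (-1) n) \<le> min (be 1 n) (be (-1) n)"
  shows "eps n * (3 * F (lam1 n)) = 1 - \<bar>G (lam1 n)\<bar>" "eps n * (3 * F (lam2 n)) = - (1 - \<bar>G (lam2 n)\<bar>)"
proof -
  have l: "lam1 n = max (al 1 n) (al (-1) n)" "lam2 n = min (be 1 n) (be (-1) n)"
    using o by (auto simp: lam1_def lam2_def min_def max_def)
  have ae: "\<bar>eps n * G x\<bar> = \<bar>G x\<bar>" for x by (simp add: abs_mult)
  have "(eps n * (3 * F (lam1 n) - G (lam1 n)) = 1 \<and> eps n * (3 * F (lam1 n) + G (lam1 n)) \<le> 1)
      \<or> (eps n * (3 * F (lam1 n) - G (lam1 n)) \<le> 1 \<and> eps n * (3 * F (lam1 n) + G (lam1 n)) = 1)"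
    using al_sign[OF _ lam_inI(1), of 1 n] al_sign[OF _ lam_inI(1), of "-1" n] l(1)
    by (auto simp: max_def split: if_splits)
  then show "eps n * (3 * F (lam1 n)) = 1 - \<bar>G (lam1 n)\<bar>"
    using ae[of "lam1 n"] by (auto simp: distrib_left right_diff_distrib abs_if split: if_splits)
  have "(eps n * (3 * F (lam2 n) - G (lam2 n)) = -1 \<and> eps n * (3 * F (lam2 n) + G (lam2 n)) \<ge> -1)
      \<or> (eps n * (3 * F (lam2 n) - G (lam2 n)) \<ge> -1 \<and> eps n * (3 * F (lam2 n) + G (lam2 n)) = -1)"
    using be_sign[OF _ lam_inI(2), of 1 n] be_sign[OF _ lam_inI(2), of "-1" n] l(2)
    by (auto simp: min_def split: if_splits)
  then show "eps n * (3 * F (lam2 n)) = - (1 - \<bar>G (lam2 n)\<bar>)"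
    using ae[of "lam2 n"] by (auto simp: distrib_left right_diff_distrib abs_if split: if_splits)
qed

text \<open>On the sides of the diamond \<open>rho\<close> is a perfect square, because the ellipse
  touches each side at \<open>\<bar>G x\<bar> = c2\<close>.\<close>

lemma rho_at_end:
  assumes "e = 1 \<or> e = -1" "e * (3 * F x) = 1 - \<bar>G x\<bar> \<or> e * (3 * F x) = - (1 - \<bar>G x\<bar>)"
  shows "rho c2 x = (\<bar>G x\<bar> - c2)\<^sup>2"
proof -
  have "(e * (3 * F x))\<^sup>2 = (1 - \<bar>G x\<bar>)\<^sup>2" using assms(2) by (auto simp: power2_commute)
  moreover have "(e * (3 * F x))\<^sup>2 = 9 * (F x)\<^sup>2" using assms(1) by (auto simp: power_mult_distrib)
  ultimately have "rho c2 x = ((1 - \<bar>G x\<bar>)\<^sup>2 - (1 - c2)) * c2 + (1 - c2) * \<bar>G x\<bar>\<^sup>2" by (simp add: rho_def)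
  then show ?thesis by (simp add: power2_eq_square algebra_simps)
qed

text \<open>The lines \<open>\<bar>3 * F\<bar> = 1 - c2\<close> pass through the points where the
  ellipse touches the diamond, so their parts inside the diamond are chords of the ellipse.\<close>

lemma rho_nonpos:
  assumes c2: "0 \<le> c2" "c2 \<le> 1" and F: "\<bar>3 * F x\<bar> = 1 - c2" and d: "\<bar>3 * F x\<bar> + \<bar>G x\<bar> \<le> 1"
  shows "rho c2 x \<le> 0"
proof -
  have "(3 * F x)\<^sup>2 = (1 - c2)\<^sup>2" using F by (metis power2_abs)
  then have f: "9 * (F x)\<^sup>2 = (1 - c2)\<^sup>2" by (simp add: power_mult_distrib)
  have "\<bar>G x\<bar> \<le> c2" using F d by simp
  then have "(G x)\<^sup>2 \<le> c2\<^sup>2" using c2 abs_le_square_iff[of "G x" c2] by simp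
  then have "(1 - c2) * (G x)\<^sup>2 \<le> (1 - c2) * c2\<^sup>2" using c2 by (intro mult_left_mono) auto
  then show ?thesis by (simp add: rho_def f) (simp add: power2_eq_square algebra_simps)
qed

text \<open>In the \<open>(3 F, G)\<close> plane \<open>rho\<close> vanishes on an ellipse inscribed in the diamond
  \<open>\<bar>3 F\<bar> + \<bar>G\<bar> \<le> 1\<close> and touching it at \<open>(\<plusminus>(1 - c2), \<plusminus>c2)\<close>. A path through the diamond that enters
  or leaves in a corner \<open>\<bar>G\<bar> < c2\<close> has to meet the ellipse.\<close>
lemma resonance_ex:
  assumes c2: "0 \<le> c2" "c2 \<le> 1" and v: "\<bar>G (lam1 n)\<bar> < c2 \<or> \<bar>G (lam2 n)\<bar> < c2"
  defines "Z \<equiv> {x. lam1 n \<le> x \<and> x \<le> lam2 n \<and> rho c2 x = 0}"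
  shows "finite Z" "Z \<noteq> {}"
proof -
  have o: "max (al 1 n) (al (-1) n) \<le> min (be 1 n) (be (-1) n)"
    by (rule ordered_of_small) (use v c2 in auto)
  note de = diamond_ends[OF o]
  have rr: "rho c2 (lam1 n) = (\<bar>G (lam1 n)\<bar> - c2)\<^sup>2" "rho c2 (lam2 n) = (\<bar>G (lam2 n)\<bar> - c2)\<^sup>2"
    using rho_at_end[OF eps_cases] de by blast+
  \<comment> \<open>An end with \<open>\<bar>G\<bar> < c2\<close> lies strictly outside the ellipse.
    This excludes that \<open>rho\<close> vanishes identically and provides one endpoint for the
    final intermediate value argument.\<close>
  from v obtain x0 where x0: "lam1 n \<le> x0" "x0 \<le> lam2 n" "rho c2 x0 > 0"
    using rr lam_le[of n] by fastforce
  show "finite Z" unfolding Z_def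
    by (rule real_entire_finite_zeros[OF entire_rho, of c2 x0]) (use x0 in auto)
  have cF: "continuous_on A F" and cG: "continuous_on A G" for A
    by (intro differentiable_imp_continuous_on differentiable_at_imp_differentiable_on diffF diffG)+
  have crho: "continuous_on A (rho c2)" for A
    unfolding rho_def[abs_def] by (intro continuous_intros cF cG)
  note dm = in_diamond[OF o]
  \<comment> \<open>The end in the cut-off corner and the opposite end lie on different sides of the
    chord that bounds the corner, so the path crosses this chord, where \<open>rho\<close> is
    nonpositive.\<close>
  have "\<exists>x. lam1 n \<le> x \<and> x \<le> lam2 n \<and> rho c2 x \<le> 0"
    using v
  proof
    assume v1: "\<bar>G (lam1 n)\<bar> < c2"
    have "\<bar>3 * F (lam2 n)\<bar> + \<bar>G (lam2 n)\<bar> \<le> 1" using dm lam_le by blast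
    then have "eps n * (3 * F (lam2 n)) \<le> 1 - c2" unfolding de using c2 by linarith
    moreover have "1 - c2 \<le> eps n * (3 * F (lam1 n))" unfolding de using v1 by linarith
    ultimately have "\<exists>x. lam1 n \<le> x \<and> x \<le> lam2 n \<and> eps n * (3 * F x) = 1 - c2"
      by (rule IVT2') (intro lam_le continuous_intros cF)+
    then obtain x where x: "lam1 n \<le> x" "x \<le> lam2 n" "eps n * (3 * F x) = 1 - c2" by blast
    have "\<bar>eps n * (3 * F x)\<bar> = 1 - c2" using x c2 by simp
    then have "\<bar>3 * F x\<bar> = 1 - c2" by (simp add: abs_mult)
    then show ?thesis using rho_nonpos[OF c2 _ dm[OF x(1,2)]] x by blast
  next
    assume v2: "\<bar>G (lam2 n)\<bar> < c2"
    have "\<bar>3 * F (lam1 n)\<bar> + \<bar>G (lam1 n)\<bar> \<le> 1" using dm lam_le by blast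
    then have "- (1 - c2) \<le> eps n * (3 * F (lam1 n))" unfolding de using c2 by linarith
    moreover have "eps n * (3 * F (lam2 n)) \<le> - (1 - c2)" unfolding de using v2 by linarith
    ultimately have "\<exists>x. lam1 n \<le> x \<and> x \<le> lam2 n \<and> eps n * (3 * F x) = - (1 - c2)"
      by (intro IVT2') (auto intro!: lam_le continuous_intros cF)
    then obtain x where x: "lam1 n \<le> x" "x \<le> lam2 n" "eps n * (3 * F x) = - (1 - c2)" by blast
    have "\<bar>eps n * (3 * F x)\<bar> = 1 - c2" using x c2 by simp
    then have "\<bar>3 * F x\<bar> = 1 - c2" by (simp add: abs_mult)
    then show ?thesis using rho_nonpos[OF c2 _ dm[OF x(1,2)]] x by blast
  qed
  then obtain x1 where x1: "lam1 n \<le> x1" "x1 \<le> lam2 n" "rho c2 x1 \<le> 0" by blast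
  have "\<exists>x. lam1 n \<le> x \<and> x \<le> lam2 n \<and> rho c2 x = 0"
  proof (cases "x0 \<le> x1")
    case True
    then obtain x where "x0 \<le> x" "x \<le> x1" "rho c2 x = 0"
      using IVT2'[of "rho c2" x1 0 x0] x0 x1 crho by auto
    then show ?thesis using x0 x1 by (intro exI[of _ x]) auto
  next
    case False
    then obtain x where "x1 \<le> x" "x \<le> x0" "rho c2 x = 0"
      using IVT'[of "rho c2" x1 0 x0] x0 x1 crho by auto
    then show ?thesis using x0 x1 by (intro exI[of _ x]) auto
  qed
  then show "Z \<noteq> {}" by (auto simp: Z_def)
qed

section \<open>Labels of the periodic eigenvalues\<close>

definition Dp :: "real \<Rightarrow> real \<Rightarrow> real" where
  "Dp c x = (9 * (F x)\<^sup>2 - (G x)\<^sup>2 - 5)\<^sup>2 - 4 * ((G x)\<^sup>2 + 4 * c\<^sup>2)"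

lemma entire_Dp: "real_entire (Dp c)"
  unfolding Dp_def[abs_def]
  by (intro real_entire_mult real_entire_diff real_entire_power real_entire_add real_entire_const entire_FG)

text \<open>The inner level curve, with a minus sign before the inner root, stays strictly below
  \<open>9 + 9 * y\<^sup>2\<close> even for \<open>c\<^sup>2 = 1\<close>, and so yields a zero in
  every interval.\<close>

lemma Dp_zero:
  assumes c: "c\<^sup>2 \<le> 1"
  shows "Dp c (zseq (Dp c) j) = 0"
proof (rule zseq_is_zero[OF entire_Dp])
  fix y assume "y < X0"
  then have f: "(F y)\<^sup>2 > 1 + (G y)\<^sup>2" using F_left by blast
  let ?u = "(G y)\<^sup>2"
  have u: "?u \<ge> 0" by simp
  have "9 * (F y)\<^sup>2 - ?u - 5 > 4 + 8 * ?u" using f by linarith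
  then have "(9 * (F y)\<^sup>2 - ?u - 5)\<^sup>2 > (4 + 8 * ?u)\<^sup>2" using u by (intro power_strict_mono) auto
  moreover have "(4 + 8 * ?u)\<^sup>2 = 16 + 64 * ?u + 64 * ?u\<^sup>2" by (simp add: power2_sum power_mult_distrib)
  moreover have "?u\<^sup>2 \<ge> 0" by simp
  moreover have "A - 4 * (v + 4 * d) > 0" if "A > B" "B = 16 + 64 * v + 64 * w" "w \<ge> 0" "d \<le> 1" "v \<ge> 0"
    for A B v w d :: real
    using that by (simp add: algebra_simps)
  ultimately have "Dp c y > 0" unfolding Dp_def using c u by blast
  then show "Dp c y \<noteq> 0" by simp
next
  fix n
  define R where "R y = sqrt (5 + y\<^sup>2 - 2 * sqrt (y\<^sup>2 + 4 * c\<^sup>2))" for y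
  have nn: "5 + y\<^sup>2 - 2 * sqrt (y\<^sup>2 + 4 * c\<^sup>2) \<ge> 0" for y
  proof -
    have "5 + y\<^sup>2 - 2 * sqrt (y\<^sup>2 + 4 * c\<^sup>2) = 4 * (1 - c\<^sup>2) + (1 - sqrt (y\<^sup>2 + 4 * c\<^sup>2))\<^sup>2"
      by (simp add: power2_diff)
    moreover have "4 * (1 - c\<^sup>2) + (1 - sqrt (y\<^sup>2 + 4 * c\<^sup>2))\<^sup>2 \<ge> 0"
      using c by (intro add_nonneg_nonneg) auto
    ultimately show ?thesis by linarith
  qed
  have R2: "(R y)\<^sup>2 = 5 + y\<^sup>2 - 2 * sqrt (y\<^sup>2 + 4 * c\<^sup>2)" for y using nn[of y] by (simp add: R_def)
  have "\<exists>x. inI n x \<and> gR R x = 0"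
  proof (rule ex_zero_of_bound)
    show "continuous_on UNIV R" unfolding R_def[abs_def] by (intro continuous_intros)
    fix y :: real
    have "sqrt (y\<^sup>2 + 4 * c\<^sup>2) \<ge> 0" by simp
    then show "(R y)\<^sup>2 < 9 + 9 * y\<^sup>2" unfolding R2 using zero_le_power2[of y] by linarith
  qed
  then obtain x where x: "inI n x" "3 * F x = R (G x)" by (auto simp: gR_def)
  have "9 * (F x)\<^sup>2 = (3 * F x)\<^sup>2" by (simp add: power_mult_distrib)
  then have "9 * (F x)\<^sup>2 - (G x)\<^sup>2 - 5 = - 2 * sqrt ((G x)\<^sup>2 + 4 * c\<^sup>2)" unfolding x(2) R2 by simp
  then have "Dp c x = 0" by (simp add: Dp_def power_mult_distrib)
  then show "\<exists>x. inI n x \<and> Dp c x = 0" using x(1) by blast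
qed

text \<open>The roots \<open>Rp\<close> never vanish, so on interval \<open>n\<close> every zero
  with \<open>eps n * F > 0\<close> precedes every zero with \<open>eps n * F < 0\<close>, whichever
  inner sign is taken. Positions 1 and 2 of a group are the ones that bound the p-mix gaps.\<close>

lemma Dp_zseq_mid:
  assumes c: "c\<^sup>2 < 1"
  defines "a \<equiv> \<lambda>\<sigma> n. zt (Rp c (eps n) \<sigma>) n" and "b \<equiv> \<lambda>\<sigma> n. zt (Rp c (- eps n) \<sigma>) n"
  shows "zseq (Dp c) (4 * n + 1) = max (a 1 n) (a (-1) n)"
    and "zseq (Dp c) (4 * n + 2) = min (b 1 n) (b (-1) n)"
proof -
  define R :: "nat \<Rightarrow> real \<Rightarrow> real"
    where "R i = Rp c (if i < 2 then 1 else -1) (if even i then 1 else -1)" for i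
  have adm: "admissible (R i)" for i unfolding R_def using c by (intro admissible_Rp) auto
  have P: "Dp c = (\<lambda>x. 1 * (\<Prod>i\<in>{..<4::nat}. gR (R i) x))"
  proof
    fix x
    let ?r = "rfun c (G x)"
    have neg: "Rp c (-1) \<sigma> y = - Rp c 1 \<sigma> y" for \<sigma> y by (simp add: Rp_def)
    have "(\<Prod>i\<in>{..<4::nat}. gR (R i) x)
        = ((3 * F x)\<^sup>2 - (Rp c 1 1 (G x))\<^sup>2) * ((3 * F x)\<^sup>2 - (Rp c 1 (-1) (G x))\<^sup>2)"
      unfolding prod_less_4 by (simp add: R_def gR_def neg) (simp add: power2_eq_square algebra_simps)
    also have "\<dots> = (9 * (F x)\<^sup>2 - (5 + (G x)\<^sup>2 + 2 * ?r)) * (9 * (F x)\<^sup>2 - (5 + (G x)\<^sup>2 - 2 * ?r))"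
      using c by (simp add: Rp_sq power_mult_distrib)
    also have "\<dots> = (9 * (F x)\<^sup>2 - (G x)\<^sup>2 - 5)\<^sup>2 - 4 * ?r\<^sup>2" by (simp add: power2_eq_square algebra_simps)
    finally show "Dp c x = 1 * (\<Prod>i\<in>{..<4::nat}. gR (R i) x)" by (simp add: Dp_def rfun_sq)
  qed
  have cnt: "of_bool (Q (zt (R 0) n)) + of_bool (Q (zt (R 1) n)) + of_bool (Q (zt (R 2) n)) + of_bool (Q (zt (R 3) n))
     = (of_bool (Q (a 1 n)) + of_bool (Q (a (-1) n)) + of_bool (Q (b 1 n)) + of_bool (Q (b (-1) n)) :: nat)" for Q
    using eps_cases[of n] by (auto simp: R_def a_def b_def)
  have main: "zseq (Dp c) (4 * n + r) = x" if x: "inI n x"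
    and r: "of_bool (a 1 n < x) + of_bool (a (-1) n < x) + of_bool (b 1 n < x) + of_bool (b (-1) n < x) \<le> r"
      "r < of_bool (a 1 n \<le> x) + of_bool (a (-1) n \<le> x) + of_bool (b 1 n \<le> x) + of_bool (b (-1) n \<le> x)" for x r
  proof -
    have "zseq (Dp c) (card {..<4::nat} * n + r) = x"
    proof (rule zseq_product[OF _ adm _ P entire_Dp x])
      show "card {i \<in> {..<4}. zt (R i) n < x} \<le> r"
        unfolding card_Collect_less_4 using cnt[of "\<lambda>y. y < x"] r(1) by simp
      show "r < card {i \<in> {..<4}. zt (R i) n \<le> x}"
        unfolding card_Collect_less_4 using cnt[of "\<lambda>y. y \<le> x"] r(2) by simp
    qed auto
    then show ?thesis by simp
  qed
  have adma: "admissible (Rp c (eps n) \<sigma>)" and admb: "admissible (Rp c (- eps n) \<sigma>)"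
    if "\<sigma> = 1 \<or> \<sigma> = -1" for \<sigma>
    using eps_cases[of n] that c by (auto intro!: admissible_Rp)
  have I: "inI n (a \<sigma> n)" "inI n (b \<sigma> n)" if "\<sigma> = 1 \<or> \<sigma> = -1" for \<sigma>
    using zt(1)[OF adma[OF that]] zt(1)[OF admb[OF that]] by (simp_all add: a_def b_def)
  have lt: "a \<sigma> n < b \<tau> n" if s: "\<sigma> = 1 \<or> \<sigma> = -1" and t: "\<tau> = 1 \<or> \<tau> = -1" for \<sigma> \<tau>
  proof -
    have "Rp c 1 \<sigma> y > 0" if "\<sigma> = 1 \<or> \<sigma> = -1" for \<sigma> y
    proof -
      have "5 + y\<^sup>2 + 2 * \<sigma> * rfun c y > 0"
        unfolding Rp_radicand[OF that] using c by (intro add_pos_nonneg) auto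
      then show ?thesis by (simp add: Rp_def)
    qed
    moreover have "Rp c (e * eps n) \<sigma> y = e * eps n * Rp c 1 \<sigma> y" for e \<sigma> y by (simp add: Rp_def)
    ultimately have "eps n * (3 * F (a \<sigma> n)) > 0" "eps n * Rp c (- eps n) \<tau> (G (a \<sigma> n)) < 0"
      using zt(2)[OF adma[OF s], of n] s t eps_sq[of n]
      by (simp_all add: a_def gR_def Rp_def flip: mult.assoc)
    then have "eps n * gR (Rp c (- eps n) \<tau>) (a \<sigma> n) > 0" by (simp add: gR_def right_diff_distrib)
    then show ?thesis using zt_sign(1)[OF admb[OF t] I(1)[OF s]] by (simp add: b_def)
  qed
  note lts = lt[of 1 1] lt[of 1 "-1"] lt[of "-1" 1] lt[of "-1" "-1"]
  note Is = I[of 1] I[of "-1"]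
  show "zseq (Dp c) (4 * n + 1) = max (a 1 n) (a (-1) n)"
    by (rule main) (use lts Is in \<open>auto simp: max_def\<close>)
  show "zseq (Dp c) (4 * n + 2) = min (b 1 n) (b (-1) n)"
    by (rule main) (use lts Is in \<open>auto simp: min_def\<close>)
qed

text \<open>Once \<open>\<bar>G\<bar> < 1 - \<bar>c\<bar>\<close> on interval \<open>n\<close>,
  \<open>Rp_large\<close> puts the first two periodic zeros before both \<open>al\<close> and the
  last two after both \<open>be\<close>.\<close>

lemma pmix_order:
  assumes c: "c\<^sup>2 < 1"
  obtains n0 where "\<And>n. n \<ge> n0 \<Longrightarrow> zseq (Dp c) (4 * n + 1) \<le> zseq Dm (4 * n)"
    "\<And>n. n \<ge> n0 \<Longrightarrow> zseq Dm (4 * n + 3) \<le> zseq (Dp c) (4 * n + 2)"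
proof -
  have "\<bar>c\<bar> < 1" using c by (simp add: abs_square_less_1)
  then obtain n0 where n0: "\<And>n x. n \<ge> n0 \<Longrightarrow> inI n x \<Longrightarrow> \<bar>G x\<bar> < 1 - \<bar>c\<bar>"
    using G_small[of "1 - \<bar>c\<bar>"] by auto
  have adm: "admissible (Rp c (eps n) \<sigma>)" "admissible (Rp c (- eps n) \<sigma>)" if "\<sigma> = 1 \<or> \<sigma> = -1" for \<sigma> n
    using eps_cases[of n] that c by (auto intro!: admissible_Rp)
  show ?thesis
  proof (rule that[of n0])
    fix n assume n: "n \<ge> n0"
    have a: "zt (Rp c (eps n) \<sigma>) n < al t n" if s: "\<sigma> = 1 \<or> \<sigma> = -1" and t: "t = 1 \<or> t = -1" for \<sigma> t
    proof -
      let ?x = "zt (Rp c (eps n) \<sigma>) n"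
      have I: "inI n ?x" by (rule zt(1)[OF adm(1)[OF s]])
      have "3 * F ?x = eps n * sqrt (5 + (G ?x)\<^sup>2 + 2 * \<sigma> * rfun c (G ?x))"
        using zt(2)[OF adm(1)[OF s], of n n] by (simp add: gR_def Rp_def)
      then have "eps n * (3 * F ?x) = sqrt (5 + (G ?x)\<^sup>2 + 2 * \<sigma> * rfun c (G ?x))"
        by (simp flip: mult.assoc)
      then have "eps n * (3 * F ?x) > 1 + \<bar>G ?x\<bar>" using Rp_large[OF s n0[OF n I]] by simp
      moreover have "\<bar>eps n * (t * G ?x)\<bar> = \<bar>G ?x\<bar>" using t by (auto simp: abs_mult)
      ultimately have "eps n * (3 * F ?x - t * G ?x) > 1" unfolding right_diff_distrib by linarith
      then show ?thesis using al_sign(1)[OF _ I, of t] t by auto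
    qed
    have b: "be t n < zt (Rp c (- eps n) \<sigma>) n" if s: "\<sigma> = 1 \<or> \<sigma> = -1" and t: "t = 1 \<or> t = -1" for \<sigma> t
    proof -
      let ?x = "zt (Rp c (- eps n) \<sigma>) n"
      have I: "inI n ?x" by (rule zt(1)[OF adm(2)[OF s]])
      have "3 * F ?x = - eps n * sqrt (5 + (G ?x)\<^sup>2 + 2 * \<sigma> * rfun c (G ?x))"
        using zt(2)[OF adm(2)[OF s], of n n] by (simp add: gR_def Rp_def)
      then have "eps n * (3 * F ?x) = - sqrt (5 + (G ?x)\<^sup>2 + 2 * \<sigma> * rfun c (G ?x))"
        by (simp flip: mult.assoc)
      then have "eps n * (3 * F ?x) < - (1 + \<bar>G ?x\<bar>)" using Rp_large[OF s n0[OF n I]] by simp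
      moreover have "\<bar>eps n * (t * G ?x)\<bar> = \<bar>G ?x\<bar>" using t by (auto simp: abs_mult)
      ultimately have "eps n * (3 * F ?x - t * G ?x) < -1" unfolding right_diff_distrib by linarith
      then show ?thesis using be_sign(2)[OF _ I, of t] t by auto
    qed
    show "zseq (Dp c) (4 * n + 1) \<le> zseq Dm (4 * n)"
      unfolding Dp_zseq_mid[OF c] Dm_zseq using a[of 1 1] a[of 1 "-1"] a[of "-1" 1] a[of "-1" "-1"] by simp
    show "zseq Dm (4 * n + 3) \<le> zseq (Dp c) (4 * n + 2)"
      unfolding Dp_zseq_mid[OF c] Dm_zseq using b[of 1 1] b[of 1 "-1"] b[of "-1" 1] b[of "-1" "-1"] by simp
  qed
qed

end

section \<open>The gaps\<close>

context hill
begin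

definition Zres :: "real \<Rightarrow> nat \<Rightarrow> real set" where
  "Zres c2 n = {x. lam1 n \<le> x \<and> x \<le> lam2 n \<and> rho c2 x = 0}"

text \<open>\<open>Em\<close> and \<open>Ep\<close> are the edges E^{k,-}_{1,p} and E^{k,+}_{1,p}
  for \<open>p = 2 * n + 1\<close>, with \<open>c2\<close> standing for c_k^2.\<close>

definition Em :: "real \<Rightarrow> nat \<Rightarrow> real" where
  "Em c2 n = (if \<bar>G (lam1 n)\<bar> - c2 \<ge> 0 then lam1 n else Min (Zres c2 n))"

definition Ep :: "real \<Rightarrow> nat \<Rightarrow> real" where
  "Ep c2 n = (if \<bar>G (lam2 n)\<bar> - c2 \<ge> 0 then lam2 n else Max (Zres c2 n))"

lemma Dm_lam: "Dm (lam1 n) = 0" "Dm (lam2 n) = 0"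
  using Dm_zero[of "4 * n + 1"] Dm_zero[of "4 * n + 2"] by (simp_all only: Dm_zseq)

lemma Zres_ends:
  assumes "0 \<le> c2" "c2 \<le> 1" "\<bar>G (lam1 n)\<bar> < c2 \<or> \<bar>G (lam2 n)\<bar> < c2"
  shows "Min (Zres c2 n) \<in> Zres c2 n" "Max (Zres c2 n) \<in> Zres c2 n"
  using resonance_ex[OF assms] unfolding Zres_def by (intro Min_in Max_in; blast)+

lemma Em_type:
  assumes "0 \<le> c2" "c2 \<le> 1"
  shows "\<bar>G (lam1 n)\<bar> \<ge> c2 \<Longrightarrow> Dm (Em c2 n) = 0" "\<bar>G (lam1 n)\<bar> < c2 \<Longrightarrow> rho c2 (Em c2 n) = 0"
  using Dm_lam(1)[of n] Zres_ends(1)[OF assms, of n] by (auto simp: Em_def Zres_def)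

lemma Ep_type:
  assumes "0 \<le> c2" "c2 \<le> 1"
  shows "\<bar>G (lam2 n)\<bar> \<ge> c2 \<Longrightarrow> Dm (Ep c2 n) = 0" "\<bar>G (lam2 n)\<bar> < c2 \<Longrightarrow> rho c2 (Ep c2 n) = 0"
  using Dm_lam(2)[of n] Zres_ends(2)[OF assms, of n] by (auto simp: Ep_def Zres_def)

text \<open>For \<open>c2 = 1\<close>, that is s_k = 0, the ellipse degenerates:
  \<open>rho 1\<close> is \<open>9 * F\<^sup>2\<close>.\<close>

lemma Zres_1: "x \<in> Zres 1 n \<Longrightarrow> x = zF n"
  using zF(3)[OF inI_between[OF lam_inI]] by (auto simp: Zres_def rho_def)

lemma Em_Ep_1_small:
  shows "\<bar>G (lam1 n)\<bar> < 1 \<Longrightarrow> Em 1 n = zF n" "\<bar>G (lam2 n)\<bar> < 1 \<Longrightarrow> Ep 1 n = zF n"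
  using Zres_1[OF Zres_ends(1)[of 1 n]] Zres_1[OF Zres_ends(2)[of 1 n]] by (auto simp: Em_def Ep_def)

text \<open>If \<open>\<bar>G\<bar> < 1\<close> at one end, both ends lie in the diamond. An end
  with \<open>\<bar>G\<bar> \<ge> 1\<close> is then a vertex with \<open>F = 0\<close>, so both
  edges equal \<open>zF n\<close> and the gap closes.\<close>

lemma Em_Ep_1: "(Dm (Em 1 n) = 0 \<and> Dm (Ep 1 n) = 0) \<or> Em 1 n \<ge> Ep 1 n"
proof (cases "\<bar>G (lam1 n)\<bar> < 1 \<or> \<bar>G (lam2 n)\<bar> < 1")
  case False
  then show ?thesis using Em_type(1)[of 1 n] Ep_type(1)[of 1 n] by auto
next
  case True
  note dm = in_diamond[OF ordered_of_small[OF True]]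
  have 1: "lam1 n = zF n" if "\<not> \<bar>G (lam1 n)\<bar> < 1"
    using dm[of "lam1 n"] lam_le[of n] that by (intro zF(3)[OF lam_inI(1)]) auto
  have 2: "lam2 n = zF n" if "\<not> \<bar>G (lam2 n)\<bar> < 1"
    using dm[of "lam2 n"] lam_le[of n] that by (intro zF(3)[OF lam_inI(2)]) auto
  have "Em 1 n = zF n" using Em_Ep_1_small(1)[of n] 1 by (cases "\<bar>G (lam1 n)\<bar> < 1") (auto simp: Em_def)
  moreover have "Ep 1 n = zF n" using Em_Ep_1_small(2)[of n] 2 by (cases "\<bar>G (lam2 n)\<bar> < 1") (auto simp: Ep_def)
  ultimately show ?thesis by simp
qed

end

section \<open>Instantiation for the given potential and translation of labels, edges and
  gaps\<close>

context quasi_potential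
begin

lemma real_entire_transfer: "real_entire rth" "real_entire rphd" "real_entire rph"
proof -
  have "f holomorphic_on UNIV" if "\<And>z. \<exists>d. (f has_field_derivative d) (at z)" for f
    using that by (auto simp: holomorphic_on_def field_differentiable_def)
  then have "th holomorphic_on UNIV" "phd holomorphic_on UNIV" "ph holomorphic_on UNIV"
    using deriv_transfer by blast+
  then show "real_entire rth" "real_entire rphd" "real_entire rph"
    unfolding real_entire_def using of_real_transfer by blast+
qed

end

lemma deriv_translate:
  fixes f :: "real \<Rightarrow> real"
  assumes "f differentiable (at (x - m))"
  shows "(\<lambda>x. f (x - m)) differentiable (at x)" "deriv (\<lambda>x. f (x - m)) x = deriv f (x - m)"
proof -
  have "(f has_real_derivative deriv f (x - m)) (at (x - m))"
    using assms by (simp add: DERIV_deriv_iff_real_differentiable)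
  then have "((\<lambda>x. f (x - m)) has_real_derivative deriv f (x - m) * 1) (at x)"
    by (rule DERIV_chain2) (auto intro!: derivative_eq_intros)
  then show "(\<lambda>x. f (x - m)) differentiable (at x)" "deriv (\<lambda>x. f (x - m)) x = deriv f (x - m)"
    by (auto simp: real_differentiable_def DERIV_imp_deriv)
qed

context L2_potential
begin

lemma theta1_fun: "theta1 q = (\<lambda>x. rth (x - qmean))" and phid1_fun: "phid1 q = (\<lambda>x. rphd (x - qmean))"
  using theta1_eq phid1_eq by auto

sublocale hill "theta1 q" "phid1 q" "\<lambda>x. rph (x - qmean)" "\<lambda>x. rthd (x - qmean)" "qmean - QK\<^sup>2"
proof
  fix x b1 b2 b :: real
  show "theta1 q x * phid1 q x - rthd (x - qmean) * rph (x - qmean) = 1"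
    using rwronskian by (simp add: theta1_fun phid1_fun)
  show "theta1 q differentiable at x" "phid1 q differentiable at x" "(\<lambda>x. rph (x - qmean)) differentiable at x"
    unfolding theta1_fun phid1_fun by (rule deriv_translate(1)[OF transfer_differentiable(1)]
        deriv_translate(1)[OF transfer_differentiable(2)] deriv_translate(1)[OF transfer_differentiable(3)])+
  show "(b1 * deriv (theta1 q) x + b2 * deriv (phid1 q) x) * rph (x - qmean) < 0"
    if "b1 > 0" "b2 > 0" "(b1 * theta1 q x + b2 * phid1 q x)\<^sup>2 < 4 * b1 * b2"
    using weighted_trace_deriv[OF that(1,2), of "x - qmean"] that(3)
    unfolding theta1_fun phid1_fun deriv_translate(2)[OF transfer_differentiable(1)]
      deriv_translate(2)[OF transfer_differentiable(2)] by blast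
  show "deriv (\<lambda>x. rph (x - qmean)) x * theta1 q x > 0" if "rph (x - qmean) = 0"
    using dirichlet_simple[OF that]
    unfolding theta1_fun deriv_translate(2)[OF transfer_differentiable(3)] .
  show "theta1 q x > 0 \<and> rthd (x - qmean) > 0 \<and> rph (x - qmean) > 0 \<and> phid1 q x > 0" if "x < qmean - QK\<^sup>2"
    using transfer_pos[of "x - qmean"] that by (simp add: theta1_fun phid1_fun)
  have "filterlim (\<lambda>x. x + (- qmean)) at_top at_top"
    by (rule filterlim_tendsto_add_at_top[OF tendsto_const filterlim_ident, of "- qmean", simplified add.commute])
  then have "filterlim (\<lambda>x. x - qmean) at_top at_top" by simp
  from filterlim_compose[OF transfer_trace_diff_tendsto this]
  show "((\<lambda>x. phid1 q x - theta1 q x) \<longlongrightarrow> 0) at_top" by (simp add: theta1_fun phid1_fun)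
  show "\<exists>x\<ge>b. rph (x - qmean) = 0"
  proof -
    obtain x where "x \<ge> b - qmean" "rph x = 0" using dirichlet_unbounded by blast
    then show ?thesis by (intro exI[of _ "x + qmean"]) auto
  qed
  show "real_entire (theta1 q)" "real_entire (phid1 q)" "real_entire (\<lambda>x. rph (x - qmean))"
    unfolding theta1_fun phid1_fun by (intro real_entire_shift real_entire_transfer)+
qed

lemma Fp_eq: "Fp q x = F x" and Fm_eq: "Fm q x = G x"
  by (simp_all add: Fp_def Fm_def F_def G_def)

lemma ck_sk: "(sk N k a)\<^sup>2 = 1 - (ck N k a)\<^sup>2"
  unfolding sk_def ck_def by (rule sin_squared_eq)

lemma Dminus_eq: "Dminus q N k a = Dm"
proof
  fix x
  have "Dminus q N k a x = (9 * (F x)\<^sup>2 - (G x)\<^sup>2 - 1)\<^sup>2 - 4 * (G x)\<^sup>2"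
    unfolding Dminus_def xik_def rhok_def Fp_eq Fm_eq ck_sk
    by (simp add: field_simps power2_eq_square)
  also have "\<dots> = Dm x" unfolding Dm_def by algebra
  finally show "Dminus q N k a x = Dm x" .
qed

lemma Dplus_eq: "Dplus q N k a = Dp (ck N k a)"
proof
  fix x
  show "Dplus q N k a x = Dp (ck N k a) x"
    unfolding Dplus_def xik_def rhok_def Fp_eq Fm_eq ck_sk Dp_def
    by (simp add: field_simps power2_eq_square)
qed

lemma rhok_eq: "rhok q N k a = rho ((ck N k a)\<^sup>2)"
  by (rule ext) (simp add: rhok_def rho_def Fp_eq Fm_eq ck_sk)

text \<open>Here \<open>j\<close> is n - 1. As \<open>Dminus\<close> does not depend on
  \<open>k\<close> and \<open>a\<close>, the values at \<open>k = 0\<close>, \<open>a = 0\<close>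
  that enter the edges are covered as well.\<close>

lemma lam_odd:
  "lam q N k a False 2 (2 * j + 1) = zseq Dm (4 * j)"
  "lam q N k a False 1 (2 * j + 1) = lam1 j"
  "lam q N k a True 1 (2 * j + 1) = lam2 j"
  "lam q N k a True 2 (2 * j + 1) = zseq Dm (4 * j + 3)"
proof -
  have "lab_idx False 2 (2 * j + 1) = 4 * j" "lab_idx False 1 (2 * j + 1) = 4 * j + 1"
    "lab_idx True 1 (2 * j + 1) = 4 * j + 2" "lab_idx True 2 (2 * j + 1) = 4 * j + 3"
    by (simp_all add: lab_idx_def)
  then show "lam q N k a False 2 (2 * j + 1) = zseq Dm (4 * j)" "lam q N k a False 1 (2 * j + 1) = lam1 j"
    "lam q N k a True 1 (2 * j + 1) = lam2 j" "lam q N k a True 2 (2 * j + 1) = zseq Dm (4 * j + 3)"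
    unfolding Dm_zseq(2,3)[symmetric] lam_def Dminus_eq by simp_all
qed

lemma Eedge_odd:
  "Eedge q N k a False 2 (2 * j + 1) = zseq Dm (4 * j)"
  "Eedge q N k a True 2 (2 * j + 1) = zseq Dm (4 * j + 3)"
  "Eedge q N k a False 1 (2 * j + 1) = Em ((ck N k a)\<^sup>2) j"
  "Eedge q N k a True 1 (2 * j + 1) = Ep ((ck N k a)\<^sup>2) j"
proof -
  show "Eedge q N k a False 2 (2 * j + 1) = zseq Dm (4 * j)" "Eedge q N k a True 2 (2 * j + 1) = zseq Dm (4 * j + 3)"
    by (simp_all only: Eedge_def lam_odd) simp_all
  have r: "rres q N k a sg (Suc j) = (if sg then Max else Min) (Zres ((ck N k a)\<^sup>2) j)" for sg
  proof -
    have "2 * Suc j - 1 = 2 * j + 1" by simp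
    then show ?thesis unfolding rres_def Let_def Zres_def rhok_eq by (simp only: lam_odd) simp
  qed
  have i: "(2 * j + 1 + 1) div 2 = Suc j" "odd (2 * j + 1)" by simp_all
  show "Eedge q N k a False 1 (2 * j + 1) = Em ((ck N k a)\<^sup>2) j" "Eedge q N k a True 1 (2 * j + 1) = Ep ((ck N k a)\<^sup>2) j"
    unfolding Eedge_def lam_odd i r Em_def Ep_def vk_def Fm_eq by simp_all
qed

lemma gap_antiperiodic_eq: "gap q N k a (4 * Suc j - 2) = (Em ((ck N k a)\<^sup>2) j, Ep ((ck N k a)\<^sup>2) j)"
proof -
  have i: "4 * Suc j - 2 = 4 * j + 2" "(4 * j + 2 + 2) div 4 = Suc j" "2 * Suc j - 1 = 2 * j + 1"
    "(4 * j + 2) mod 4 = 2"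
    by simp_all presburger
  show ?thesis unfolding i(1) gap_def i Let_def Eedge_odd by simp
qed

lemma gap_odd_eq:
  "gap q N k a (4 * j + 1) = (zseq Dm (4 * j), zseq (Dp (ck N k a)) (4 * j + 1))"
  "gap q N k a (4 * j + 3) = (zseq (Dp (ck N k a)) (4 * j + 2), zseq Dm (4 * j + 3))"
proof -
  have i: "(4 * j + 1 + 3) div 4 = Suc j" "(4 * j + 3 + 1) div 4 = Suc j" "2 * Suc j - 1 = 2 * j + 1"
    "2 * Suc j - 2 = 2 * j" "(4 * j + 1) mod 4 = 1" "(4 * j + 3) mod 4 = 3"
    by simp_all
  have e: "Eedge q N k a True 1 (2 * j) = zseq (Dp (ck N k a)) (4 * j + 1)"
    "Eedge q N k a False 1 (2 * Suc j) = zseq (Dp (ck N k a)) (4 * j + 2)"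
    by (simp_all add: Eedge_def lam_def lab_idx_def Dplus_eq)
  show "gap q N k a (4 * j + 1) = (zseq Dm (4 * j), zseq (Dp (ck N k a)) (4 * j + 1))"
    unfolding gap_def i Let_def Eedge_odd e by simp
  show "gap q N k a (4 * j + 3) = (zseq (Dp (ck N k a)) (4 * j + 2), zseq Dm (4 * j + 3))"
    unfolding gap_def i Let_def Eedge_odd e by simp
qed

lemma periodic_gap_all: "periodic_gap q N k a (gap q N k a (4 * n))"
proof -
  have c: "(ck N k a)\<^sup>2 \<le> 1" using ck_sk[of N k a] zero_le_power2[of "sk N k a"] by linarith
  have "gap q N k a (4 * n) = (lam q N k a False 2 (2 * n), lam q N k a True 2 (2 * n))"
    by (simp add: gap_def Eedge_def)
  then show ?thesis using Dp_zero[OF c] by (simp add: periodic_gap_def lam_def Dplus_eq)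
qed

text \<open>Residue 1 modulo 4 is the gap at the lower end of antiperiodic group \<open>j\<close>,
  residue 3 the one at its upper end.\<close>

lemma index_odd_cases:
  assumes "n \<ge> (1::nat)"
  obtains j where "2 * n - 1 = 4 * j + 1" "n = 2 * j + 1" | j where "2 * n - 1 = 4 * j + 3" "n = 2 * j + 2"
proof (cases "odd n")
  case True
  then obtain j where "n = 2 * j + 1" by (rule oddE)
  then show ?thesis using that(1)[of j] by simp
next
  case False
  then obtain i where "n = 2 * i" by blast
  then show ?thesis using that(2)[of "i - 1"] assms by simp
qed

lemma pmix_gap_all:
  assumes "n \<ge> 1"
  shows "pmix_gap q N k a (gap q N k a (2 * n - 1))"
proof -
  have c: "(ck N k a)\<^sup>2 \<le> 1" using ck_sk[of N k a] zero_le_power2[of "sk N k a"] by linarith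
  note z = Dp_zero[OF c] Dm_zero
  show ?thesis using assms
    by (rule index_odd_cases) (simp_all only: gap_odd_eq pmix_gap_def Dplus_eq Dminus_eq fst_conv snd_conv z, simp_all)
qed

lemma pmix_gap_empty:
  assumes "sk N k a \<noteq> 0"
  shows "\<exists>n0\<ge>1. \<forall>n\<ge>n0. empty_gap (gap q N k a (2 * n - 1))"
proof -
  have c: "(ck N k a)\<^sup>2 < 1" using ck_sk[of N k a] assms by (smt (verit) zero_less_power2)
  obtain n0 where n0: "\<And>n. n \<ge> n0 \<Longrightarrow> zseq (Dp (ck N k a)) (4 * n + 1) \<le> zseq Dm (4 * n)"
    "\<And>n. n \<ge> n0 \<Longrightarrow> zseq Dm (4 * n + 3) \<le> zseq (Dp (ck N k a)) (4 * n + 2)"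
    using pmix_order[OF c] by blast
  \<comment> \<open>Each group \<open>j\<close> accounts for the two values \<open>2 * j + 1\<close>
    and \<open>2 * j + 2\<close> of \<open>n\<close>, so this witness ensures
    \<open>j \<ge> n0\<close> in both cases.\<close>
  show ?thesis
  proof (intro exI[of _ "2 * n0 + 2"] conjI allI impI)
    fix n assume n: "n \<ge> 2 * n0 + 2"
    then have "n \<ge> 1" by simp
    then show "empty_gap (gap q N k a (2 * n - 1))"
    proof (rule index_odd_cases)
      fix j assume j: "2 * n - 1 = 4 * j + 1" "n = 2 * j + 1"
      then show ?thesis using n0(1)[of j] n unfolding j(1) gap_odd_eq empty_gap_def by simp
    next
      fix j assume j: "2 * n - 1 = 4 * j + 3" "n = 2 * j + 2"
      then show ?thesis using n0(2)[of j] n unfolding j(1) gap_odd_eq empty_gap_def by simp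
    qed
  qed simp
qed

text \<open>The spectral curve then stays on the axis \<open>G = 0\<close>, so v_k is
  \<open>- (ck N k a)\<^sup>2\<close> everywhere and both edges are resonances as soon as c_k is
  nonzero.\<close>

lemma G_zero_of_even:
  assumes "AE t in lborel. t \<in> {0..1} \<longrightarrow> q (1 - t) = q t"
  shows "G x = 0"
  using transfer_reflect[OF Qp_reflect[OF assms], of "x - qmean"] by (simp add: G_def theta1_eq phid1_eq)

lemma eta_eq: "eta q (Suc j) = zF j"
  using F_zero_THE[of j] by (simp add: eta_def Fp_eq)

end

theorem theorem3p6:
  fixes q :: "real \<Rightarrow> real" and N k :: nat and a :: real
  assumes N: "N \<ge> 1"
    and q_meas: "set_borel_measurable lborel {0..1} q"
    and q_L2: "set_integrable lborel {0..1} (\<lambda>t. (q t)\<^sup>2)"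
    and a: "0 \<le> a" "a \<le> pi / (2 * real N)"
    and k: "k < N"
  shows
    "(\<forall>n\<ge>1. periodic_gap q N k a (gap q N k a (4 * n)))
   \<and> (\<forall>n\<ge>1. pmix_gap q N k a (gap q N k a (2 * n - 1)))
   \<and> (sk N k a \<noteq> 0 \<longrightarrow> (\<exists>n0\<ge>1. \<forall>n\<ge>n0. empty_gap (gap q N k a (2 * n - 1))))
   \<and> (\<forall>n\<ge>1. antiperiodic_gap q N k a (gap q N k a (4 * n - 2))
             \<or> resonance_gap q N k a (gap q N k a (4 * n - 2))
             \<or> rmix_gap q N k a (gap q N k a (4 * n - 2)))
   \<and> (\<exists>n0\<ge>1.
        (sk N k a = 0 \<longrightarrow>
           (\<forall>n\<ge>1. antiperiodic_gap q N k a (gap q N k a (4 * n - 2))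
                   \<or> empty_gap (gap q N k a (4 * n - 2)))
           \<and> (\<forall>n\<ge>n0. empty_gap (gap q N k a (4 * n - 2))))
      \<and> (ck N k a \<noteq> 0 \<and> sk N k a \<noteq> 0 \<longrightarrow>
           (\<forall>n\<ge>n0. resonance_gap q N k a (gap q N k a (4 * n - 2))))
      \<and> (ck N k a = 0 \<longrightarrow>
           (\<forall>n\<ge>1. antiperiodic_gap q N k a (gap q N k a (4 * n - 2)))))
   \<and> ((AE t in lborel. t \<in> {0..1} \<longrightarrow> q (1 - t) = q t) \<longrightarrow>
        (\<forall>n\<ge>1.
           (sk N k a = 0 \<longrightarrow>
              Eedge q N k a False 1 (2 * n - 1) = eta q n
              \<and> Eedge q N k a True 1 (2 * n - 1) = eta q n
              \<and> empty_gap (gap q N k a (4 * n - 2)))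
         \<and> (ck N k a \<noteq> 0 \<and> sk N k a \<noteq> 0 \<longrightarrow>
              resonance_gap q N k a (gap q N k a (4 * n - 2)))))"
proof -
  interpret L2_potential q by unfold_locales (fact q_meas q_L2)+
  define c2 where "c2 = (ck N k a)\<^sup>2"
  have c2: "0 \<le> c2" "c2 \<le> 1"
    using ck_sk[of N k a] zero_le_power2[of "sk N k a"] unfolding c2_def by simp_all
  have c2s: "sk N k a = 0 \<Longrightarrow> c2 = 1" using ck_sk[of N k a] by (simp add: c2_def)
  have c2c: "ck N k a \<noteq> 0 \<longleftrightarrow> c2 > 0" by (simp add: c2_def)
  have Suc_all: "(\<forall>n\<ge>Suc m. P n) \<longleftrightarrow> (\<forall>j\<ge>m. P (Suc j))" for m :: nat and P
    by (metis Suc_le_D Suc_le_mono)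
  have ge1_all: "(\<forall>n\<ge>1. P n) \<longleftrightarrow> (\<forall>j. P (Suc j))" for P :: "nat \<Rightarrow> bool"
    by (metis One_nat_def Suc_all le0)
  have gap: "gap q N k a (4 * Suc j - 2) = (Em c2 j, Ep c2 j)" for j
    unfolding c2_def by (rule gap_antiperiodic_eq)
  note defs = antiperiodic_gap_def resonance_gap_def rmix_gap_def empty_gap_def
    Dminus_eq rhok_eq c2_def[symmetric] gap fst_conv snd_conv
  have res: "resonance_gap q N k a (gap q N k a (4 * Suc j - 2))"
    if "\<bar>G (lam1 j)\<bar> < c2" "\<bar>G (lam2 j)\<bar> < c2" for j
    unfolding defs using Em_type(2)[OF c2 that(1)] Ep_type(2)[OF c2 that(2)] by simp
  have edges: "Em c2 j = zF j" "Ep c2 j = zF j" if "sk N k a = 0" "\<bar>G (lam1 j)\<bar> < c2" "\<bar>G (lam2 j)\<bar> < c2" for j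
    using Em_Ep_1_small[of j] that c2s by simp_all
  \<comment> \<open>Four cases according to the sign of v_k at the two ends: equal signs give an
    antiperiodic or a resonance gap, different signs an r-mix gap.\<close>
  have types: "antiperiodic_gap q N k a (gap q N k a (4 * Suc j - 2))
      \<or> resonance_gap q N k a (gap q N k a (4 * Suc j - 2)) \<or> rmix_gap q N k a (gap q N k a (4 * Suc j - 2))" for j
    unfolding defs using Em_type[OF c2, of j] Ep_type[OF c2, of j] by linarith
  have anti0: "antiperiodic_gap q N k a (gap q N k a (4 * Suc j - 2))" if "ck N k a = 0" for j
    unfolding defs using Em_type(1)[OF c2, of j] Ep_type(1)[OF c2, of j] that c2c c2 by simp
  have s0: "antiperiodic_gap q N k a (gap q N k a (4 * Suc j - 2)) \<or> empty_gap (gap q N k a (4 * Suc j - 2))"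
    if "sk N k a = 0" for j
    unfolding defs using Em_Ep_1[of j] c2s[OF that] by simp
  \<comment> \<open>One threshold serves both claims about large \<open>n\<close>, because
    \<open>sk N k a = 0\<close> forces \<open>c2 = 1\<close>. For \<open>ck N k a = 0\<close> the
    condition is vacuous.\<close>
  obtain m where m: "\<And>j. j \<ge> m \<Longrightarrow> ck N k a \<noteq> 0 \<Longrightarrow> \<bar>G (lam1 j)\<bar> < c2 \<and> \<bar>G (lam2 j)\<bar> < c2"
  proof (cases "ck N k a = 0")
    case False
    then show ?thesis using G_small[of c2] c2c lam_inI that by metis
  qed (use that in blast)
  have s0c: "sk N k a = 0 \<Longrightarrow> ck N k a \<noteq> 0" using c2s c2c by simp
  \<comment> \<open>Groups are numbered from 0 and gaps from 1, so the threshold \<open>m\<close>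
    for groups becomes \<open>Suc m\<close>.\<close>
  have A: "\<exists>n0\<ge>1.
        (sk N k a = 0 \<longrightarrow>
           (\<forall>n\<ge>1. antiperiodic_gap q N k a (gap q N k a (4 * n - 2))
                   \<or> empty_gap (gap q N k a (4 * n - 2)))
           \<and> (\<forall>n\<ge>n0. empty_gap (gap q N k a (4 * n - 2))))
      \<and> (ck N k a \<noteq> 0 \<and> sk N k a \<noteq> 0 \<longrightarrow>
           (\<forall>n\<ge>n0. resonance_gap q N k a (gap q N k a (4 * n - 2))))
      \<and> (ck N k a = 0 \<longrightarrow>
           (\<forall>n\<ge>1. antiperiodic_gap q N k a (gap q N k a (4 * n - 2))))"
  proof (intro exI[of _ "Suc m"] conjI impI, unfold ge1_all Suc_all)
    show "1 \<le> Suc m" by simp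
    show "\<forall>j. antiperiodic_gap q N k a (gap q N k a (4 * Suc j - 2)) \<or> empty_gap (gap q N k a (4 * Suc j - 2))"
      if "sk N k a = 0" using s0[OF that] by blast
    show "\<forall>j\<ge>m. empty_gap (gap q N k a (4 * Suc j - 2))" if s: "sk N k a = 0"
    proof (intro allI impI)
      fix j assume "j \<ge> m"
      then show "empty_gap (gap q N k a (4 * Suc j - 2))"
        unfolding defs using edges[OF s, of j] m[of j] s0c[OF s] by simp
    qed
    show "\<forall>j\<ge>m. resonance_gap q N k a (gap q N k a (4 * Suc j - 2))" if "ck N k a \<noteq> 0 \<and> sk N k a \<noteq> 0"
      using res m that by blast
    show "\<forall>j. antiperiodic_gap q N k a (gap q N k a (4 * Suc j - 2))" if "ck N k a = 0"
      using anti0[OF that] by blast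
  qed
  have B: "\<forall>n\<ge>1.
           (sk N k a = 0 \<longrightarrow>
              Eedge q N k a False 1 (2 * n - 1) = eta q n
              \<and> Eedge q N k a True 1 (2 * n - 1) = eta q n
              \<and> empty_gap (gap q N k a (4 * n - 2)))
         \<and> (ck N k a \<noteq> 0 \<and> sk N k a \<noteq> 0 \<longrightarrow>
              resonance_gap q N k a (gap q N k a (4 * n - 2)))"
    if ev: "AE t in lborel. t \<in> {0..1} \<longrightarrow> q (1 - t) = q t"
    unfolding ge1_all
  proof (intro allI impI conjI)
    fix j
    have G: "\<bar>G (lam1 j)\<bar> < c2" "\<bar>G (lam2 j)\<bar> < c2" if "ck N k a \<noteq> 0"
      using G_zero_of_even[OF ev] that c2c by simp_all
    have i: "2 * Suc j - 1 = 2 * j + 1" by simp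
    show "resonance_gap q N k a (gap q N k a (4 * Suc j - 2))" if "ck N k a \<noteq> 0 \<and> sk N k a \<noteq> 0"
      using res G that by blast
    assume s: "sk N k a = 0"
    show "Eedge q N k a False 1 (2 * Suc j - 1) = eta q (Suc j)"
      unfolding i Eedge_odd eta_eq c2_def[symmetric] by (rule edges(1)[OF s G[OF s0c[OF s]]])
    show "Eedge q N k a True 1 (2 * Suc j - 1) = eta q (Suc j)"
      unfolding i Eedge_odd eta_eq c2_def[symmetric] by (rule edges(2)[OF s G[OF s0c[OF s]]])
    show "empty_gap (gap q N k a (4 * Suc j - 2))"
      unfolding defs using edges[OF s G[OF s0c[OF s]]] by simp
  qed
  have C: "\<forall>n\<ge>1. antiperiodic_gap q N k a (gap q N k a (4 * n - 2))
             \<or> resonance_gap q N k a (gap q N k a (4 * n - 2))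
             \<or> rmix_gap q N k a (gap q N k a (4 * n - 2))"
    unfolding ge1_all using types by blast
  show ?thesis
    using periodic_gap_all pmix_gap_all pmix_gap_empty A B C by blast
qed

end
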